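(* Let $R$ be a commutative noetherian ring and let $F$ be a faithfully flat $R$-module. Let $M$ be an $R$-module with $\operatorname{Ext}^{i}_{R}(F,M)=0$ for all $i>0$. Then the $R$-module $\operatorname{Hom}_R(F,M)$ is injective if and only if $M$ is injective. *)

theory Defs
  imports "HOL-Algebra.Module" "HOL-Algebra.AbelCoset" "HOL-Algebra.Ring_Divisibility" "HOL-Library.FSet"
begin

text \<open>
  Modules are those of \<^theory>\<open>HOL-Algebra.Module\<close>. Its record inherits a multiplication and a
  unit from rings; they play no role for modules and are left undefined in the constructions below.
\<close>

section \<open>Homomorphisms, quotients and free modules\<close>

definition module_homs :: "'a ring \<Rightarrow> ('a, 'b) module \<Rightarrow> ('a, 'c) module \<Rightarrow> ('b \<Rightarrow> 'c) set" where
  "module_homs R A B =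
     {h \<in> carrier A \<rightarrow> carrier B.
        (\<forall>x\<in>carrier A. \<forall>y\<in>carrier A. h (x \<oplus>\<^bsub>A\<^esub> y) = h x \<oplus>\<^bsub>B\<^esub> h y) \<and>
        (\<forall>r\<in>carrier R. \<forall>x\<in>carrier A. h (r \<odot>\<^bsub>A\<^esub> x) = r \<odot>\<^bsub>B\<^esub> h x)}"

text \<open>Elements of the Hom module are normalised to be \<open>undefined\<close> outside the source, so that
  equality of homomorphisms is equality of functions.\<close>

definition hom_module :: "'a ring \<Rightarrow> ('a, 'b) module \<Rightarrow> ('a, 'c) module \<Rightarrow> ('a, 'b \<Rightarrow> 'c) module" where
  "hom_module R A B =
     \<lparr>carrier = module_homs R A B \<inter> extensional (carrier A),
      monoid.mult = undefined, one = undefined,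
      ring.zero = (\<lambda>x\<in>carrier A. \<zero>\<^bsub>B\<^esub>),
      ring.add = (\<lambda>f g. \<lambda>x\<in>carrier A. f x \<oplus>\<^bsub>B\<^esub> g x),
      smult = (\<lambda>r f. \<lambda>x\<in>carrier A. r \<odot>\<^bsub>B\<^esub> f x)\<rparr>"

definition quotient_module :: "('a, 'b) module \<Rightarrow> 'b set \<Rightarrow> ('a, 'b set) module" where
  "quotient_module A N =
     \<lparr>carrier = a_rcosets\<^bsub>A\<^esub> N,
      monoid.mult = undefined, one = undefined,
      ring.zero = N,
      ring.add = (\<lambda>X Y. X <+>\<^bsub>A\<^esub> Y),
      smult = (\<lambda>r X. \<Union>x\<in>X. N +>\<^bsub>A\<^esub> (r \<odot>\<^bsub>A\<^esub> x))\<rparr>"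

definition submodule_generated :: "'a ring \<Rightarrow> ('a, 'b) module \<Rightarrow> 'b set \<Rightarrow> 'b set" where
  "submodule_generated R A X = \<Inter>{N. submodule N R A \<and> X \<subseteq> N}"

definition free_module :: "'a ring \<Rightarrow> 's set \<Rightarrow> ('a, 's \<Rightarrow> 'a) module" where
  "free_module R S =
     \<lparr>carrier = {p. (\<forall>s. p s \<in> carrier R) \<and> (\<forall>s. s \<notin> S \<longrightarrow> p s = \<zero>\<^bsub>R\<^esub>) \<and> finite {s. p s \<noteq> \<zero>\<^bsub>R\<^esub>}},
      monoid.mult = undefined, one = undefined,
      ring.zero = (\<lambda>s. \<zero>\<^bsub>R\<^esub>),
      ring.add = (\<lambda>p q s. p s \<oplus>\<^bsub>R\<^esub> q s),
      smult = (\<lambda>r p s. r \<otimes>\<^bsub>R\<^esub> p s)\<rparr>"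

definition free_gen :: "'a ring \<Rightarrow> 's \<Rightarrow> 's \<Rightarrow> 'a" where
  "free_gen R s = (\<lambda>t. if t = s then \<one>\<^bsub>R\<^esub> else \<zero>\<^bsub>R\<^esub>)"

definition linear_extension :: "'a ring \<Rightarrow> ('a, 'b) module \<Rightarrow> ('s \<Rightarrow> 'b) \<Rightarrow> ('s \<Rightarrow> 'a) \<Rightarrow> 'b" where
  "linear_extension R A \<phi> p = (\<Oplus>\<^bsub>A\<^esub>s\<in>{s. p s \<noteq> \<zero>\<^bsub>R\<^esub>}. p s \<odot>\<^bsub>A\<^esub> \<phi> s)"

section \<open>Tensor products and faithful flatness\<close>

definition tensor_relations :: "'a ring \<Rightarrow> ('a, 'b) module \<Rightarrow> ('a, 'c) module \<Rightarrow> ('b \<times> 'c \<Rightarrow> 'a) set" where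
  "tensor_relations R A B =
     (let P = free_module R (carrier A \<times> carrier B); e = (\<lambda>x y. free_gen R (x, y)) in
        {e (x \<oplus>\<^bsub>A\<^esub> x') y \<ominus>\<^bsub>P\<^esub> (e x y \<oplus>\<^bsub>P\<^esub> e x' y) | x x' y.
           x \<in> carrier A \<and> x' \<in> carrier A \<and> y \<in> carrier B} \<union>
        {e x (y \<oplus>\<^bsub>B\<^esub> y') \<ominus>\<^bsub>P\<^esub> (e x y \<oplus>\<^bsub>P\<^esub> e x y') | x y y'.
           x \<in> carrier A \<and> y \<in> carrier B \<and> y' \<in> carrier B} \<union>
        {e (r \<odot>\<^bsub>A\<^esub> x) y \<ominus>\<^bsub>P\<^esub> r \<odot>\<^bsub>P\<^esub> e x y | r x y.
           r \<in> carrier R \<and> x \<in> carrier A \<and> y \<in> carrier B} \<union>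
        {e x (r \<odot>\<^bsub>B\<^esub> y) \<ominus>\<^bsub>P\<^esub> r \<odot>\<^bsub>P\<^esub> e x y | r x y.
           r \<in> carrier R \<and> x \<in> carrier A \<and> y \<in> carrier B})"

definition tensor_kernel :: "'a ring \<Rightarrow> ('a, 'b) module \<Rightarrow> ('a, 'c) module \<Rightarrow> ('b \<times> 'c \<Rightarrow> 'a) set" where
  "tensor_kernel R A B =
     submodule_generated R (free_module R (carrier A \<times> carrier B)) (tensor_relations R A B)"

definition tensor_module ::
    "'a ring \<Rightarrow> ('a, 'b) module \<Rightarrow> ('a, 'c) module \<Rightarrow> ('a, ('b \<times> 'c \<Rightarrow> 'a) set) module" where
  "tensor_module R A B =
     quotient_module (free_module R (carrier A \<times> carrier B)) (tensor_kernel R A B)"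

definition pure_tensor ::
    "'a ring \<Rightarrow> ('a, 'b) module \<Rightarrow> ('a, 'c) module \<Rightarrow> 'b \<Rightarrow> 'c \<Rightarrow> ('b \<times> 'c \<Rightarrow> 'a) set" where
  "pure_tensor R A B x y =
     tensor_kernel R A B +>\<^bsub>free_module R (carrier A \<times> carrier B)\<^esub> free_gen R (x, y)"

text \<open>The homomorphism \<open>F \<otimes> B \<rightarrow> F \<otimes> C\<close> induced by \<open>f : B \<rightarrow> C\<close>.\<close>

definition tensor_map ::
    "'a ring \<Rightarrow> ('a, 'f) module \<Rightarrow> ('a, 'c) module \<Rightarrow> ('b \<Rightarrow> 'c) \<Rightarrow>
     ('f \<times> 'b \<Rightarrow> 'a) set \<Rightarrow> ('f \<times> 'c \<Rightarrow> 'a) set" where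
  "tensor_map R F C f X =
     (let Q = free_module R (carrier F \<times> carrier C) in
        \<Union>p\<in>X. tensor_kernel R F C +>\<^bsub>Q\<^esub>
           linear_extension R Q (\<lambda>(x, y). free_gen R (x, f y)) p)"

definition exact_at ::
    "('a, 'b) module \<Rightarrow> ('a, 'c) module \<Rightarrow> ('a, 'd) module \<Rightarrow> ('b \<Rightarrow> 'c) \<Rightarrow> ('c \<Rightarrow> 'd) \<Rightarrow> bool" where
  "exact_at A B C f g \<longleftrightarrow> f ` carrier A = a_kernel B C g"

text \<open>
  HOL cannot quantify over types inside a definition, so the modules tested against below have their
  carriers in the type \<open>'a\<close> in which \<open>R\<close> itself lives. As \<open>carrier R\<close> is merely a subset of
  \<open>'a\<close>, this type may be chosen arbitrarily large. The choice is in fact immaterial: for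
  injectivity by Baer's criterion (\<open>injective_module_extend\<close> below), and for faithful flatness
  because \<open>R\<close>, its ideals and copies of its residue fields, which suffice as test modules, all
  have carriers in \<open>'a\<close>.
\<close>

definition faithfully_flat :: "'a ring \<Rightarrow> ('a, 'f) module \<Rightarrow> bool" where
  "faithfully_flat R F \<longleftrightarrow> module R F \<and>
     (\<forall>(A :: ('a, 'a) module) (B :: ('a, 'a) module) (C :: ('a, 'a) module) f g.
        module R A \<and> module R B \<and> module R C \<and> f \<in> module_homs R A B \<and> g \<in> module_homs R B C \<longrightarrow>
        (exact_at A B C f g \<longleftrightarrow>
         exact_at (tensor_module R F A) (tensor_module R F B) (tensor_module R F C)
           (tensor_map R F B f) (tensor_map R F C g)))"

definition injective_module :: "'a ring \<Rightarrow> ('a, 'm) module \<Rightarrow> bool" where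
  "injective_module R M \<longleftrightarrow> module R M \<and>
     (\<forall>(A :: ('a, 'a) module) (B :: ('a, 'a) module) i g.
        module R A \<and> module R B \<and> i \<in> module_homs R A B \<and> inj_on i (carrier A) \<and>
        g \<in> module_homs R A M \<longrightarrow>
        (\<exists>h\<in>module_homs R B M. \<forall>x\<in>carrier A. h (i x) = g x))"

section \<open>The standard free resolution and Ext\<close>

text \<open>
  The standard free resolution of \<open>F\<close> has the free module on the set \<open>carrier F\<close> in degree 0 and
  the free module on the set of all elements of the kernel of the preceding map in each further
  degree. To have all degrees in one type, a basis element in positive degree is the
  graph of the nonzero values of the (finitely supported) kernel element that it stands for.
\<close>

datatype ('a, 'f) syzygy = Gen (gen_of: 'f) | Syz "('a \<times> ('a, 'f) syzygy) fset"

definition syz_code :: "'a ring \<Rightarrow> (('a, 'f) syzygy \<Rightarrow> 'a) \<Rightarrow> ('a, 'f) syzygy" where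
  "syz_code R p = Syz (Abs_fset {(p s, s) | s. p s \<noteq> \<zero>\<^bsub>R\<^esub>})"

definition syz_decode :: "'a ring \<Rightarrow> ('a, 'f) syzygy \<Rightarrow> ('a, 'f) syzygy \<Rightarrow> 'a" where
  "syz_decode R = inv_into {p. finite {s. p s \<noteq> \<zero>\<^bsub>R\<^esub>}} (syz_code R)"

definition res_augmentation :: "'a ring \<Rightarrow> ('a, 'f) module \<Rightarrow> (('a, 'f) syzygy \<Rightarrow> 'a) \<Rightarrow> 'f" where
  "res_augmentation R F = linear_extension R F gen_of"

fun res_basis :: "'a ring \<Rightarrow> ('a, 'f) module \<Rightarrow> nat \<Rightarrow> ('a, 'f) syzygy set" where
  "res_basis R F 0 = Gen ` carrier F"
| "res_basis R F (Suc 0) =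
     syz_code R ` a_kernel (free_module R (res_basis R F 0)) F (res_augmentation R F)"
| "res_basis R F (Suc (Suc n)) =
     syz_code R ` a_kernel (free_module R (res_basis R F (Suc n))) (free_module R (res_basis R F n))
       (linear_extension R (free_module R (res_basis R F n)) (syz_decode R))"

definition res_module :: "'a ring \<Rightarrow> ('a, 'f) module \<Rightarrow> nat \<Rightarrow> ('a, ('a, 'f) syzygy \<Rightarrow> 'a) module" where
  "res_module R F n = free_module R (res_basis R F n)"

definition res_boundary ::
    "'a ring \<Rightarrow> ('a, 'f) module \<Rightarrow> nat \<Rightarrow> (('a, 'f) syzygy \<Rightarrow> 'a) \<Rightarrow> (('a, 'f) syzygy \<Rightarrow> 'a)" where
  \<comment> \<open>from degree \<open>Suc n\<close> to degree \<open>n\<close>\<close>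
  "res_boundary R F n = linear_extension R (res_module R F n) (syz_decode R)"

definition ext_cochains ::
    "'a ring \<Rightarrow> nat \<Rightarrow> ('a, 'f) module \<Rightarrow> ('a, 'm) module \<Rightarrow>
     ('a, (('a, 'f) syzygy \<Rightarrow> 'a) \<Rightarrow> 'm) module" where
  "ext_cochains R n F M = hom_module R (res_module R F n) M"

definition ext_coboundary ::
    "'a ring \<Rightarrow> nat \<Rightarrow> ('a, 'f) module \<Rightarrow>
     ((('a, 'f) syzygy \<Rightarrow> 'a) \<Rightarrow> 'm) \<Rightarrow> (('a, 'f) syzygy \<Rightarrow> 'a) \<Rightarrow> 'm" where
  "ext_coboundary R n F h = compose (carrier (res_module R F (Suc n))) h (res_boundary R F n)"

definition ext_cocycles ::
    "'a ring \<Rightarrow> nat \<Rightarrow> ('a, 'f) module \<Rightarrow> ('a, 'm) module \<Rightarrow>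
     ((('a, 'f) syzygy \<Rightarrow> 'a) \<Rightarrow> 'm) set" where
  "ext_cocycles R n F M =
     a_kernel (ext_cochains R n F M) (ext_cochains R (Suc n) F M) (ext_coboundary R n F)"

fun ext_coboundaries ::
    "'a ring \<Rightarrow> nat \<Rightarrow> ('a, 'f) module \<Rightarrow> ('a, 'm) module \<Rightarrow>
     ((('a, 'f) syzygy \<Rightarrow> 'a) \<Rightarrow> 'm) set" where
  "ext_coboundaries R 0 F M = {\<zero>\<^bsub>ext_cochains R 0 F M\<^esub>}"
| "ext_coboundaries R (Suc n) F M = ext_coboundary R n F ` carrier (ext_cochains R n F M)"

definition Ext ::
    "'a ring \<Rightarrow> nat \<Rightarrow> ('a, 'f) module \<Rightarrow> ('a, 'm) module \<Rightarrow>
     ('a, ((('a, 'f) syzygy \<Rightarrow> 'a) \<Rightarrow> 'm) set) module" where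
  "Ext R n F M =
     quotient_module ((ext_cochains R n F M)\<lparr>carrier := ext_cocycles R n F M\<rparr>)
       (ext_coboundaries R n F M)"

section \<open>Basic facts\<close>


lemma module_homsI:
  assumes "\<And>x. x \<in> carrier A \<Longrightarrow> h x \<in> carrier B"
    and "\<And>x y. x \<in> carrier A \<Longrightarrow> y \<in> carrier A \<Longrightarrow> h (x \<oplus>\<^bsub>A\<^esub> y) = h x \<oplus>\<^bsub>B\<^esub> h y"
    and "\<And>r x. r \<in> carrier R \<Longrightarrow> x \<in> carrier A \<Longrightarrow> h (r \<odot>\<^bsub>A\<^esub> x) = r \<odot>\<^bsub>B\<^esub> h x"
  shows "h \<in> module_homs R A B"
  using assms by (auto simp: module_homs_def)

lemma module_homsD:
  assumes "h \<in> module_homs R A B"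
  shows "x \<in> carrier A \<Longrightarrow> h x \<in> carrier B"
    and "x \<in> carrier A \<Longrightarrow> y \<in> carrier A \<Longrightarrow> h (x \<oplus>\<^bsub>A\<^esub> y) = h x \<oplus>\<^bsub>B\<^esub> h y"
    and "r \<in> carrier R \<Longrightarrow> x \<in> carrier A \<Longrightarrow> h (r \<odot>\<^bsub>A\<^esub> x) = r \<odot>\<^bsub>B\<^esub> h x"
  using assms by (auto simp: module_homs_def)

lemma module_homs_zero:
  assumes "module R A" "module R B" "h \<in> module_homs R A B"
  shows "h \<zero>\<^bsub>A\<^esub> = \<zero>\<^bsub>B\<^esub>"
proof -
  interpret A: module R A by fact
  interpret B: module R B by fact
  have "h (\<zero>\<^bsub>R\<^esub> \<odot>\<^bsub>A\<^esub> \<zero>\<^bsub>A\<^esub>) = \<zero>\<^bsub>R\<^esub> \<odot>\<^bsub>B\<^esub> h \<zero>\<^bsub>A\<^esub>"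
    by (intro module_homsD(3)[OF assms(3)]) auto
  then show ?thesis using module_homsD(1)[OF assms(3), of "\<zero>\<^bsub>A\<^esub>"] by simp
qed

section \<open>Independence of injectivity of the type of test modules\<close>

definition ideal_module :: "'a ring \<Rightarrow> 'a set \<Rightarrow> ('a, 'a) module" where
  "ideal_module R I = \<lparr>carrier = I, monoid.mult = undefined, one = undefined,
     ring.zero = \<zero>\<^bsub>R\<^esub>, ring.add = add R, smult = monoid.mult R\<rparr>"

lemma module_ideal_module:
  assumes "cring R" "ideal I R"
  shows "module R (ideal_module R I)"
proof -
  interpret R: cring R by fact
  interpret I: ideal I R by fact
  have neg: "\<ominus>\<^bsub>R\<^esub> x \<in> I" if "x \<in> I" for x using that by simp
  show ?thesis
  proof (rule moduleI)
    show "abelian_group (ideal_module R I)"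
    proof (rule abelian_groupI)
      fix x assume "x \<in> carrier (ideal_module R I)"
      then show "\<exists>y\<in>carrier (ideal_module R I). y \<oplus>\<^bsub>ideal_module R I\<^esub> x = \<zero>\<^bsub>ideal_module R I\<^esub>"
        by (intro bexI[of _ "\<ominus>\<^bsub>R\<^esub> x"]) (auto simp: ideal_module_def R.l_neg)
    qed (auto simp: ideal_module_def R.a_ac I.Icarr)
  qed (use assms(1) in \<open>auto simp: ideal_module_def R.l_distr R.r_distr R.m_assoc I.I_l_closed\<close>)
qed

lemma injective_module_extend:
  fixes A :: "('a, 'b) module" and B :: "('a, 'c) module"
  assumes inj: "injective_module R M" and A: "module R A" and B: "module R B"
    and i: "i \<in> module_homs R A B" "inj_on i (carrier A)" and g: "g \<in> module_homs R A M"
  shows "\<exists>h\<in>module_homs R B M. \<forall>x\<in>carrier A. h (i x) = g x"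
proof -
  have M: "module R M" using inj by (simp add: injective_module_def)
  interpret A: module R A by fact
  interpret B: module R B by fact
  interpret M: module R M by fact
  define P where "P = {G. G \<subseteq> carrier B \<times> carrier M \<and> (\<lambda>x. (i x, g x)) ` carrier A \<subseteq> G \<and>
     (\<forall>b m b' m'. (b, m) \<in> G \<longrightarrow> (b', m') \<in> G \<longrightarrow> (b \<oplus>\<^bsub>B\<^esub> b', m \<oplus>\<^bsub>M\<^esub> m') \<in> G) \<and>
     (\<forall>r b m. r \<in> carrier R \<longrightarrow> (b, m) \<in> G \<longrightarrow> (r \<odot>\<^bsub>B\<^esub> b, r \<odot>\<^bsub>M\<^esub> m) \<in> G) \<and>
     (\<forall>m. (\<zero>\<^bsub>B\<^esub>, m) \<in> G \<longrightarrow> m = \<zero>\<^bsub>M\<^esub>)}"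
  note iD = module_homsD[OF i(1)] and gD = module_homsD[OF g]
  have base: "(\<lambda>x. (i x, g x)) ` carrier A \<in> P"
  proof -
    have "x = \<zero>\<^bsub>A\<^esub>" if "x \<in> carrier A" "i x = \<zero>\<^bsub>B\<^esub>" for x
      using i(2) that module_homs_zero[OF A B i(1)] by (metis A.zero_closed inj_onD)
    then have z: "g x = \<zero>\<^bsub>M\<^esub>" if "x \<in> carrier A" "i x = \<zero>\<^bsub>B\<^esub>" for x
      using that module_homs_zero[OF A M g] by auto
    have 1: "(i x \<oplus>\<^bsub>B\<^esub> i y, g x \<oplus>\<^bsub>M\<^esub> g y) \<in> (\<lambda>x. (i x, g x)) ` carrier A"
      if "x \<in> carrier A" "y \<in> carrier A" for x y
      using that iD gD by (intro image_eqI[of _ _ "x \<oplus>\<^bsub>A\<^esub> y"]) auto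
    have 2: "(r \<odot>\<^bsub>B\<^esub> i x, r \<odot>\<^bsub>M\<^esub> g x) \<in> (\<lambda>x. (i x, g x)) ` carrier A"
      if "x \<in> carrier A" "r \<in> carrier R" for x r
      using that iD gD by (intro image_eqI[of _ _ "r \<odot>\<^bsub>A\<^esub> x"]) auto
    show ?thesis unfolding P_def using iD(1) gD(1) z 1 2 by (auto dest: sym)
  qed
  have "\<exists>G\<in>P. \<forall>X\<in>P. G \<subseteq> X \<longrightarrow> X = G"
  proof (rule subset_Zorn_nonempty)
    show "P \<noteq> {}" using base by blast
    fix C assume C: "C \<noteq> {}" "subset.chain P C"
    then have CP: "C \<subseteq> P" and ch: "\<And>X Y. X \<in> C \<Longrightarrow> Y \<in> C \<Longrightarrow> X \<subseteq> Y \<or> Y \<subseteq> X"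
      by (auto simp: subset_chain_def)
    have "(b \<oplus>\<^bsub>B\<^esub> b', m \<oplus>\<^bsub>M\<^esub> m') \<in> \<Union>C" if h: "(b, m) \<in> X" "X \<in> C" "(b', m') \<in> Y" "Y \<in> C" for b m b' m' X Y
    proof -
      obtain Z where "Z \<in> C" "(b, m) \<in> Z" "(b', m') \<in> Z" using ch[of X Y] h by blast
      then show ?thesis using CP unfolding P_def by blast
    qed
    moreover have "\<Union>C \<subseteq> carrier B \<times> carrier M" using CP unfolding P_def by blast
    moreover have "(\<lambda>x. (i x, g x)) ` carrier A \<subseteq> \<Union>C" using CP C(1) unfolding P_def by blast
    moreover have "\<forall>r b m. r \<in> carrier R \<longrightarrow> (b, m) \<in> \<Union>C \<longrightarrow> (r \<odot>\<^bsub>B\<^esub> b, r \<odot>\<^bsub>M\<^esub> m) \<in> \<Union>C"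
      using CP unfolding P_def by blast
    moreover have "\<forall>m. (\<zero>\<^bsub>B\<^esub>, m) \<in> \<Union>C \<longrightarrow> m = \<zero>\<^bsub>M\<^esub>" using CP unfolding P_def by blast
    ultimately show "\<Union>C \<in> P" unfolding P_def by blast
  qed
  then obtain G where GP: "G \<in> P" and max: "\<And>X. X \<in> P \<Longrightarrow> G \<subseteq> X \<Longrightarrow> X = G" by blast
  have Gc: "b \<in> carrier B" "m \<in> carrier M" if "(b, m) \<in> G" for b m
    using GP that unfolding P_def by auto
  have Gi: "(i x, g x) \<in> G" if "x \<in> carrier A" for x using GP that unfolding P_def by auto
  have Ga: "(b \<oplus>\<^bsub>B\<^esub> b', m \<oplus>\<^bsub>M\<^esub> m') \<in> G" if "(b, m) \<in> G" "(b', m') \<in> G" for b m b' m'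
    using GP that unfolding P_def by auto
  have Gs: "(r \<odot>\<^bsub>B\<^esub> b, r \<odot>\<^bsub>M\<^esub> m) \<in> G" if "r \<in> carrier R" "(b, m) \<in> G" for r b m
    using GP that unfolding P_def by auto
  have Gz: "m = \<zero>\<^bsub>M\<^esub>" if "(\<zero>\<^bsub>B\<^esub>, m) \<in> G" for m
    using GP that unfolding P_def by auto
  have G0: "(\<zero>\<^bsub>B\<^esub>, \<zero>\<^bsub>M\<^esub>) \<in> G"
    using Gi[of "\<zero>\<^bsub>A\<^esub>"] module_homs_zero[OF A B i(1)] module_homs_zero[OF A M g] by simp
  have Gn: "(\<ominus>\<^bsub>B\<^esub> b, \<ominus>\<^bsub>M\<^esub> m) \<in> G" if "(b, m) \<in> G" for b m
    using Gs[of "\<ominus>\<^bsub>R\<^esub> \<one>\<^bsub>R\<^esub>" b m] that Gc[OF that] by (simp add: B.smult_l_minus M.smult_l_minus)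
  have Gu: "m = m'" if "(b, m) \<in> G" "(b, m') \<in> G" for b m m'
  proof -
    have "(b \<oplus>\<^bsub>B\<^esub> \<ominus>\<^bsub>B\<^esub> b, m \<oplus>\<^bsub>M\<^esub> \<ominus>\<^bsub>M\<^esub> m') \<in> G" using Ga Gn that by blast
    then have "m \<oplus>\<^bsub>M\<^esub> \<ominus>\<^bsub>M\<^esub> m' = \<zero>\<^bsub>M\<^esub>" using Gz Gc[OF that(1)] by (simp add: B.r_neg)
    then show ?thesis using Gc that by (metis M.add.inv_closed M.add.inv_inv M.minus_equality M.a_comm)
  qed
  have total: "\<exists>m. (b, m) \<in> G" if b: "b \<in> carrier B" for b
  proof -
    define I where "I = {r \<in> carrier R. \<exists>m. (r \<odot>\<^bsub>B\<^esub> b, m) \<in> G}"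
    define k where "k = (\<lambda>r. THE m. (r \<odot>\<^bsub>B\<^esub> b, m) \<in> G)"
    have k: "k r = m" if "(r \<odot>\<^bsub>B\<^esub> b, m) \<in> G" for r m
      unfolding k_def using that Gu by blast
    have kG: "(r \<odot>\<^bsub>B\<^esub> b, k r) \<in> G" if "r \<in> I" for r using that k unfolding I_def by auto
    have R: "cring R" by (rule A.R.cring_axioms)
    have ideal: "ideal I R"
    proof (rule idealI)
      show "ring R" by (rule A.R.ring_axioms)
      show "subgroup I (add_monoid R)"
      proof (rule A.R.add.subgroupI)
        show "I \<subseteq> carrier R" by (auto simp: I_def)
        show "I \<noteq> {}" using G0 b by (auto simp: I_def intro!: exI[of _ "\<zero>\<^bsub>R\<^esub>"])
        fix r assume r: "r \<in> I"
        then show "\<ominus>\<^bsub>R\<^esub> r \<in> I" using Gn[OF kG[OF r]] b by (auto simp: I_def B.smult_l_minus)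
        fix s assume s: "s \<in> I"
        then show "r \<oplus>\<^bsub>R\<^esub> s \<in> I" using Ga[OF kG[OF r] kG[OF s]] r b by (auto simp: I_def B.smult_l_distr)
      qed
      fix r s assume rs: "r \<in> I" "s \<in> carrier R"
      then show "s \<otimes>\<^bsub>R\<^esub> r \<in> I" using Gs[OF rs(2) kG[OF rs(1)]] b by (auto simp: I_def B.smult_assoc1)
      then show "r \<otimes>\<^bsub>R\<^esub> s \<in> I" using rs A.R.m_comm by (auto simp: I_def)
    qed
    have ideal1: "ideal (carrier R) R" by (rule A.R.oneideal)
    have kI: "k \<in> module_homs R (ideal_module R I) M"
    proof (rule module_homsI)
      fix r assume "r \<in> carrier (ideal_module R I)"
      then have r: "r \<in> I" by (simp add: ideal_module_def)
      then show "k r \<in> carrier M" using Gc kG by blast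
      fix s
      show "k (r \<oplus>\<^bsub>ideal_module R I\<^esub> s) = k r \<oplus>\<^bsub>M\<^esub> k s" if "s \<in> carrier (ideal_module R I)"
        using Ga[OF kG[OF r] kG[of s]] r that b
        by (intro k) (auto simp: ideal_module_def I_def B.smult_l_distr)
      show "k (s \<odot>\<^bsub>ideal_module R I\<^esub> r) = s \<odot>\<^bsub>M\<^esub> k r" if "s \<in> carrier R"
        using Gs[OF that kG[OF r]] r that b
        by (intro k) (auto simp: ideal_module_def I_def B.smult_assoc1)
    qed
    have idh: "id \<in> module_homs R (ideal_module R I) (ideal_module R (carrier R))"
      by (rule module_homsI) (auto simp: ideal_module_def I_def)
    have "\<exists>h\<in>module_homs R (ideal_module R (carrier R)) M. \<forall>x\<in>carrier (ideal_module R I). h (id x) = k x"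
      using inj module_ideal_module[OF R ideal] module_ideal_module[OF R ideal1] idh kI
      unfolding injective_module_def by (metis inj_on_id)
    then obtain h where h: "h \<in> module_homs R (ideal_module R (carrier R)) M" and hk: "\<And>r. r \<in> I \<Longrightarrow> h r = k r"
      by (auto simp: ideal_module_def)
    define m where "m = h \<one>\<^bsub>R\<^esub>"
    have m: "m \<in> carrier M" using module_homsD(1)[OF h] by (simp add: m_def ideal_module_def)
    have hr: "h r = r \<odot>\<^bsub>M\<^esub> m" if "r \<in> carrier R" for r
      using module_homsD(3)[OF h, of r "\<one>\<^bsub>R\<^esub>"] that by (simp add: m_def ideal_module_def)
    have Im: "(r \<odot>\<^bsub>B\<^esub> b, r \<odot>\<^bsub>M\<^esub> m) \<in> G" if "r \<in> I" for r
      using kG[OF that] hk[OF that] hr that by (simp add: I_def)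
    define G' where "G' = {(c \<oplus>\<^bsub>B\<^esub> r \<odot>\<^bsub>B\<^esub> b, n \<oplus>\<^bsub>M\<^esub> r \<odot>\<^bsub>M\<^esub> m) | c n r. (c, n) \<in> G \<and> r \<in> carrier R}"
    have G'I: "(c \<oplus>\<^bsub>B\<^esub> r \<odot>\<^bsub>B\<^esub> b, n \<oplus>\<^bsub>M\<^esub> r \<odot>\<^bsub>M\<^esub> m) \<in> G'" if "(c, n) \<in> G" "r \<in> carrier R" for c n r
      using that unfolding G'_def by blast
    have sub: "G \<subseteq> G'"
    proof
      fix z assume z: "z \<in> G"
      obtain c n where zc: "z = (c, n)" by (cases z)
      show "z \<in> G'" using G'I[of c n "\<zero>\<^bsub>R\<^esub>"] z zc Gc[of c n] b m by simp
    qed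
    have "G' \<in> P"
    proof -
      have 1: "G' \<subseteq> carrier B \<times> carrier M" using Gc b m by (auto simp: G'_def)
      have 2: "(\<lambda>x. (i x, g x)) ` carrier A \<subseteq> G'" using Gi sub by blast
      have 3: "(c \<oplus>\<^bsub>B\<^esub> c', n \<oplus>\<^bsub>M\<^esub> n') \<in> G'" if "(c, n) \<in> G'" "(c', n') \<in> G'" for c n c' n'
      proof -
        from that obtain d p r d' p' r' where
          e: "(d, p) \<in> G" "r \<in> carrier R" "c = d \<oplus>\<^bsub>B\<^esub> r \<odot>\<^bsub>B\<^esub> b" "n = p \<oplus>\<^bsub>M\<^esub> r \<odot>\<^bsub>M\<^esub> m"
             "(d', p') \<in> G" "r' \<in> carrier R" "c' = d' \<oplus>\<^bsub>B\<^esub> r' \<odot>\<^bsub>B\<^esub> b" "n' = p' \<oplus>\<^bsub>M\<^esub> r' \<odot>\<^bsub>M\<^esub> m"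
          unfolding G'_def by blast
        have "c \<oplus>\<^bsub>B\<^esub> c' = (d \<oplus>\<^bsub>B\<^esub> d') \<oplus>\<^bsub>B\<^esub> (r \<oplus>\<^bsub>R\<^esub> r') \<odot>\<^bsub>B\<^esub> b"
          using e Gc b by (simp add: B.smult_l_distr B.a_ac)
        moreover have "n \<oplus>\<^bsub>M\<^esub> n' = (p \<oplus>\<^bsub>M\<^esub> p') \<oplus>\<^bsub>M\<^esub> (r \<oplus>\<^bsub>R\<^esub> r') \<odot>\<^bsub>M\<^esub> m"
          using e Gc m by (simp add: M.smult_l_distr M.a_ac)
        ultimately show ?thesis using G'I[OF Ga[OF e(1) e(5)]] e by simp
      qed
      have 4: "(s \<odot>\<^bsub>B\<^esub> c, s \<odot>\<^bsub>M\<^esub> n) \<in> G'" if "s \<in> carrier R" "(c, n) \<in> G'" for s c n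
      proof -
        from that obtain d p r where
          e: "(d, p) \<in> G" "r \<in> carrier R" "c = d \<oplus>\<^bsub>B\<^esub> r \<odot>\<^bsub>B\<^esub> b" "n = p \<oplus>\<^bsub>M\<^esub> r \<odot>\<^bsub>M\<^esub> m"
          unfolding G'_def by blast
        then show ?thesis using G'I[OF Gs[OF that(1) e(1)], of "s \<otimes>\<^bsub>R\<^esub> r"] that Gc b m
          by (simp add: B.smult_assoc1 M.smult_assoc1 B.smult_r_distr M.smult_r_distr)
      qed
      have 5: "n = \<zero>\<^bsub>M\<^esub>" if "(\<zero>\<^bsub>B\<^esub>, n) \<in> G'" for n
      proof -
        from that obtain d p r where
          e: "(d, p) \<in> G" "r \<in> carrier R" "\<zero>\<^bsub>B\<^esub> = d \<oplus>\<^bsub>B\<^esub> r \<odot>\<^bsub>B\<^esub> b" "n = p \<oplus>\<^bsub>M\<^esub> r \<odot>\<^bsub>M\<^esub> m"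
          unfolding G'_def by blast
        note dc = Gc[OF e(1)]
        have "r \<odot>\<^bsub>B\<^esub> b = \<ominus>\<^bsub>B\<^esub> d"
          using e dc b by (metis B.a_comm B.minus_equality B.smult_closed)
        then have "(r \<odot>\<^bsub>B\<^esub> b, \<ominus>\<^bsub>M\<^esub> p) \<in> G" using Gn[OF e(1)] by simp
        moreover from this have "r \<in> I" using e by (auto simp: I_def)
        ultimately have "r \<odot>\<^bsub>M\<^esub> m = \<ominus>\<^bsub>M\<^esub> p" using Im Gu by blast
        then show ?thesis using e dc by (simp add: M.r_neg)
      qed
      show ?thesis unfolding P_def using 1 2 3 4 5 by blast
    qed
    then have "G' = G" using max sub by blast
    moreover have "(\<zero>\<^bsub>B\<^esub> \<oplus>\<^bsub>B\<^esub> \<one>\<^bsub>R\<^esub> \<odot>\<^bsub>B\<^esub> b, \<zero>\<^bsub>M\<^esub> \<oplus>\<^bsub>M\<^esub> \<one>\<^bsub>R\<^esub> \<odot>\<^bsub>M\<^esub> m) \<in> G'"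
      by (rule G'I[OF G0]) simp
    ultimately show ?thesis using b m by auto
  qed
  define h where "h = (\<lambda>b. THE m. (b, m) \<in> G)"
  have hI: "h b = m" if "(b, m) \<in> G" for b m
    unfolding h_def using that Gu by blast
  have hG: "(b, h b) \<in> G" if "b \<in> carrier B" for b using total[OF that] hI by auto
  have "h \<in> module_homs R B M"
    by (rule module_homsI) (auto intro: hI Ga Gs hG Gc(2)[OF hG])
  moreover have "\<forall>x\<in>carrier A. h (i x) = g x" using Gi hI by blast
  ultimately show ?thesis by blast
qed


section \<open>Free modules and exactness of the standard resolution\<close>

lemma free_module_simps:
  "\<zero>\<^bsub>free_module R S\<^esub> = (\<lambda>s. \<zero>\<^bsub>R\<^esub>)"
  "p \<oplus>\<^bsub>free_module R S\<^esub> q = (\<lambda>s. p s \<oplus>\<^bsub>R\<^esub> q s)"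
  "r \<odot>\<^bsub>free_module R S\<^esub> p = (\<lambda>s. r \<otimes>\<^bsub>R\<^esub> p s)"
  by (simp_all add: free_module_def)

lemma free_module_carrier:
  "p \<in> carrier (free_module R S) \<longleftrightarrow>
     (\<forall>s. p s \<in> carrier R) \<and> (\<forall>s. s \<notin> S \<longrightarrow> p s = \<zero>\<^bsub>R\<^esub>) \<and> finite {s. p s \<noteq> \<zero>\<^bsub>R\<^esub>}"
  by (simp add: free_module_def)

lemma module_free_module:
  assumes "cring R"
  shows "module R (free_module R S)"
proof -
  interpret R: cring R by fact
  have add: "(\<lambda>s. p s \<oplus>\<^bsub>R\<^esub> q s) \<in> carrier (free_module R S)"
    if "p \<in> carrier (free_module R S)" "q \<in> carrier (free_module R S)" for p q
  proof -
    have "{s. p s \<oplus>\<^bsub>R\<^esub> q s \<noteq> \<zero>\<^bsub>R\<^esub>} \<subseteq> {s. p s \<noteq> \<zero>\<^bsub>R\<^esub>} \<union> {s. q s \<noteq> \<zero>\<^bsub>R\<^esub>}" by auto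
    moreover have "finite ({s. p s \<noteq> \<zero>\<^bsub>R\<^esub>} \<union> {s. q s \<noteq> \<zero>\<^bsub>R\<^esub>})" using that by (simp add: free_module_carrier)
    ultimately have "finite {s. p s \<oplus>\<^bsub>R\<^esub> q s \<noteq> \<zero>\<^bsub>R\<^esub>}" by (rule finite_subset)
    then show ?thesis using that by (simp add: free_module_carrier)
  qed
  have smult: "(\<lambda>s. r \<otimes>\<^bsub>R\<^esub> p s) \<in> carrier (free_module R S)"
    if "p \<in> carrier (free_module R S)" "r \<in> carrier R" for p r
  proof -
    have "{s. r \<otimes>\<^bsub>R\<^esub> p s \<noteq> \<zero>\<^bsub>R\<^esub>} \<subseteq> {s. p s \<noteq> \<zero>\<^bsub>R\<^esub>}" using that by auto
    moreover have "finite {s. p s \<noteq> \<zero>\<^bsub>R\<^esub>}" using that by (simp add: free_module_carrier)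
    ultimately have "finite {s. r \<otimes>\<^bsub>R\<^esub> p s \<noteq> \<zero>\<^bsub>R\<^esub>}" by (rule finite_subset)
    then show ?thesis using that by (simp add: free_module_carrier)
  qed
  have neg: "(\<lambda>s. \<ominus>\<^bsub>R\<^esub> p s) \<in> carrier (free_module R S)" if "p \<in> carrier (free_module R S)" for p
  proof -
    have "(\<lambda>s. \<ominus>\<^bsub>R\<^esub> p s) = (\<lambda>s. (\<ominus>\<^bsub>R\<^esub> \<one>\<^bsub>R\<^esub>) \<otimes>\<^bsub>R\<^esub> p s)"
      using that by (auto simp: free_module_carrier R.l_minus)
    then show ?thesis using smult[OF that, of "\<ominus>\<^bsub>R\<^esub> \<one>\<^bsub>R\<^esub>"] by simp
  qed
  show ?thesis
  proof (rule moduleI)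
    show "abelian_group (free_module R S)"
    proof (rule abelian_groupI)
      fix p assume "p \<in> carrier (free_module R S)"
      then show "\<exists>q\<in>carrier (free_module R S). q \<oplus>\<^bsub>free_module R S\<^esub> p = \<zero>\<^bsub>free_module R S\<^esub>"
        by (intro bexI[OF _ neg]) (auto simp: free_module_carrier free_module_simps R.l_neg)
    qed (simp_all add: add free_module_simps, simp_all add: free_module_carrier R.a_ac)
  qed (simp_all add: assms smult free_module_simps, simp_all add: free_module_carrier R.l_distr R.r_distr R.m_assoc)
qed

lemma linear_extension_superset:
  assumes "module R A" "p \<in> carrier (free_module R S)" "\<phi> \<in> S \<rightarrow> carrier A"
    "finite T" "{s. p s \<noteq> \<zero>\<^bsub>R\<^esub>} \<subseteq> T" "T \<subseteq> S"
  shows "linear_extension R A \<phi> p = (\<Oplus>\<^bsub>A\<^esub>s\<in>T. p s \<odot>\<^bsub>A\<^esub> \<phi> s)"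
proof -
  interpret A: module R A by fact
  show ?thesis unfolding linear_extension_def
    by (rule A.add.finprod_mono_neutral_cong_left)
      (use assms in \<open>auto simp: free_module_carrier Pi_def subset_iff\<close>)
qed

lemma linear_extension_hom:
  assumes "module R A" "\<phi> \<in> S \<rightarrow> carrier A"
  shows "linear_extension R A \<phi> \<in> module_homs R (free_module R S) A"
proof -
  interpret A: module R A by fact
  have supp: "{s. p s \<noteq> \<zero>\<^bsub>R\<^esub>} \<subseteq> S" "finite {s. p s \<noteq> \<zero>\<^bsub>R\<^esub>}" "p s \<in> carrier R"
    if "p \<in> carrier (free_module R S)" for p s
    using that by (auto simp: free_module_carrier)
  interpret P: module R "free_module R S" by (rule module_free_module) (rule A.R.cring_axioms)
  show ?thesis
  proof (rule module_homsI)
    fix p assume p: "p \<in> carrier (free_module R S)"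
    note le = linear_extension_superset[OF assms(1) _ assms(2)]
    show "linear_extension R A \<phi> p \<in> carrier A" unfolding linear_extension_def
      using p assms(2) supp[OF p] by (intro A.finsum_closed) (auto simp: subset_iff)
    show "linear_extension R A \<phi> (p \<oplus>\<^bsub>free_module R S\<^esub> q) =
        linear_extension R A \<phi> p \<oplus>\<^bsub>A\<^esub> linear_extension R A \<phi> q"
      if q: "q \<in> carrier (free_module R S)" for q
    proof -
      let ?T = "{s. p s \<noteq> \<zero>\<^bsub>R\<^esub>} \<union> {s. q s \<noteq> \<zero>\<^bsub>R\<^esub>}"
      have T: "finite ?T" "?T \<subseteq> S" using supp[OF p] supp[OF q] by auto
      have pq: "p \<oplus>\<^bsub>free_module R S\<^esub> q \<in> carrier (free_module R S)" using p q by (rule P.a_closed)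
      have "linear_extension R A \<phi> (p \<oplus>\<^bsub>free_module R S\<^esub> q) = 
         (\<Oplus>\<^bsub>A\<^esub>s\<in>?T. (p \<oplus>\<^bsub>free_module R S\<^esub> q) s \<odot>\<^bsub>A\<^esub> \<phi> s)"
        using T by (intro le pq) (auto simp: free_module_simps)
      also have "\<dots> = (\<Oplus>\<^bsub>A\<^esub>s\<in>?T. p s \<odot>\<^bsub>A\<^esub> \<phi> s \<oplus>\<^bsub>A\<^esub> q s \<odot>\<^bsub>A\<^esub> \<phi> s)"
        using T supp(3)[OF p] supp(3)[OF q] assms(2)
        by (intro A.finsum_cong') (auto simp: free_module_simps A.smult_l_distr Pi_def subset_iff)
      also have "\<dots> = (\<Oplus>\<^bsub>A\<^esub>s\<in>?T. p s \<odot>\<^bsub>A\<^esub> \<phi> s) \<oplus>\<^bsub>A\<^esub> (\<Oplus>\<^bsub>A\<^esub>s\<in>?T. q s \<odot>\<^bsub>A\<^esub> \<phi> s)"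
        using T supp(3)[OF p] supp(3)[OF q] assms(2)
        by (intro A.finsum_addf) (auto simp: Pi_def subset_iff)
      also have "\<dots> = linear_extension R A \<phi> p \<oplus>\<^bsub>A\<^esub> linear_extension R A \<phi> q"
        using T by (subst (1 2) le[of _ ?T]) (auto simp: p q)
      finally show ?thesis .
    qed
    show "linear_extension R A \<phi> (r \<odot>\<^bsub>free_module R S\<^esub> p) = r \<odot>\<^bsub>A\<^esub> linear_extension R A \<phi> p"
      if r: "r \<in> carrier R" for r
    proof -
      let ?T = "{s. p s \<noteq> \<zero>\<^bsub>R\<^esub>}"
      have T: "finite ?T" "?T \<subseteq> S" using supp[OF p] by auto
      have rp: "r \<odot>\<^bsub>free_module R S\<^esub> p \<in> carrier (free_module R S)" using r p by (rule P.smult_closed)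
      have "linear_extension R A \<phi> (r \<odot>\<^bsub>free_module R S\<^esub> p) = 
         (\<Oplus>\<^bsub>A\<^esub>s\<in>?T. (r \<odot>\<^bsub>free_module R S\<^esub> p) s \<odot>\<^bsub>A\<^esub> \<phi> s)"
        using T r by (intro le rp) (auto simp: free_module_simps)
      also have "\<dots> = (\<Oplus>\<^bsub>A\<^esub>s\<in>?T. r \<odot>\<^bsub>A\<^esub> (p s \<odot>\<^bsub>A\<^esub> \<phi> s))"
        using T supp(3)[OF p] assms(2) r
        by (intro A.finsum_cong') (auto simp: free_module_simps A.smult_assoc1 Pi_def subset_iff)
      also have "\<dots> = r \<odot>\<^bsub>A\<^esub> linear_extension R A \<phi> p" unfolding linear_extension_def
        using T supp(3)[OF p] assms(2) r
        by (intro A.finsum_smult_ldistr[symmetric]) (auto simp: Pi_def subset_iff)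
      finally show ?thesis .
    qed
  qed
qed

lemma free_gen_closed:
  assumes "cring R" "s \<in> S"
  shows "free_gen R s \<in> carrier (free_module R S)"
proof -
  interpret R: cring R by fact
  have "{t. free_gen R s t \<noteq> \<zero>\<^bsub>R\<^esub>} \<subseteq> {s}" by (auto simp: free_gen_def)
  then show ?thesis using assms by (auto simp: free_module_carrier free_gen_def dest: finite_subset)
qed

lemma linear_extension_gen:
  assumes "module R A" "\<phi> \<in> S \<rightarrow> carrier A" "s \<in> S"
  shows "linear_extension R A \<phi> (free_gen R s) = \<phi> s"
proof -
  interpret A: module R A by fact
  have "linear_extension R A \<phi> (free_gen R s) = (\<Oplus>\<^bsub>A\<^esub>t\<in>{s}. free_gen R s t \<odot>\<^bsub>A\<^esub> \<phi> t)"
    by (rule linear_extension_superset[OF assms(1) free_gen_closed assms(2)])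
      (use assms(3) A.R.cring_axioms in \<open>auto simp: free_gen_def\<close>)
  then show ?thesis using assms(2,3) by (auto simp: free_gen_def Pi_def A.add.finprod_insert)
qed

lemma syz_code_inj: "inj_on (syz_code R) {p. finite {s. p s \<noteq> \<zero>\<^bsub>R\<^esub>}}"
proof (rule inj_onI)
  fix p q assume fin: "p \<in> {p. finite {s. p s \<noteq> \<zero>\<^bsub>R\<^esub>}}" "q \<in> {p. finite {s. p s \<noteq> \<zero>\<^bsub>R\<^esub>}}"
    and eq: "syz_code R p = syz_code R q"
  have gr: "{(p s, s) | s. p s \<noteq> \<zero>\<^bsub>R\<^esub>} = (\<lambda>s. (p s, s)) ` {s. p s \<noteq> \<zero>\<^bsub>R\<^esub>}" for p :: "('a, 'b) syzygy \<Rightarrow> 'a"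
    by auto
  have "{(p s, s) | s. p s \<noteq> \<zero>\<^bsub>R\<^esub>} = {(q s, s) | s. q s \<noteq> \<zero>\<^bsub>R\<^esub>}"
    using eq fin unfolding syz_code_def by (simp add: Abs_fset_inject gr)
  then have iff: "(a = p s \<and> p s \<noteq> \<zero>\<^bsub>R\<^esub>) \<longleftrightarrow> (a = q s \<and> q s \<noteq> \<zero>\<^bsub>R\<^esub>)" for a s
    by (auto simp: set_eq_iff)
  show "p = q"
  proof
    show "p s = q s" for s using iff[of "p s" s] iff[of "q s" s] by metis
  qed
qed

lemma syz_decode_code: "finite {s. p s \<noteq> \<zero>\<^bsub>R\<^esub>} \<Longrightarrow> syz_decode R (syz_code R p) = p"
  unfolding syz_decode_def by (rule inv_into_f_f[OF syz_code_inj]) simp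

lemma a_kernel_iff: "x \<in> a_kernel G H h \<longleftrightarrow> x \<in> carrier G \<and> h x = \<zero>\<^bsub>H\<^esub>"
  by (simp add: a_kernel_def kernel_def)

lemma free_cover:
  assumes R: "cring R" and Z: "Z \<subseteq> carrier (free_module R S)" and D: "module R D"
    and f: "f \<in> module_homs R (free_module R S) D" and Zdef: "Z = a_kernel (free_module R S) D f"
  shows "linear_extension R (free_module R S) (syz_decode R) ` carrier (free_module R (syz_code R ` Z)) = Z"
proof -
  interpret P: module R "free_module R S" by (rule module_free_module[OF R])
  interpret D: module R D by fact
  have dec: "syz_decode R (syz_code R z) = z" if "z \<in> Z" for z
    using that Z by (intro syz_decode_code) (auto simp: free_module_carrier)
  then have phi: "syz_decode R \<in> syz_code R ` Z \<rightarrow> carrier (free_module R S)" using Z by auto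
  note fD = module_homsD[OF f]
  have "submodule Z R (free_module R S)"
  proof (rule P.submoduleI)
    show "Z \<subseteq> carrier (free_module R S)" by fact
    show "\<zero>\<^bsub>free_module R S\<^esub> \<in> Z"
      unfolding Zdef a_kernel_iff
      using module_homs_zero[OF P.module_axioms D f] P.zero_closed by blast
    show add: "a \<oplus>\<^bsub>free_module R S\<^esub> b \<in> Z" if "a \<in> Z" "b \<in> Z" for a b
    proof -
      have *: "a \<in> carrier (free_module R S)" "b \<in> carrier (free_module R S)" "f a = \<zero>\<^bsub>D\<^esub>" "f b = \<zero>\<^bsub>D\<^esub>"
        using that unfolding Zdef a_kernel_iff by auto
      show ?thesis unfolding Zdef a_kernel_iff fD(2)[OF *(1,2)] *(3,4)
        using P.a_closed[OF *(1,2)] D.l_zero[OF D.zero_closed] by blast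
    qed
    show sm: "a \<odot>\<^bsub>free_module R S\<^esub> x \<in> Z" if a: "a \<in> carrier R" "x \<in> Z" for a x
    proof -
      have *: "x \<in> carrier (free_module R S)" "f x = \<zero>\<^bsub>D\<^esub>"
        using that unfolding Zdef a_kernel_iff by auto
      show ?thesis unfolding Zdef a_kernel_iff fD(3)[OF a(1) *(1)] *(2)
        using P.smult_closed[OF a(1) *(1)] D.smult_r_null[OF a(1)] by blast
    qed
    show "\<ominus>\<^bsub>free_module R S\<^esub> a \<in> Z" if a: "a \<in> Z" for a
    proof -
      have ac: "a \<in> carrier (free_module R S)" using a Z by blast
      have "(\<ominus>\<^bsub>R\<^esub> \<one>\<^bsub>R\<^esub>) \<odot>\<^bsub>free_module R S\<^esub> a \<in> Z" by (rule sm[OF _ a]) simp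
      then show ?thesis
        unfolding P.smult_l_minus[OF P.R.one_closed ac] P.smult_one[OF ac] .
    qed
  qed
  then interpret ZM: module R "(free_module R S)\<lparr>carrier := Z\<rparr>"
    using submodule.submodule_is_module[OF _ P.module_axioms] by blast
  have inZ: "linear_extension R (free_module R S) (syz_decode R) p \<in> Z"
    if p: "p \<in> carrier (free_module R (syz_code R ` Z))" for p
  proof -
    let ?L = "linear_extension R (free_module R S) (syz_decode R)"
    have eq: "f (\<Oplus>\<^bsub>free_module R S\<^esub>s\<in>T. p s \<odot>\<^bsub>free_module R S\<^esub> syz_decode R s) = \<zero>\<^bsub>D\<^esub>"
      if "finite T" "T \<subseteq> syz_code R ` Z" for T
      using that
    proof (induction T)
      case empty
      then show ?case using module_homs_zero[OF P.module_axioms D f] by (simp add: P.finsum_empty)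
    next
      case (insert t T)
      have c: "p s \<odot>\<^bsub>free_module R S\<^esub> syz_decode R s \<in> carrier (free_module R S)" if "s \<in> syz_code R ` Z" for s
        by (rule P.smult_closed[OF _ funcset_mem[OF phi that]]) (use p in \<open>simp add: free_module_carrier\<close>)
      have z: "f (p t \<odot>\<^bsub>free_module R S\<^esub> syz_decode R t) = \<zero>\<^bsub>D\<^esub>"
      proof -
        have "syz_decode R t \<in> Z" using insert.prems dec by auto
        moreover have "p t \<in> carrier R" using p by (simp add: free_module_carrier)
        ultimately show ?thesis using fD(3)[of "p t" "syz_decode R t"] D.smult_r_null[of "p t"]
          unfolding Zdef a_kernel_iff by simp
      qed
      define w where "w = (\<lambda>s. p s \<odot>\<^bsub>free_module R S\<^esub> syz_decode R s)"
      have wc: "w \<in> T \<rightarrow> carrier (free_module R S)" "w t \<in> carrier (free_module R S)"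
        using c insert.prems by (auto simp: w_def)
      have "f (finsum (free_module R S) w (insert t T)) =
          f (w t \<oplus>\<^bsub>free_module R S\<^esub> finsum (free_module R S) w T)"
        by (subst P.finsum_insert) (use insert.hyps wc in auto)
      also have "\<dots> = f (w t) \<oplus>\<^bsub>D\<^esub> f (finsum (free_module R S) w T)"
        by (rule fD(2)[OF wc(2) P.finsum_closed[OF wc(1)]])
      also have "\<dots> = \<zero>\<^bsub>D\<^esub>" using insert z by (simp add: w_def)
      finally show ?case unfolding w_def .
    qed
    have "f (?L p) = \<zero>\<^bsub>D\<^esub>" unfolding linear_extension_def
      using p by (intro eq) (auto simp: free_module_carrier)
    then show ?thesis using module_homsD(1)[OF linear_extension_hom[OF P.module_axioms phi] p]
      unfolding Zdef a_kernel_iff by blast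
  qed
  show ?thesis
  proof
    show "linear_extension R (free_module R S) (syz_decode R) ` carrier (free_module R (syz_code R ` Z)) \<subseteq> Z"
      using inZ by blast
    show "Z \<subseteq> linear_extension R (free_module R S) (syz_decode R) ` carrier (free_module R (syz_code R ` Z))"
    proof
      fix z assume z: "z \<in> Z"
      then have "linear_extension R (free_module R S) (syz_decode R) (free_gen R (syz_code R z)) = z"
        using linear_extension_gen[OF P.module_axioms phi, of "syz_code R z"] dec by auto
      then show "z \<in> linear_extension R (free_module R S) (syz_decode R) ` carrier (free_module R (syz_code R ` Z))"
        using free_gen_closed[OF R, of "syz_code R z" "syz_code R ` Z"] z by (metis image_eqI)
    qed
  qed
qed

lemma res_augmentation_hom:
  assumes "cring R" "module R F"
  shows "res_augmentation R F \<in> module_homs R (res_module R F 0) F"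
  unfolding res_augmentation_def res_module_def
  by (rule linear_extension_hom[OF assms(2)]) auto

lemma res_boundary_hom:
  assumes "cring R" "module R F"
  shows "res_boundary R F n \<in> module_homs R (res_module R F (Suc n)) (res_module R F n)"
  unfolding res_boundary_def res_module_def
proof (rule linear_extension_hom[OF module_free_module[OF assms(1)]])
  show "syz_decode R \<in> res_basis R F (Suc n) \<rightarrow> carrier (free_module R (res_basis R F n))"
    by (cases n) (auto simp: a_kernel_iff syz_decode_code free_module_carrier)
qed

theorem standard_resolution_exact:
  assumes R: "cring R" and F: "module R F"
  shows "res_augmentation R F ` carrier (res_module R F 0) = carrier F"
    and "exact_at (res_module R F (Suc 0)) (res_module R F 0) F (res_boundary R F 0) (res_augmentation R F)"
    and "exact_at (res_module R F (Suc (Suc n))) (res_module R F (Suc n)) (res_module R F n)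
           (res_boundary R F (Suc n)) (res_boundary R F n)"
proof -
  show "res_augmentation R F ` carrier (res_module R F 0) = carrier F"
  proof
    show "res_augmentation R F ` carrier (res_module R F 0) \<subseteq> carrier F"
      using module_homsD(1)[OF res_augmentation_hom[OF assms]] by blast
    show "carrier F \<subseteq> res_augmentation R F ` carrier (res_module R F 0)"
    proof
      fix x assume x: "x \<in> carrier F"
      have "res_augmentation R F (free_gen R (Gen x)) = x" unfolding res_augmentation_def
        by (subst linear_extension_gen[OF F, of _ "Gen ` carrier F"]) (use x in auto)
      then show "x \<in> res_augmentation R F ` carrier (res_module R F 0)"
        using free_gen_closed[OF R, of "Gen x" "Gen ` carrier F"] x
        by (metis image_eqI imageI res_basis.simps(1) res_module_def)
    qed
  qed
  show "exact_at (res_module R F (Suc 0)) (res_module R F 0) F (res_boundary R F 0) (res_augmentation R F)"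
    unfolding exact_at_def res_boundary_def res_module_def res_basis.simps(2)
    using res_augmentation_hom[OF assms] unfolding res_module_def
    by (intro free_cover[OF R _ F _ refl]) (auto simp: a_kernel_iff)
  show "exact_at (res_module R F (Suc (Suc n))) (res_module R F (Suc n)) (res_module R F n)
           (res_boundary R F (Suc n)) (res_boundary R F n)"
    unfolding exact_at_def res_boundary_def res_module_def res_basis.simps(3)
    using res_boundary_hom[OF assms, of n] unfolding res_module_def res_boundary_def
    by (intro free_cover[OF R _ module_free_module[OF R] _ refl]) (auto simp: a_kernel_iff)
qed

section \<open>Quotients, tensor products and Hom\<close>

context
  fixes R :: "'a ring" and A :: "('a, 'b) module" and N
  assumes A: "module R A" and N: "submodule N R A"
begin

interpretation A: module R A by (rule A)
interpretation sub: submodule N R A by (rule N)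
interpretation N: abelian_subgroup N A
  by (rule abelian_subgroupI3[OF additive_subgroupI[OF sub.subgroup_axioms] A.abelian_group_axioms])

lemma coset_eqI:
  assumes "x \<in> carrier A" "y \<in> carrier A" "x \<ominus>\<^bsub>A\<^esub> y \<in> N"
  shows "N +>\<^bsub>A\<^esub> x = N +>\<^bsub>A\<^esub> y"
proof (rule A.a_coset_add_inv1)
  show "N +>\<^bsub>A\<^esub> (x \<oplus>\<^bsub>A\<^esub> \<ominus>\<^bsub>A\<^esub> y) = N"
    using assms by (intro A.a_coset_join2[OF _ sub.subgroup_axioms]) (auto simp: a_minus_def)
qed (use assms N.a_subset in auto)

lemma coset_memD:
  assumes "x \<in> carrier A" "x' \<in> N +>\<^bsub>A\<^esub> x"
  shows "x' \<in> carrier A" "x' \<ominus>\<^bsub>A\<^esub> x \<in> N"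
proof -
  obtain n where n: "n \<in> N" "x' = n \<oplus>\<^bsub>A\<^esub> x" using assms(2) by (auto simp: a_r_coset_def')
  have nc: "n \<in> carrier A" using n N.a_subset by auto
  show "x' \<in> carrier A" using n nc assms by auto
  show "x' \<ominus>\<^bsub>A\<^esub> x \<in> N" using n nc assms(1) by (simp add: a_minus_def A.a_assoc A.r_neg)
qed

lemma coset_closed: "x \<in> carrier A \<Longrightarrow> N +>\<^bsub>A\<^esub> x \<in> carrier (quotient_module A N)"
  using A.a_rcosetsI[OF N.a_subset] by (simp add: quotient_module_def)

lemma quotient_carrierE:
  assumes "X \<in> carrier (quotient_module A N)"
  obtains x where "x \<in> carrier A" "X = N +>\<^bsub>A\<^esub> x"
  using assms by (auto simp: quotient_module_def A_RCOSETS_def')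

lemma quotient_add:
  "x \<in> carrier A \<Longrightarrow> y \<in> carrier A \<Longrightarrow>
    (N +>\<^bsub>A\<^esub> x) \<oplus>\<^bsub>quotient_module A N\<^esub> (N +>\<^bsub>A\<^esub> y) = N +>\<^bsub>A\<^esub> (x \<oplus>\<^bsub>A\<^esub> y)"
  by (simp add: quotient_module_def N.a_rcos_sum)

lemma quotient_zero: "\<zero>\<^bsub>quotient_module A N\<^esub> = N +>\<^bsub>A\<^esub> \<zero>\<^bsub>A\<^esub>"
  using N.a_subset by (simp add: quotient_module_def)

lemma quotient_smult:
  assumes "r \<in> carrier R" "x \<in> carrier A"
  shows "r \<odot>\<^bsub>quotient_module A N\<^esub> (N +>\<^bsub>A\<^esub> x) = N +>\<^bsub>A\<^esub> (r \<odot>\<^bsub>A\<^esub> x)"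
proof -
  have "N +>\<^bsub>A\<^esub> (r \<odot>\<^bsub>A\<^esub> x') = N +>\<^bsub>A\<^esub> (r \<odot>\<^bsub>A\<^esub> x)" if "x' \<in> N +>\<^bsub>A\<^esub> x" for x'
  proof (rule coset_eqI)
    note x' = coset_memD[OF assms(2) that]
    have "r \<odot>\<^bsub>A\<^esub> (x' \<ominus>\<^bsub>A\<^esub> x) \<in> N" using x' assms by (intro sub.smult_closed)
    then show "r \<odot>\<^bsub>A\<^esub> x' \<ominus>\<^bsub>A\<^esub> r \<odot>\<^bsub>A\<^esub> x \<in> N"
      using x'(1) assms by (simp add: a_minus_def A.smult_r_distr A.smult_r_minus)
    show "r \<odot>\<^bsub>A\<^esub> x' \<in> carrier A" "r \<odot>\<^bsub>A\<^esub> x \<in> carrier A" using x' assms by auto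
  qed
  then have "(\<Union>x'\<in>N +>\<^bsub>A\<^esub> x. N +>\<^bsub>A\<^esub> (r \<odot>\<^bsub>A\<^esub> x')) = (\<Union>x'\<in>N +>\<^bsub>A\<^esub> x. N +>\<^bsub>A\<^esub> (r \<odot>\<^bsub>A\<^esub> x))"
    by (rule SUP_cong[OF refl])
  also have "\<dots> = N +>\<^bsub>A\<^esub> (r \<odot>\<^bsub>A\<^esub> x)" using N.a_rcos_self[OF assms(2)] by blast
  finally show ?thesis by (simp add: quotient_module_def)
qed

lemma module_quotient: "module R (quotient_module A N)"
proof -
  let ?Q = "quotient_module A N"
  note E = quotient_carrierE
  show ?thesis
  proof (rule moduleI)
    show "cring R" by (rule A.R.cring_axioms)
    show "abelian_group ?Q"
    proof (rule abelian_groupI)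
      fix X assume X: "X \<in> carrier ?Q"
      obtain x where x: "x \<in> carrier A" "X = N +>\<^bsub>A\<^esub> x" by (rule E[OF X])
      have "(N +>\<^bsub>A\<^esub> (\<ominus>\<^bsub>A\<^esub> x)) \<oplus>\<^bsub>?Q\<^esub> X = \<zero>\<^bsub>?Q\<^esub>"
        unfolding x(2) quotient_zero quotient_add[OF A.a_inv_closed[OF x(1)] x(1)] A.l_neg[OF x(1)] ..
      then show "\<exists>Y\<in>carrier ?Q. Y \<oplus>\<^bsub>?Q\<^esub> X = \<zero>\<^bsub>?Q\<^esub>"
        using coset_closed[OF A.a_inv_closed[OF x(1)]] by blast
      show "\<zero>\<^bsub>?Q\<^esub> \<oplus>\<^bsub>?Q\<^esub> X = X"
        unfolding x(2) quotient_zero quotient_add[OF A.zero_closed x(1)] A.l_zero[OF x(1)] ..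
      fix Y assume Y: "Y \<in> carrier ?Q"
      obtain y where y: "y \<in> carrier A" "Y = N +>\<^bsub>A\<^esub> y" by (rule E[OF Y])
      show "X \<oplus>\<^bsub>?Q\<^esub> Y \<in> carrier ?Q"
        unfolding x(2) y(2) quotient_add[OF x(1) y(1)] by (rule coset_closed[OF A.a_closed[OF x(1) y(1)]])
      show "X \<oplus>\<^bsub>?Q\<^esub> Y = Y \<oplus>\<^bsub>?Q\<^esub> X"
        unfolding x(2) y(2) quotient_add[OF x(1) y(1)] quotient_add[OF y(1) x(1)] A.a_comm[OF x(1) y(1)] ..
      fix Z assume Z: "Z \<in> carrier ?Q"
      obtain z where z: "z \<in> carrier A" "Z = N +>\<^bsub>A\<^esub> z" by (rule E[OF Z])
      show "X \<oplus>\<^bsub>?Q\<^esub> Y \<oplus>\<^bsub>?Q\<^esub> Z = X \<oplus>\<^bsub>?Q\<^esub> (Y \<oplus>\<^bsub>?Q\<^esub> Z)"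
        unfolding x(2) y(2) z(2) by (simp add: quotient_add x(1) y(1) z(1) A.a_assoc)
    next
      show "\<zero>\<^bsub>?Q\<^esub> \<in> carrier ?Q" unfolding quotient_zero by (rule coset_closed[OF A.zero_closed])
    qed
  next
    fix X r assume X: "X \<in> carrier ?Q" and r: "r \<in> carrier R"
    obtain x where x: "x \<in> carrier A" "X = N +>\<^bsub>A\<^esub> x" by (rule E[OF X])
    show "r \<odot>\<^bsub>?Q\<^esub> X \<in> carrier ?Q"
      unfolding x(2) quotient_smult[OF r x(1)] by (rule coset_closed[OF A.smult_closed[OF r x(1)]])
    fix s assume s: "s \<in> carrier R"
    show "(r \<oplus>\<^bsub>R\<^esub> s) \<odot>\<^bsub>?Q\<^esub> X = r \<odot>\<^bsub>?Q\<^esub> X \<oplus>\<^bsub>?Q\<^esub> s \<odot>\<^bsub>?Q\<^esub> X"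
      unfolding x(2) by (simp add: quotient_add quotient_smult x(1) r s A.smult_l_distr)
    show "(r \<otimes>\<^bsub>R\<^esub> s) \<odot>\<^bsub>?Q\<^esub> X = r \<odot>\<^bsub>?Q\<^esub> (s \<odot>\<^bsub>?Q\<^esub> X)"
      unfolding x(2) by (simp add: quotient_smult x(1) r s A.smult_assoc1)
  next
    fix X Y r assume X: "X \<in> carrier ?Q" and Y: "Y \<in> carrier ?Q" and r: "r \<in> carrier R"
    obtain x where x: "x \<in> carrier A" "X = N +>\<^bsub>A\<^esub> x" by (rule E[OF X])
    obtain y where y: "y \<in> carrier A" "Y = N +>\<^bsub>A\<^esub> y" by (rule E[OF Y])
    show "r \<odot>\<^bsub>?Q\<^esub> (X \<oplus>\<^bsub>?Q\<^esub> Y) = r \<odot>\<^bsub>?Q\<^esub> X \<oplus>\<^bsub>?Q\<^esub> r \<odot>\<^bsub>?Q\<^esub> Y"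
      unfolding x(2) y(2) by (simp add: quotient_add quotient_smult x(1) y(1) r A.smult_r_distr)
  next
    fix X assume X: "X \<in> carrier ?Q"
    obtain x where x: "x \<in> carrier A" "X = N +>\<^bsub>A\<^esub> x" by (rule E[OF X])
    show "\<one>\<^bsub>R\<^esub> \<odot>\<^bsub>?Q\<^esub> X = X"
      unfolding x(2) by (simp add: quotient_smult x(1))
  qed
qed

end

lemma submodule_generated:
  assumes "module R A" "X \<subseteq> carrier A"
  shows "submodule (submodule_generated R A X) R A" "X \<subseteq> submodule_generated R A X"
    "\<And>N. submodule N R A \<Longrightarrow> X \<subseteq> N \<Longrightarrow> submodule_generated R A X \<subseteq> N"
proof -
  interpret A: module R A by fact
  have *: "carrier A \<in> {N. submodule N R A \<and> X \<subseteq> N}" using A.carrier_is_submodule assms by simp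
  show "submodule (submodule_generated R A X) R A"
  proof (rule A.submoduleI)
    show "submodule_generated R A X \<subseteq> carrier A" unfolding submodule_generated_def using * by blast
  qed (auto simp: submodule_generated_def dest: A.submoduleE subgroup.one_closed[OF submodule.axioms(1)])
  show "X \<subseteq> submodule_generated R A X" by (auto simp: submodule_generated_def)
  show "\<And>N. submodule N R A \<Longrightarrow> X \<subseteq> N \<Longrightarrow> submodule_generated R A X \<subseteq> N"
     by (auto simp: submodule_generated_def)
qed

lemma module_homs_minus:
  assumes "module R A" "module R B" "h \<in> module_homs R A B" "x \<in> carrier A" "y \<in> carrier A"
  shows "h (x \<ominus>\<^bsub>A\<^esub> y) = h x \<ominus>\<^bsub>B\<^esub> h y"
proof -
  interpret A: module R A by fact
  interpret B: module R B by fact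
  note hD = module_homsD[OF assms(3)]
  have e: "\<ominus>\<^bsub>A\<^esub> y = (\<ominus>\<^bsub>R\<^esub> \<one>\<^bsub>R\<^esub>) \<odot>\<^bsub>A\<^esub> y" using assms by (simp add: A.smult_l_minus)
  have "h (\<ominus>\<^bsub>A\<^esub> y) = \<ominus>\<^bsub>B\<^esub> h y"
    unfolding e using assms hD(1)[OF assms(5)] by (subst hD(3)) (auto simp: B.smult_l_minus)
  then show ?thesis using hD assms by (simp add: a_minus_def)
qed

lemma kernel_submodule:
  assumes "module R A" "module R B" "h \<in> module_homs R A B"
  shows "submodule (a_kernel A B h) R A"
proof -
  interpret A: module R A by fact
  interpret B: module R B by fact
  note hD = module_homsD[OF assms(3)]
  have m: "h (\<ominus>\<^bsub>A\<^esub> x) = \<ominus>\<^bsub>B\<^esub> h x" if "x \<in> carrier A" for x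
    using module_homs_minus[OF assms, of "\<zero>\<^bsub>A\<^esub>" x] module_homs_zero[OF assms] that hD(1)[OF that]
    by (simp add: a_minus_def)
  show ?thesis
    by (rule A.submoduleI) (auto simp: a_kernel_iff module_homs_zero[OF assms] hD(2,3) m)
qed

lemma tensor_relations_closed:
  assumes "module R A" "module R B"
  shows "tensor_relations R A B \<subseteq> carrier (free_module R (carrier A \<times> carrier B))"
proof -
  interpret A: module R A by fact
  interpret B: module R B by fact
  have R: "cring R" by (rule A.R.cring_axioms)
  interpret P: module R "free_module R (carrier A \<times> carrier B)" by (rule module_free_module[OF R])
  have g: "free_gen R (x, y) \<in> carrier (free_module R (carrier A \<times> carrier B))"
    if "x \<in> carrier A" "y \<in> carrier B" for x y using that by (intro free_gen_closed[OF R]) auto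
  show ?thesis unfolding tensor_relations_def Let_def
    by (auto intro!: P.minus_closed P.a_closed P.smult_closed g)
qed

lemmas tensor_kernel_props =
  submodule_generated[OF module_free_module tensor_relations_closed, folded tensor_kernel_def]

lemma tensor_kernel_sub:
  assumes "module R A" "module R B"
  shows "submodule (tensor_kernel R A B) R (free_module R (carrier A \<times> carrier B))"
  using tensor_kernel_props(1)[OF _ assms] assms(1) module.axioms(1) by blast

lemma module_tensor_module:
  assumes "module R A" "module R B"
  shows "module R (tensor_module R A B)"
  unfolding tensor_module_def
  by (rule module_quotient[OF module_free_module tensor_kernel_sub[OF assms]])
    (use assms(1) module.axioms(1) in blast)

lemma pure_tensor_bilinear:
  assumes "module R A" "module R B" "x \<in> carrier A" "y \<in> carrier B" "x' \<in> carrier A" "y' \<in> carrier B" "r \<in> carrier R"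
  defines "T \<equiv> tensor_module R A B" and "t \<equiv> pure_tensor R A B"
  shows "t x y \<in> carrier T"
    and "t (x \<oplus>\<^bsub>A\<^esub> x') y = t x y \<oplus>\<^bsub>T\<^esub> t x' y" and "t x (y \<oplus>\<^bsub>B\<^esub> y') = t x y \<oplus>\<^bsub>T\<^esub> t x y'"
    and "t (r \<odot>\<^bsub>A\<^esub> x) y = r \<odot>\<^bsub>T\<^esub> t x y" and "t x (r \<odot>\<^bsub>B\<^esub> y) = r \<odot>\<^bsub>T\<^esub> t x y"
proof -
  interpret A: module R A by fact
  interpret B: module R B by fact
  have R: "cring R" by (rule A.R.cring_axioms)
  let ?P = "free_module R (carrier A \<times> carrier B)"
  interpret P: module R ?P by (rule module_free_module[OF R])
  note P = P.module_axioms and K = tensor_kernel_sub[OF assms(1,2)]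
  have g: "free_gen R (x, y) \<in> carrier ?P"
    if "x \<in> carrier A" "y \<in> carrier B" for x y using that by (intro free_gen_closed[OF R]) auto
  have rel: "q \<in> tensor_kernel R A B" if "q \<in> tensor_relations R A B" for q
    using tensor_kernel_props(2)[OF R assms(1,2)] that by blast
  note d = T_def t_def tensor_module_def pure_tensor_def
  show "t x y \<in> carrier T" unfolding d by (rule coset_closed[OF P K g]) fact+
  show "t (x \<oplus>\<^bsub>A\<^esub> x') y = t x y \<oplus>\<^bsub>T\<^esub> t x' y"
    unfolding d quotient_add[OF P K g[OF assms(3,4)] g[OF assms(5,4)]]
    by (rule coset_eqI[OF P K g P.a_closed[OF g g] rel])
      (use assms(3-7) in \<open>auto simp: tensor_relations_def Let_def\<close>)
  show "t x (y \<oplus>\<^bsub>B\<^esub> y') = t x y \<oplus>\<^bsub>T\<^esub> t x y'"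
    unfolding d quotient_add[OF P K g[OF assms(3,4)] g[OF assms(3,6)]]
    by (rule coset_eqI[OF P K g P.a_closed[OF g g] rel])
      (use assms(3-7) in \<open>auto simp: tensor_relations_def Let_def\<close>)
  show "t (r \<odot>\<^bsub>A\<^esub> x) y = r \<odot>\<^bsub>T\<^esub> t x y"
    unfolding d quotient_smult[OF P K assms(7) g[OF assms(3,4)]]
    by (rule coset_eqI[OF P K g P.smult_closed[OF _ g] rel])
      (use assms(3-7) in \<open>auto simp: tensor_relations_def Let_def\<close>)
  show "t x (r \<odot>\<^bsub>B\<^esub> y) = r \<odot>\<^bsub>T\<^esub> t x y"
    unfolding d quotient_smult[OF P K assms(7) g[OF assms(3,4)]]
    by (rule coset_eqI[OF P K g P.smult_closed[OF _ g] rel])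
      (use assms(3-7) in \<open>auto simp: tensor_relations_def Let_def\<close>)
qed

text \<open>Bilinear maps factor through the tensor product.\<close>

lemma tensor_kernel_bilinear:
  assumes A: "module R A" and B: "module R B" and C: "module R C"
    and \<beta>: "\<And>x y. x \<in> carrier A \<Longrightarrow> y \<in> carrier B \<Longrightarrow> \<beta> x y \<in> carrier C"
    "\<And>x x' y. x \<in> carrier A \<Longrightarrow> x' \<in> carrier A \<Longrightarrow> y \<in> carrier B \<Longrightarrow> \<beta> (x \<oplus>\<^bsub>A\<^esub> x') y = \<beta> x y \<oplus>\<^bsub>C\<^esub> \<beta> x' y"
    "\<And>x y y'. x \<in> carrier A \<Longrightarrow> y \<in> carrier B \<Longrightarrow> y' \<in> carrier B \<Longrightarrow> \<beta> x (y \<oplus>\<^bsub>B\<^esub> y') = \<beta> x y \<oplus>\<^bsub>C\<^esub> \<beta> x y'"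
    "\<And>r x y. r \<in> carrier R \<Longrightarrow> x \<in> carrier A \<Longrightarrow> y \<in> carrier B \<Longrightarrow> \<beta> (r \<odot>\<^bsub>A\<^esub> x) y = r \<odot>\<^bsub>C\<^esub> \<beta> x y"
    "\<And>r x y. r \<in> carrier R \<Longrightarrow> x \<in> carrier A \<Longrightarrow> y \<in> carrier B \<Longrightarrow> \<beta> x (r \<odot>\<^bsub>B\<^esub> y) = r \<odot>\<^bsub>C\<^esub> \<beta> x y"
  shows "tensor_kernel R A B \<subseteq>
    a_kernel (free_module R (carrier A \<times> carrier B)) C (linear_extension R C (\<lambda>(x, y). \<beta> x y))"
proof -
  interpret A: module R A by fact
  interpret B: module R B by fact
  interpret C: module R C by fact
  have R: "cring R" by (rule A.R.cring_axioms)
  let ?S = "carrier A \<times> carrier B"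
  let ?P = "free_module R ?S"
  let ?L = "linear_extension R C (\<lambda>(x, y). \<beta> x y)"
  interpret P: module R ?P by (rule module_free_module[OF R])
  note P = P.module_axioms
  have phi: "(\<lambda>(x, y). \<beta> x y) \<in> ?S \<rightarrow> carrier C" using \<beta>(1) by auto
  note L = linear_extension_hom[OF C phi]
  have Lg: "?L (free_gen R (x, y)) = \<beta> x y" if "x \<in> carrier A" "y \<in> carrier B" for x y
    using linear_extension_gen[OF C phi, of "(x, y)"] that by simp
  have g: "free_gen R (x, y) \<in> carrier ?P"
    if "x \<in> carrier A" "y \<in> carrier B" for x y using that by (intro free_gen_closed[OF R]) auto
  have Lm: "?L (p \<ominus>\<^bsub>?P\<^esub> q) = \<zero>\<^bsub>C\<^esub>" if "p \<in> carrier ?P" "q \<in> carrier ?P" "?L p = ?L q" for p q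
    using module_homs_minus[OF P C L that(1,2)] that(3) module_homsD(1)[OF L that(2)]
    by (simp add: a_minus_def C.r_neg)
  note LD = module_homsD[OF L]
  show ?thesis
  proof (rule tensor_kernel_props(3)[OF R A B])
    show "submodule (a_kernel ?P C ?L) R ?P" by (rule kernel_submodule[OF P C L])
    show "tensor_relations R A B \<subseteq> a_kernel ?P C ?L"
    proof
      fix q assume q: "q \<in> tensor_relations R A B"
      then have qc: "q \<in> carrier ?P" using tensor_relations_closed[OF A B] by blast
      have "?L q = \<zero>\<^bsub>C\<^esub>"
        using q unfolding tensor_relations_def Let_def
        by (elim UnE CollectE exE conjE) (auto intro!: Lm P.a_closed P.smult_closed g simp: LD g Lg \<beta>)
      then show "q \<in> a_kernel ?P C ?L" using qc by (simp add: a_kernel_iff)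
    qed
  qed
qed

lemma tensor_map_coset:
  assumes F: "module R F" and B: "module R B" and C: "module R C" and f: "f \<in> module_homs R B C"
    and p: "p \<in> carrier (free_module R (carrier F \<times> carrier B))"
  shows "tensor_map R F C f (tensor_kernel R F B +>\<^bsub>free_module R (carrier F \<times> carrier B)\<^esub> p) =
     tensor_kernel R F C +>\<^bsub>free_module R (carrier F \<times> carrier C)\<^esub>
        linear_extension R (free_module R (carrier F \<times> carrier C)) (\<lambda>(x, y). free_gen R (x, f y)) p"
proof -
  interpret F: module R F by fact
  interpret B: module R B by fact
  have R: "cring R" by (rule F.R.cring_axioms)
  let ?P = "free_module R (carrier F \<times> carrier B)"
  let ?Q = "free_module R (carrier F \<times> carrier C)"
  let ?L = "linear_extension R ?Q (\<lambda>(x, y). free_gen R (x, f y))"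
  interpret P: module R ?P by (rule module_free_module[OF R])
  interpret Q: module R ?Q by (rule module_free_module[OF R])
  note P = P.module_axioms and Q = Q.module_axioms
  note fD = module_homsD[OF f]
  note KB = tensor_kernel_sub[OF F B] and KC = tensor_kernel_sub[OF F C]
  have phi: "(\<lambda>(x, y). free_gen R (x, f y)) \<in> carrier F \<times> carrier B \<rightarrow> carrier ?Q"
    using fD(1) by (auto intro!: free_gen_closed[OF R])
  note L = linear_extension_hom[OF Q phi]
  note LD = module_homsD[OF L]
  have Lg: "?L (free_gen R (x, y)) = free_gen R (x, f y)" if "x \<in> carrier F" "y \<in> carrier B" for x y
    using linear_extension_gen[OF Q phi, of "(x, y)"] that by simp
  have g: "free_gen R (x, y) \<in> carrier ?P"
    if "x \<in> carrier F" "y \<in> carrier B" for x y using that by (intro free_gen_closed[OF R]) auto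
  let ?N = "{q \<in> carrier ?P. ?L q \<in> tensor_kernel R F C}"
  have "tensor_kernel R F B \<subseteq> ?N"
  proof (rule tensor_kernel_props(3)[OF R F B])
    show "submodule ?N R ?P"
    proof (rule P.submoduleI)
      show "\<zero>\<^bsub>?P\<^esub> \<in> ?N" using module_homs_zero[OF P Q L] P.zero_closed 
        subgroup.one_closed[OF submodule.axioms(1)[OF KC]] by simp
      have m: "?L (\<ominus>\<^bsub>?P\<^esub> x) = \<ominus>\<^bsub>?Q\<^esub> ?L x" if "x \<in> carrier ?P" for x
        using module_homs_minus[OF P Q L P.zero_closed that] module_homs_zero[OF P Q L] that LD(1)[OF that]
        by (simp add: a_minus_def)
      show "\<ominus>\<^bsub>?P\<^esub> a \<in> ?N" if "a \<in> ?N" for a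
        using that m[of a] Q.submoduleE(3)[OF KC] by auto
    qed (auto simp: LD(2,3) intro: Q.submoduleE(4,5)[OF KC])
    show "tensor_relations R F B \<subseteq> ?N"
    proof
      fix q assume q: "q \<in> tensor_relations R F B"
      then have qc: "q \<in> carrier ?P" using tensor_relations_closed[OF F B] by blast
      have "?L q \<in> tensor_relations R F C"
        using q unfolding tensor_relations_def[of R F B] Let_def
      proof (elim UnE CollectE exE conjE, goal_cases)
        case (1 x x' y)
        then have "?L q = free_gen R (x \<oplus>\<^bsub>F\<^esub> x', f y) \<ominus>\<^bsub>?Q\<^esub> (free_gen R (x, f y) \<oplus>\<^bsub>?Q\<^esub> free_gen R (x', f y))"
          by (simp add: module_homs_minus[OF P Q L] LD g Lg P.a_closed)
        with 1 fD(1)[of y] show ?case unfolding tensor_relations_def Let_def by blast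
      next
        case (2 x y y')
        then have "?L q = free_gen R (x, f y \<oplus>\<^bsub>C\<^esub> f y') \<ominus>\<^bsub>?Q\<^esub> (free_gen R (x, f y) \<oplus>\<^bsub>?Q\<^esub> free_gen R (x, f y'))"
          by (simp add: module_homs_minus[OF P Q L] LD g Lg P.a_closed fD B.a_closed)
        with 2 fD(1)[of y] fD(1)[of y'] show ?case unfolding tensor_relations_def Let_def by blast
      next
        case (3 r x y)
        then have "?L q = free_gen R (r \<odot>\<^bsub>F\<^esub> x, f y) \<ominus>\<^bsub>?Q\<^esub> r \<odot>\<^bsub>?Q\<^esub> free_gen R (x, f y)"
          by (simp add: module_homs_minus[OF P Q L] LD g Lg P.smult_closed)
        with 3 fD(1)[of y] show ?case unfolding tensor_relations_def Let_def by blast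
      next
        case (4 r x y)
        then have "?L q = free_gen R (x, r \<odot>\<^bsub>C\<^esub> f y) \<ominus>\<^bsub>?Q\<^esub> r \<odot>\<^bsub>?Q\<^esub> free_gen R (x, f y)"
          by (simp add: module_homs_minus[OF P Q L] LD g Lg P.smult_closed fD B.smult_closed)
        with 4 fD(1)[of y] show ?case unfolding tensor_relations_def Let_def by blast
      qed
      then show "q \<in> ?N" using qc tensor_kernel_props(2)[OF R F C] by auto
    qed
  qed
  then have K: "?L q \<in> tensor_kernel R F C" if "q \<in> tensor_kernel R F B" for q using that by auto
  have "tensor_kernel R F C +>\<^bsub>?Q\<^esub> ?L p' = tensor_kernel R F C +>\<^bsub>?Q\<^esub> ?L p"
    if "p' \<in> tensor_kernel R F B +>\<^bsub>?P\<^esub> p" for p'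
  proof (rule coset_eqI[OF Q KC])
    note m = coset_memD[OF P KB p that]
    show "?L p' \<in> carrier ?Q" "?L p \<in> carrier ?Q" using LD(1) m(1) p by blast+
    show "?L p' \<ominus>\<^bsub>?Q\<^esub> ?L p \<in> tensor_kernel R F C"
      using K[OF m(2)] unfolding module_homs_minus[OF P Q L m(1) p] .
  qed
  moreover have "p \<in> tensor_kernel R F B +>\<^bsub>?P\<^esub> p"
    by (rule abelian_subgroup.a_rcos_self[OF abelian_subgroupI3[OF additive_subgroupI[OF submodule.axioms(1)[OF KB]] P.abelian_group_axioms] p])
  ultimately show ?thesis unfolding tensor_map_def Let_def by (intro equalityI UN_least) (metis order_refl, blast)
qed

lemma tensor_map_pure:
  assumes F: "module R F" and B: "module R B" and C: "module R C" and f: "f \<in> module_homs R B C"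
    and xy: "x \<in> carrier F" "y \<in> carrier B"
  shows "tensor_map R F C f (pure_tensor R F B x y) = pure_tensor R F C x (f y)"
proof -
  have R: "cring R" using F module.axioms(1) by blast
  have phi: "(\<lambda>(x, y). free_gen R (x, f y)) \<in> carrier F \<times> carrier B \<rightarrow> carrier (free_module R (carrier F \<times> carrier C))"
    using module_homsD(1)[OF f] by (auto intro!: free_gen_closed[OF R])
  show ?thesis unfolding pure_tensor_def using xy
    by (subst tensor_map_coset[OF F B C f free_gen_closed[OF R]])
      (auto simp: linear_extension_gen[OF module_free_module[OF R] phi])
qed

lemma tensor_map_hom:
  assumes F: "module R F" and B: "module R B" and C: "module R C" and f: "f \<in> module_homs R B C"
  shows "tensor_map R F C f \<in> module_homs R (tensor_module R F B) (tensor_module R F C)"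
proof -
  have R: "cring R" using F module.axioms(1) by blast
  let ?P = "free_module R (carrier F \<times> carrier B)"
  let ?Q = "free_module R (carrier F \<times> carrier C)"
  interpret P: module R ?P by (rule module_free_module[OF R])
  interpret Q: module R ?Q by (rule module_free_module[OF R])
  note P = P.module_axioms and Q = Q.module_axioms
  have phi: "(\<lambda>(x, y). free_gen R (x, f y)) \<in> carrier F \<times> carrier B \<rightarrow> carrier ?Q"
    using module_homsD(1)[OF f] by (auto intro!: free_gen_closed[OF R])
  note LD = module_homsD[OF linear_extension_hom[OF Q phi]]
  note tc = tensor_map_coset[OF assms]
  note KB = tensor_kernel_sub[OF F B] and KC = tensor_kernel_sub[OF F C]
  show ?thesis unfolding tensor_module_def
    by (rule module_homsI; (elim quotient_carrierE[OF P KB])?)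
      (simp_all add: tc coset_closed[OF Q KC] LD quotient_add[OF P KB] quotient_add[OF Q KC]
         quotient_smult[OF P KB] quotient_smult[OF Q KC] P.a_closed P.smult_closed)
qed

lemma module_hom_module:
  assumes "module R A" "module R B"
  shows "module R (hom_module R A B)"
proof -
  interpret A: module R A by fact
  interpret B: module R B by fact
  have R: "cring R" by (rule A.R.cring_axioms)
  note hd = hom_module_def module_homs_def
  have ext: "f = g" if "f \<in> extensional (carrier A)" "g \<in> extensional (carrier A)" "\<And>x. x \<in> carrier A \<Longrightarrow> f x = g x" for f g :: "'b \<Rightarrow> 'c"
    using that by (rule extensionalityI)
  show ?thesis
  proof (rule moduleI)
    show "abelian_group (hom_module R A B)"
    proof (rule abelian_groupI)
      fix f assume f: "f \<in> carrier (hom_module R A B)"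
      show "\<exists>g\<in>carrier (hom_module R A B). g \<oplus>\<^bsub>hom_module R A B\<^esub> f = \<zero>\<^bsub>hom_module R A B\<^esub>"
        using f by (intro bexI[of _ "\<lambda>x\<in>carrier A. \<ominus>\<^bsub>B\<^esub> f x"])
          (auto simp: hd Pi_iff B.l_neg B.smult_r_minus B.minus_add restrict_def extensional_def)
    qed (auto simp: hd Pi_iff B.a_ac B.smult_r_distr restrict_def fun_eq_iff extensional_def)
  qed (auto simp: R hd Pi_iff B.a_ac B.smult_r_distr B.smult_l_distr B.smult_assoc1 restrict_def fun_eq_iff extensional_def A.R.m_comm
     simp flip: B.smult_assoc1)
qed


lemma module_res_module: "cring R \<Longrightarrow> module R (res_module R F n)"
  unfolding res_module_def by (rule module_free_module)

lemma ext_coboundary_hom: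
  assumes R: "cring R" and F: "module R F" and M: "module R M"
  shows "ext_coboundary R n F \<in> module_homs R (ext_cochains R n F M) (ext_cochains R (Suc n) F M)"
proof -
  note d = module_homsD[OF res_boundary_hom[OF R F, of n]]
  interpret P: module R "res_module R F (Suc n)" by (rule module_res_module[OF R])
  show ?thesis
  proof (rule module_homsI)
    fix h assume h: "h \<in> carrier (ext_cochains R n F M)"
    then have hh: "h \<in> module_homs R (res_module R F n) M" by (simp add: ext_cochains_def hom_module_def)
    note hD = module_homsD[OF hh]
    have "ext_coboundary R n F h \<in> module_homs R (res_module R F (Suc n)) M"
      by (rule module_homsI) (simp_all add: ext_coboundary_def compose_def d hD)
    then show "ext_coboundary R n F h \<in> carrier (ext_cochains R (Suc n) F M)"
      by (simp add: ext_cochains_def hom_module_def ext_coboundary_def)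
    show "ext_coboundary R n F (r \<odot>\<^bsub>ext_cochains R n F M\<^esub> h) = r \<odot>\<^bsub>ext_cochains R (Suc n) F M\<^esub> ext_coboundary R n F h"
      if "r \<in> carrier R" for r
      by (rule ext) (simp add: ext_cochains_def hom_module_def ext_coboundary_def compose_def d(1))
    show "ext_coboundary R n F (h \<oplus>\<^bsub>ext_cochains R n F M\<^esub> k) = ext_coboundary R n F h \<oplus>\<^bsub>ext_cochains R (Suc n) F M\<^esub> ext_coboundary R n F k" for k
      by (rule ext) (simp add: ext_cochains_def hom_module_def ext_coboundary_def compose_def d(1))
  qed
qed

end

(* If M is injective, then so is Hom(F, M) by the adjunction with F (x) -. For the converse let
   0 -> M -> E 0 -> E 1 -> ... be an injective resolution with cycles L n. By induction on n each
   Hom(F, L n) is injective and Ext^i(F, L n) = 0 for i > 0; hence Hom(F, E n) -> Hom(F, L (n+1))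
   is surjective with injective kernel and has an R-linear section.

   Suppose that Ext^1(R/J, L n) is nonzero for some n and some ideal J, and take J = p maximal with
   this property. By the long exact sequence p is prime. Let y in L (n+1) be killed by p; it has to be
   lifted to an element of E n killed by p. The module F (x) R/p is nonzero and torsion-free over R/p,
   so it contains a pure tensor x (x) 1 with annihilator p. By maximality of p and Baer's criterion,
   x (x) 1 |-> y extends to F (x) R/p -> L (n+1), which gives v : F -> L (n+1) with v x = y and p v = 0.
   If u is the image of v under the section, then u x lifts y and is killed by p. So all
   Ext^1(R/J, L 0) vanish, and M = L 0 is injective by Baer's criterion. *)

theory Submission
  imports Defs "HOL-Algebra.IntRing"
begin

section \<open>Modules and homomorphisms\<close>

text \<open>\<open>M\<close> need not be a retract of \<open>Hom(F, M)\<close>, so injectivity is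
  not inherited directly. What can be brought down is a single element, by evaluating a homomorphism
  at one \<open>x\<close> in \<open>F\<close>. An arbitrary lift of \<open>v\<close> to
  \<open>E n\<close> might not stay killed by \<open>p\<close>; the image under the section does,
  because the section is linear over \<open>R\<close>, and injectivity of \<open>Hom(F, L n)\<close>
  is what provides such a section. Homomorphisms from \<open>F\<close> killed by \<open>p\<close>
  are those from \<open>F\<close> tensor \<open>R/p\<close>. There Baer's argument meets only ideals
  containing \<open>p\<close>: \<open>p\<close> itself imposes nothing, and the larger ones involve
  \<open>Ext^1(R/J, L (n+1))\<close>. The statement for \<open>L n\<close> therefore rests on the
  one for \<open>L (n+1)\<close>, but with larger ideals. An injective resolution need not end, so a
  descending induction on \<open>n\<close> has no starting point; taking \<open>p\<close> maximal
  among the ideals that fail for some \<open>n\<close> replaces it. This is why the argument runs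
  along a whole resolution although only \<open>L 0\<close> matters in the end.\<close>

abbreviation regular_module :: "'a ring \<Rightarrow> ('a, 'a) module" where
  "regular_module R \<equiv> ideal_module R (carrier R)"

lemma ideal_module_simps [simp]:
  "carrier (ideal_module R J) = J"
  "r \<odot>\<^bsub>ideal_module R J\<^esub> x = r \<otimes>\<^bsub>R\<^esub> x"
  "x \<oplus>\<^bsub>ideal_module R J\<^esub> y = x \<oplus>\<^bsub>R\<^esub> y"
  "\<zero>\<^bsub>ideal_module R J\<^esub> = \<zero>\<^bsub>R\<^esub>"
  by (simp_all add: ideal_module_def)

lemma module_regular_module: "cring R \<Longrightarrow> module R (regular_module R)"
  by (rule module_ideal_module[OF _ ring.oneideal[OF cring.axioms(1)]])

lemma ideal_submodule_regular:
  assumes "cring R" "ideal J R"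
  shows "submodule J R (regular_module R)"
proof -
  interpret R: cring R by fact
  interpret J: ideal J R by fact
  have "regular_module R\<lparr>carrier := J\<rparr> = ideal_module R J" by (simp add: ideal_module_def)
  then show ?thesis
    using module.module_incl_imp_submodule[OF module_regular_module[OF assms(1)], of J]
      module_ideal_module[OF assms] J.a_subset by simp
qed

lemma module_homs_comp:
  assumes "f \<in> module_homs R A B" "g \<in> module_homs R B C"
  shows "(\<lambda>x. g (f x)) \<in> module_homs R A C"
  by (rule module_homsI) (simp_all add: module_homsD[OF assms(1)] module_homsD[OF assms(2)])

lemma module_homs_smult_elem:
  assumes "module R A" "x \<in> carrier A"
  shows "(\<lambda>r. r \<odot>\<^bsub>A\<^esub> x) \<in> module_homs R (regular_module R) A"
proof -
  interpret A: module R A by fact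
  show ?thesis using assms(2) by (intro module_homsI) (auto simp: A.smult_l_distr A.smult_assoc1)
qed

lemma module_homs_diff:
  assumes "module R B" "f \<in> module_homs R A B" "g \<in> module_homs R A B"
  shows "(\<lambda>x. f x \<ominus>\<^bsub>B\<^esub> g x) \<in> module_homs R A B"
proof -
  interpret B: module R B by fact
  note f = module_homsD[OF assms(2)] and g = module_homsD[OF assms(3)]
  show ?thesis
    by (rule module_homsI)
      (auto simp: f g a_minus_def B.minus_add B.a_ac B.smult_r_distr B.smult_r_minus)
qed

lemma module_homs_smult:
  assumes "module R B" "f \<in> module_homs R A B" "r \<in> carrier R"
  shows "(\<lambda>x. r \<odot>\<^bsub>B\<^esub> f x) \<in> module_homs R A B"
proof -
  interpret B: module R B by fact
  note f = module_homsD[OF assms(2)]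
  show ?thesis
    by (rule module_homsI) (auto simp: f assms(3) B.smult_r_distr B.R.m_comm simp flip: B.smult_assoc1)
qed

lemma module_homs_const_zero:
  assumes "module R B"
  shows "(\<lambda>x. \<zero>\<^bsub>B\<^esub>) \<in> module_homs R A B"
proof -
  interpret B: module R B by fact
  show ?thesis by (rule module_homsI) auto
qed

lemma module_homs_restrict:
  assumes "module R A" "f \<in> module_homs R A B"
  shows "(\<lambda>x\<in>carrier A. f x) \<in> module_homs R A B"
proof -
  interpret A: module R A by fact
  note f = module_homsD[OF assms(2)]
  show ?thesis by (rule module_homsI) (auto simp: f)
qed

lemma module_minus_eq_zero:
  assumes "module R A" "x \<in> carrier A" "y \<in> carrier A"
  shows "x \<ominus>\<^bsub>A\<^esub> y = \<zero>\<^bsub>A\<^esub> \<longleftrightarrow> x = y"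
proof -
  interpret A: module R A by fact
  have "x = y" if "x \<oplus>\<^bsub>A\<^esub> \<ominus>\<^bsub>A\<^esub> y = \<zero>\<^bsub>A\<^esub>"
    using A.minus_equality[OF that] assms(2,3) by simp
  then show ?thesis using assms(2,3) by (auto simp: a_minus_def A.r_neg)
qed

lemma hom_image_submodule:
  assumes "module R A" "module R B" "f \<in> module_homs R A B"
  shows "submodule (f ` carrier A) R B"
proof -
  interpret A: module R A by fact
  interpret B: module R B by fact
  note f = module_homsD[OF assms(3)]
  have neg: "\<ominus>\<^bsub>B\<^esub> f x = f (\<ominus>\<^bsub>A\<^esub> x)" if "x \<in> carrier A" for x
    using module_homs_minus[OF assms, of "\<zero>\<^bsub>A\<^esub>" x] module_homs_zero[OF assms] that f(1)[OF that]
    by (simp add: a_minus_def)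
  show ?thesis
  proof (rule B.submoduleI)
    show "\<zero>\<^bsub>B\<^esub> \<in> f ` carrier A"
      using module_homs_zero[OF assms] by (metis A.zero_closed imageI)
    show "a \<oplus>\<^bsub>B\<^esub> b \<in> f ` carrier A" if "a \<in> f ` carrier A" "b \<in> f ` carrier A" for a b
      using that by (auto simp flip: f(2))
    show "r \<odot>\<^bsub>B\<^esub> x \<in> f ` carrier A" if "r \<in> carrier R" "x \<in> f ` carrier A" for r x
      using that by (auto simp flip: f(3))
  qed (auto simp: f(1) neg)
qed

text \<open>A preimage is picked by \<open>SOME\<close>; two preimages of the same element differ by
  an element of the kernel of \<open>f\<close>, which \<open>g\<close> kills. Maps on cyclic
  submodules, on tensor products and sections of surjections are all obtained this way.\<close>

lemma hom_factor_surj: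
  assumes A: "module R A" and B: "module R B" and C: "module R C"
    and f: "f \<in> module_homs R A B" and surj: "f ` carrier A = carrier B"
    and g: "g \<in> module_homs R A C"
    and ker: "\<And>x. x \<in> carrier A \<Longrightarrow> f x = \<zero>\<^bsub>B\<^esub> \<Longrightarrow> g x = \<zero>\<^bsub>C\<^esub>"
  shows "\<exists>h\<in>module_homs R B C. \<forall>x\<in>carrier A. h (f x) = g x"
proof -
  interpret A: module R A by fact
  interpret B: module R B by fact
  interpret C: module R C by fact
  note fD = module_homsD[OF f] and gD = module_homsD[OF g]
  define h where "h = (\<lambda>b. g (SOME x. x \<in> carrier A \<and> f x = b))"
  have h: "h (f x) = g x" if x: "x \<in> carrier A" for x
  proof -
    define y where "y = (SOME y. y \<in> carrier A \<and> f y = f x)"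
    have y: "y \<in> carrier A" "f y = f x" unfolding y_def using someI[of "\<lambda>y. y \<in> carrier A \<and> f y = f x" x] x by auto
    have "f (y \<ominus>\<^bsub>A\<^esub> x) = \<zero>\<^bsub>B\<^esub>"
      using module_homs_minus[OF A B f y(1) x] module_minus_eq_zero[OF B] fD(1) x y by auto
    then have "g y \<ominus>\<^bsub>C\<^esub> g x = \<zero>\<^bsub>C\<^esub>"
      using ker[of "y \<ominus>\<^bsub>A\<^esub> x"] module_homs_minus[OF A C g y(1) x] x y by simp
    then show ?thesis using module_minus_eq_zero[OF C] gD(1) x y by (auto simp: h_def simp flip: y_def)
  qed
  have e: "\<exists>x\<in>carrier A. b = f x" if "b \<in> carrier B" for b using that surj by auto
  have "h \<in> module_homs R B C"
  proof (rule module_homsI)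
    fix b assume "b \<in> carrier B"
    then obtain x where x: "x \<in> carrier A" "b = f x" using e by blast
    then show "h b \<in> carrier C" using h gD by simp
    show "h (b \<oplus>\<^bsub>B\<^esub> c) = h b \<oplus>\<^bsub>C\<^esub> h c" if c: "c \<in> carrier B" for c
    proof -
      obtain y where y: "y \<in> carrier A" "c = f y" using e[OF c] by blast
      then show ?thesis using h[of "x \<oplus>\<^bsub>A\<^esub> y"] x by (simp add: h fD gD)
    qed
    show "h (r \<odot>\<^bsub>B\<^esub> b) = r \<odot>\<^bsub>C\<^esub> h b" if "r \<in> carrier R" for r
      using h[of "r \<odot>\<^bsub>A\<^esub> x"] x that by (simp add: h fD gD)
  qed
  then show ?thesis using h by blast
qed

section \<open>Injective modules: factorisation, retracts, splitting\<close>

lemma injective_module_factor: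
  assumes E: "injective_module R E" and A: "module R A" and B: "module R B"
    and f: "f \<in> module_homs R A B" and g: "g \<in> module_homs R A E"
    and ker: "\<And>x. x \<in> carrier A \<Longrightarrow> f x = \<zero>\<^bsub>B\<^esub> \<Longrightarrow> g x = \<zero>\<^bsub>E\<^esub>"
  shows "\<exists>h\<in>module_homs R B E. \<forall>x\<in>carrier A. h (f x) = g x"
proof -
  \<comment> \<open>\<open>f\<close> need not be injective, so \<open>g\<close> is first factored
    through the image of \<open>f\<close> and then extended along the inclusion of that
    image.\<close>
  let ?I = "B\<lparr>carrier := f ` carrier A\<rparr>"
  have I: "module R ?I" by (rule submodule.submodule_is_module[OF hom_image_submodule[OF A B f] B])
  have Em: "module R E" using E by (simp add: injective_module_def)
  note fD = module_homsD[OF f]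
  have f': "f \<in> module_homs R A ?I" by (rule module_homsI) (auto simp: fD)
  obtain k where k: "k \<in> module_homs R ?I E" "\<forall>x\<in>carrier A. k (f x) = g x"
    using hom_factor_surj[OF A I Em f' _ g] ker by auto
  have "(\<lambda>x. x) \<in> module_homs R ?I B" by (rule module_homsI) (auto simp: fD)
  from injective_module_extend[OF E I B this _ k(1)] k(2) show ?thesis by auto
qed

text \<open>A test map into \<open>Z\<close> is pushed into \<open>Y\<close> by \<open>s\<close>,
  extended there and brought back by \<open>q\<close>. As \<open>Y\<close> and \<open>Z\<close> may
  have different carrier types, this also transfers injectivity along isomorphisms.\<close>

lemma injective_module_retract:
  fixes Y :: "('a, 'b) module" and Z :: "('a, 'c) module"
  assumes Y: "injective_module R Y" and Z: "module R Z"
    and s: "s \<in> module_homs R Z Y" and q: "q \<in> module_homs R Y Z"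
    and qs: "\<And>z. z \<in> carrier Z \<Longrightarrow> q (s z) = z"
  shows "injective_module R Z"
  unfolding injective_module_def
proof (intro conjI allI impI Z; elim conjE)
  fix A B :: "('a, 'a) module" and i g
  assume A: "module R A" and B: "module R B" and i: "i \<in> module_homs R A B" "inj_on i (carrier A)"
    and g: "g \<in> module_homs R A Z"
  obtain h where h: "h \<in> module_homs R B Y" "\<forall>x\<in>carrier A. h (i x) = s (g x)"
    using injective_module_extend[OF Y A B i module_homs_comp[OF g s]] by blast
  then show "\<exists>h\<in>module_homs R B Z. \<forall>x\<in>carrier A. h (i x) = g x"
    using module_homs_comp[OF h(1) q] qs module_homsD(1)[OF g] by (intro bexI) auto
qed

text \<open>Injectivity of \<open>X\<close> gives a retraction \<open>\<rho>\<close> of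
  \<open>i\<close>. Then \<open>y - i (\<rho> y)\<close> vanishes on the image of \<open>i\<close>,
  which is the kernel of \<open>q\<close>, so it depends on \<open>q y\<close> only and defines the
  section.\<close>

lemma injective_kernel_splits:
  assumes X: "injective_module R X" and Y: "module R Y" and Z: "module R Z"
    and i: "i \<in> module_homs R X Y" "inj_on i (carrier X)"
    and q: "q \<in> module_homs R Y Z" and exact: "exact_at X Y Z i q" and surj: "q ` carrier Y = carrier Z"
  shows "\<exists>s\<in>module_homs R Z Y. \<forall>z\<in>carrier Z. q (s z) = z"
proof -
  have Xm: "module R X" using X by (simp add: injective_module_def)
  interpret Y: module R Y by fact
  interpret Z: module R Z by fact
  have "(\<lambda>x. x) \<in> module_homs R X X" by (rule module_homsI) auto
  from injective_module_extend[OF X Xm Y i this] obtain \<rho> where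
    \<rho>: "\<rho> \<in> module_homs R Y X" "\<And>x. x \<in> carrier X \<Longrightarrow> \<rho> (i x) = x" by auto
  note iD = module_homsD[OF i(1)] and \<rho>D = module_homsD[OF \<rho>(1)] and qD = module_homsD[OF q]
  have t: "(\<lambda>y. y \<ominus>\<^bsub>Y\<^esub> i (\<rho> y)) \<in> module_homs R Y Y"
    by (intro module_homs_diff[OF Y _ module_homs_comp[OF \<rho>(1) i(1)]] module_homsI) auto
  have qi: "q (i x) = \<zero>\<^bsub>Z\<^esub>" if "x \<in> carrier X" for x
    using exact that by (auto simp: exact_at_def a_kernel_iff set_eq_iff)
  have "y \<ominus>\<^bsub>Y\<^esub> i (\<rho> y) = \<zero>\<^bsub>Y\<^esub>" if y: "y \<in> carrier Y" "q y = \<zero>\<^bsub>Z\<^esub>" for y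
  proof -
    have "y \<in> i ` carrier X" using exact y by (simp add: exact_at_def a_kernel_iff)
    then show ?thesis using \<rho>(2) y module_minus_eq_zero[OF Y] by auto
  qed
  from hom_factor_surj[OF Y Z Y q surj t this] obtain s where
    s: "s \<in> module_homs R Z Y" "\<And>y. y \<in> carrier Y \<Longrightarrow> s (q y) = y \<ominus>\<^bsub>Y\<^esub> i (\<rho> y)" by auto
  have "q (s z) = z" if z: "z \<in> carrier Z" for z
  proof -
    obtain y where y: "y \<in> carrier Y" "z = q y" using surj z by auto
    then show ?thesis
      using module_homs_minus[OF Y Z q y(1) iD(1)[OF \<rho>D(1)]] qi[OF \<rho>D(1)] qD(1)[of y]
      by (simp add: s a_minus_def)
  qed
  then show ?thesis using s(1) by blast
qed

lemma annihilator_ideal: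
  assumes A: "module R A" and x: "x \<in> carrier A"
  shows "ideal {r \<in> carrier R. r \<odot>\<^bsub>A\<^esub> x = \<zero>\<^bsub>A\<^esub>} R"
proof -
  interpret A: module R A by fact
  have neg: "(\<ominus>\<^bsub>R\<^esub> r) \<odot>\<^bsub>A\<^esub> x = \<zero>\<^bsub>A\<^esub>" if "r \<in> carrier R" "r \<odot>\<^bsub>A\<^esub> x = \<zero>\<^bsub>A\<^esub>" for r
    using A.smult_assoc1[of "\<ominus>\<^bsub>R\<^esub> \<one>\<^bsub>R\<^esub>" r x] that x by (simp add: A.R.l_minus)
  show ?thesis
  proof (rule idealI[OF A.R.ring_axioms])
    show "subgroup {r \<in> carrier R. r \<odot>\<^bsub>A\<^esub> x = \<zero>\<^bsub>A\<^esub>} (add_monoid R)"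
      using x neg by (intro A.R.add.subgroupI) (auto simp: A.smult_l_distr)
    fix a r assume a: "a \<in> {r \<in> carrier R. r \<odot>\<^bsub>A\<^esub> x = \<zero>\<^bsub>A\<^esub>}" and r: "r \<in> carrier R"
    then show "r \<otimes>\<^bsub>R\<^esub> a \<in> {r \<in> carrier R. r \<odot>\<^bsub>A\<^esub> x = \<zero>\<^bsub>A\<^esub>}" using x by (simp add: A.smult_assoc1)
    then show "a \<otimes>\<^bsub>R\<^esub> r \<in> {r \<in> carrier R. r \<odot>\<^bsub>A\<^esub> x = \<zero>\<^bsub>A\<^esub>}" using a r A.R.m_comm by auto
  qed
qed

subsection \<open>Transport of structure\<close>

text \<open>Faithful flatness is tested on carriers in the type of \<open>R\<close>, and a
  resolution needs one type for all terms, whereas quotients and hulls have carriers in other types.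
  Moving the operations along an injection repairs this.\<close>

definition transport_module :: "('b \<Rightarrow> 'c) \<Rightarrow> ('a, 'b) module \<Rightarrow> ('a, 'c) module" where
  "transport_module \<phi> A = (let \<psi> = inv_into (carrier A) \<phi> in
     \<lparr>carrier = \<phi> ` carrier A, monoid.mult = undefined, one = undefined,
      ring.zero = \<phi> \<zero>\<^bsub>A\<^esub>,
      ring.add = (\<lambda>x y. \<phi> (\<psi> x \<oplus>\<^bsub>A\<^esub> \<psi> y)),
      smult = (\<lambda>r x. \<phi> (r \<odot>\<^bsub>A\<^esub> \<psi> x))\<rparr>)"

lemma transport_module:
  assumes A: "module R A" and \<phi>: "inj_on \<phi> (carrier A)"
  defines "\<psi> \<equiv> inv_into (carrier A) \<phi>"
  shows "module R (transport_module \<phi> A)"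
    and "\<phi> \<in> module_homs R A (transport_module \<phi> A)"
    and "\<psi> \<in> module_homs R (transport_module \<phi> A) A"
    and "\<And>x. x \<in> carrier A \<Longrightarrow> \<psi> (\<phi> x) = x"
    and "\<And>y. y \<in> carrier (transport_module \<phi> A) \<Longrightarrow> \<phi> (\<psi> y) = y"
    and "carrier (transport_module \<phi> A) = \<phi> ` carrier A"
proof -
  interpret A: module R A by fact
  let ?T = "transport_module \<phi> A"
  show \<psi>\<phi>: "\<psi> (\<phi> x) = x" if "x \<in> carrier A" for x
    using \<phi> that by (simp add: \<psi>_def)
  have T: "carrier ?T = \<phi> ` carrier A" "\<zero>\<^bsub>?T\<^esub> = \<phi> \<zero>\<^bsub>A\<^esub>" "x \<oplus>\<^bsub>?T\<^esub> y = \<phi> (\<psi> x \<oplus>\<^bsub>A\<^esub> \<psi> y)"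
    "r \<odot>\<^bsub>?T\<^esub> x = \<phi> (r \<odot>\<^bsub>A\<^esub> \<psi> x)" for x y r
    by (simp_all add: transport_module_def \<psi>_def Let_def)
  show "carrier ?T = \<phi> ` carrier A" by (rule T)
  show "module R ?T"
  proof (rule moduleI)
    show "cring R" by (rule A.R.cring_axioms)
    show "abelian_group ?T"
    proof (rule abelian_groupI)
      fix x assume "x \<in> carrier ?T"
      then obtain a where a: "a \<in> carrier A" "x = \<phi> a" by (auto simp: T)
      then show "\<exists>y\<in>carrier ?T. y \<oplus>\<^bsub>?T\<^esub> x = \<zero>\<^bsub>?T\<^esub>"
        by (intro bexI[of _ "\<phi> (\<ominus>\<^bsub>A\<^esub> a)"]) (auto simp: T \<psi>\<phi> A.l_neg)
    qed (auto simp: T \<psi>\<phi> A.a_ac)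
  qed (auto simp: T \<psi>\<phi> A.smult_l_distr A.smult_r_distr A.smult_assoc1)
  show "\<phi> \<in> module_homs R A ?T" by (rule module_homsI) (auto simp: T \<psi>\<phi>)
  show "\<psi> \<in> module_homs R ?T A" by (rule module_homsI) (auto simp: T \<psi>\<phi>)
  show "\<phi> (\<psi> y) = y" if "y \<in> carrier ?T" for y using that by (auto simp: T \<psi>\<phi>)
qed

section \<open>Extending homomorphisms over ideals\<close>

text \<open>Baer's criterion relative to a submodule. If a prime ideal \<open>p\<close> annihilates \<open>B\<close>, then the
  condition that \<open>h\<close> vanish on annihilators makes \<open>J = p\<close> trivial, so that only ideals strictly above
  \<open>p\<close> need a genuine argument.\<close>

lemma hom_extend_via_ideals:
  fixes A :: "('a, 'b) module" and B :: "('a, 'c) module"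
  assumes M: "module R M" and A: "module R A" and B: "module R B"
    and i: "i \<in> module_homs R A B" "inj_on i (carrier A)" and g: "g \<in> module_homs R A M"
    and test: "\<And>b J h. b \<in> carrier B \<Longrightarrow> ideal J R \<Longrightarrow>
      {r \<in> carrier R. r \<odot>\<^bsub>B\<^esub> b \<in> i ` carrier A} \<subseteq> J \<Longrightarrow>
      h \<in> module_homs R (ideal_module R J) M \<Longrightarrow>
      (\<And>r. r \<in> J \<Longrightarrow> r \<odot>\<^bsub>B\<^esub> b = \<zero>\<^bsub>B\<^esub> \<Longrightarrow> h r = \<zero>\<^bsub>M\<^esub>) \<Longrightarrow>
      \<exists>m\<in>carrier M. \<forall>r\<in>J. h r = r \<odot>\<^bsub>M\<^esub> m"
  shows "\<exists>h\<in>module_homs R B M. \<forall>x\<in>carrier A. h (i x) = g x"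
proof -
  interpret A: module R A by fact
  interpret B: module R B by fact
  interpret M: module R M by fact
  \<comment> \<open>Zorn's lemma is applied to graphs of partial homomorphisms that extend
    \<open>g\<close> on the image of \<open>i\<close>; given the closure conditions, the last clause
    says that a graph is single-valued.\<close>
  define P where "P = {G. G \<subseteq> carrier B \<times> carrier M \<and> (\<lambda>x. (i x, g x)) ` carrier A \<subseteq> G \<and>
     (\<forall>b m b' m'. (b, m) \<in> G \<longrightarrow> (b', m') \<in> G \<longrightarrow> (b \<oplus>\<^bsub>B\<^esub> b', m \<oplus>\<^bsub>M\<^esub> m') \<in> G) \<and>
     (\<forall>r b m. r \<in> carrier R \<longrightarrow> (b, m) \<in> G \<longrightarrow> (r \<odot>\<^bsub>B\<^esub> b, r \<odot>\<^bsub>M\<^esub> m) \<in> G) \<and>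
     (\<forall>m. (\<zero>\<^bsub>B\<^esub>, m) \<in> G \<longrightarrow> m = \<zero>\<^bsub>M\<^esub>)}"
  note iD = module_homsD[OF i(1)] and gD = module_homsD[OF g]
  have base: "(\<lambda>x. (i x, g x)) ` carrier A \<in> P"
  proof -
    have "x = \<zero>\<^bsub>A\<^esub>" if "x \<in> carrier A" "i x = \<zero>\<^bsub>B\<^esub>" for x
      using i(2) that module_homs_zero[OF A B i(1)] by (metis A.zero_closed inj_onD)
    then have z: "g x = \<zero>\<^bsub>M\<^esub>" if "x \<in> carrier A" "i x = \<zero>\<^bsub>B\<^esub>" for x
      using that module_homs_zero[OF A M g] by auto
    have 1: "(i x \<oplus>\<^bsub>B\<^esub> i y, g x \<oplus>\<^bsub>M\<^esub> g y) \<in> (\<lambda>x. (i x, g x)) ` carrier A"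
      if "x \<in> carrier A" "y \<in> carrier A" for x y
      using that iD gD by (intro image_eqI[of _ _ "x \<oplus>\<^bsub>A\<^esub> y"]) auto
    have 2: "(r \<odot>\<^bsub>B\<^esub> i x, r \<odot>\<^bsub>M\<^esub> g x) \<in> (\<lambda>x. (i x, g x)) ` carrier A"
      if "x \<in> carrier A" "r \<in> carrier R" for x r
      using that iD gD by (intro image_eqI[of _ _ "r \<odot>\<^bsub>A\<^esub> x"]) auto
    show ?thesis unfolding P_def using iD(1) gD(1) z 1 2 by (auto dest: sym)
  qed
  have "\<exists>G\<in>P. \<forall>X\<in>P. G \<subseteq> X \<longrightarrow> X = G"
  proof (rule subset_Zorn_nonempty)
    show "P \<noteq> {}" using base by blast
    fix C assume C: "C \<noteq> {}" "subset.chain P C"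
    then have CP: "C \<subseteq> P" and ch: "\<And>X Y. X \<in> C \<Longrightarrow> Y \<in> C \<Longrightarrow> X \<subseteq> Y \<or> Y \<subseteq> X"
      by (auto simp: subset_chain_def)
    have "(b \<oplus>\<^bsub>B\<^esub> b', m \<oplus>\<^bsub>M\<^esub> m') \<in> \<Union>C" if h: "(b, m) \<in> X" "X \<in> C" "(b', m') \<in> Y" "Y \<in> C" for b m b' m' X Y
    proof -
      obtain Z where "Z \<in> C" "(b, m) \<in> Z" "(b', m') \<in> Z" using ch[of X Y] h by blast
      then show ?thesis using CP unfolding P_def by blast
    qed
    moreover have "\<Union>C \<subseteq> carrier B \<times> carrier M" using CP unfolding P_def by blast
    moreover have "(\<lambda>x. (i x, g x)) ` carrier A \<subseteq> \<Union>C" using CP C(1) unfolding P_def by blast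
    moreover have "\<forall>r b m. r \<in> carrier R \<longrightarrow> (b, m) \<in> \<Union>C \<longrightarrow> (r \<odot>\<^bsub>B\<^esub> b, r \<odot>\<^bsub>M\<^esub> m) \<in> \<Union>C"
      using CP unfolding P_def by blast
    moreover have "\<forall>m. (\<zero>\<^bsub>B\<^esub>, m) \<in> \<Union>C \<longrightarrow> m = \<zero>\<^bsub>M\<^esub>" using CP unfolding P_def by blast
    ultimately show "\<Union>C \<in> P" unfolding P_def by blast
  qed
  then obtain G where GP: "G \<in> P" and max: "\<And>X. X \<in> P \<Longrightarrow> G \<subseteq> X \<Longrightarrow> X = G" by blast
  have Gc: "b \<in> carrier B" "m \<in> carrier M" if "(b, m) \<in> G" for b m
    using GP that unfolding P_def by auto
  have Gi: "(i x, g x) \<in> G" if "x \<in> carrier A" for x using GP that unfolding P_def by auto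
  have Ga: "(b \<oplus>\<^bsub>B\<^esub> b', m \<oplus>\<^bsub>M\<^esub> m') \<in> G" if "(b, m) \<in> G" "(b', m') \<in> G" for b m b' m'
    using GP that unfolding P_def by auto
  have Gs: "(r \<odot>\<^bsub>B\<^esub> b, r \<odot>\<^bsub>M\<^esub> m) \<in> G" if "r \<in> carrier R" "(b, m) \<in> G" for r b m
    using GP that unfolding P_def by auto
  have Gz: "m = \<zero>\<^bsub>M\<^esub>" if "(\<zero>\<^bsub>B\<^esub>, m) \<in> G" for m
    using GP that unfolding P_def by auto
  have G0: "(\<zero>\<^bsub>B\<^esub>, \<zero>\<^bsub>M\<^esub>) \<in> G"
    using Gi[of "\<zero>\<^bsub>A\<^esub>"] module_homs_zero[OF A B i(1)] module_homs_zero[OF A M g] by simp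
  have Gn: "(\<ominus>\<^bsub>B\<^esub> b, \<ominus>\<^bsub>M\<^esub> m) \<in> G" if "(b, m) \<in> G" for b m
    using Gs[of "\<ominus>\<^bsub>R\<^esub> \<one>\<^bsub>R\<^esub>" b m] that Gc[OF that] by (simp add: B.smult_l_minus M.smult_l_minus)
  have Gu: "m = m'" if "(b, m) \<in> G" "(b, m') \<in> G" for b m m'
  proof -
    have "(b \<oplus>\<^bsub>B\<^esub> \<ominus>\<^bsub>B\<^esub> b, m \<oplus>\<^bsub>M\<^esub> \<ominus>\<^bsub>M\<^esub> m') \<in> G" using Ga Gn that by blast
    then have "m \<oplus>\<^bsub>M\<^esub> \<ominus>\<^bsub>M\<^esub> m' = \<zero>\<^bsub>M\<^esub>" using Gz Gc[OF that(1)] by (simp add: B.r_neg)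
    then show ?thesis using Gc that by (metis M.add.inv_closed M.add.inv_inv M.minus_equality M.a_comm)
  qed
  have total: "\<exists>m. (b, m) \<in> G" if b: "b \<in> carrier B" for b
  proof -
    \<comment> \<open>The multipliers that carry \<open>b\<close> into the domain of
      \<open>G\<close> form an ideal \<open>I\<close>, and \<open>G\<close> induces the homomorphism
      \<open>k\<close> on it. Extending \<open>G\<close> to \<open>b\<close> amounts to finding
      \<open>m\<close> with \<open>k r = r m\<close> on \<open>I\<close>.\<close>
    define I where "I = {r \<in> carrier R. \<exists>m. (r \<odot>\<^bsub>B\<^esub> b, m) \<in> G}"
    define k where "k = (\<lambda>r. THE m. (r \<odot>\<^bsub>B\<^esub> b, m) \<in> G)"
    have k: "k r = m" if "(r \<odot>\<^bsub>B\<^esub> b, m) \<in> G" for r m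
      unfolding k_def using that Gu by blast
    have kG: "(r \<odot>\<^bsub>B\<^esub> b, k r) \<in> G" if "r \<in> I" for r using that k unfolding I_def by auto
    have ideal: "ideal I R"
    proof (rule idealI)
      show "ring R" by (rule A.R.ring_axioms)
      show "subgroup I (add_monoid R)"
      proof (rule A.R.add.subgroupI)
        show "I \<subseteq> carrier R" by (auto simp: I_def)
        show "I \<noteq> {}" using G0 b by (auto simp: I_def intro!: exI[of _ "\<zero>\<^bsub>R\<^esub>"])
        fix r assume r: "r \<in> I"
        then show "\<ominus>\<^bsub>R\<^esub> r \<in> I" using Gn[OF kG[OF r]] b by (auto simp: I_def B.smult_l_minus)
        fix s assume s: "s \<in> I"
        then show "r \<oplus>\<^bsub>R\<^esub> s \<in> I" using Ga[OF kG[OF r] kG[OF s]] r b by (auto simp: I_def B.smult_l_distr)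
      qed
      fix r s assume rs: "r \<in> I" "s \<in> carrier R"
      then show "s \<otimes>\<^bsub>R\<^esub> r \<in> I" using Gs[OF rs(2) kG[OF rs(1)]] b by (auto simp: I_def B.smult_assoc1)
      then show "r \<otimes>\<^bsub>R\<^esub> s \<in> I" using rs A.R.m_comm by (auto simp: I_def)
    qed
    have kI: "k \<in> module_homs R (ideal_module R I) M"
    proof (rule module_homsI)
      fix r assume "r \<in> carrier (ideal_module R I)"
      then have r: "r \<in> I" by (simp add: ideal_module_def)
      then show "k r \<in> carrier M" using Gc kG by blast
      fix s
      show "k (r \<oplus>\<^bsub>ideal_module R I\<^esub> s) = k r \<oplus>\<^bsub>M\<^esub> k s" if "s \<in> carrier (ideal_module R I)"
        using Ga[OF kG[OF r] kG[of s]] r that b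
        by (intro k) (auto simp: ideal_module_def I_def B.smult_l_distr)
      show "k (s \<odot>\<^bsub>ideal_module R I\<^esub> r) = s \<odot>\<^bsub>M\<^esub> k r" if "s \<in> carrier R"
        using Gs[OF that kG[OF r]] r that b
        by (intro k) (auto simp: ideal_module_def I_def B.smult_assoc1)
    qed
    \<comment> \<open>This and the next fact are the two side conditions of \<open>test\<close>;
      both come from \<open>G\<close> being a single-valued graph that extends
      \<open>g\<close>.\<close>
    have kz: "k r = \<zero>\<^bsub>M\<^esub>" if "r \<in> I" "r \<odot>\<^bsub>B\<^esub> b = \<zero>\<^bsub>B\<^esub>" for r
      using kG[OF that(1)] that(2) Gz by simp
    have "{r \<in> carrier R. r \<odot>\<^bsub>B\<^esub> b \<in> i ` carrier A} \<subseteq> I" unfolding I_def using Gi by force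
    from test[OF b ideal this kI kz] obtain m where
      m: "m \<in> carrier M" and hk: "\<And>r. r \<in> I \<Longrightarrow> k r = r \<odot>\<^bsub>M\<^esub> m" by auto
    have Im: "(r \<odot>\<^bsub>B\<^esub> b, r \<odot>\<^bsub>M\<^esub> m) \<in> G" if "r \<in> I" for r
      using kG[OF that] hk[OF that] by simp
    define G' where "G' = {(c \<oplus>\<^bsub>B\<^esub> r \<odot>\<^bsub>B\<^esub> b, n \<oplus>\<^bsub>M\<^esub> r \<odot>\<^bsub>M\<^esub> m) | c n r. (c, n) \<in> G \<and> r \<in> carrier R}"
    have G'I: "(c \<oplus>\<^bsub>B\<^esub> r \<odot>\<^bsub>B\<^esub> b, n \<oplus>\<^bsub>M\<^esub> r \<odot>\<^bsub>M\<^esub> m) \<in> G'" if "(c, n) \<in> G" "r \<in> carrier R" for c n r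
      using that unfolding G'_def by blast
    have sub: "G \<subseteq> G'"
    proof
      fix z assume z: "z \<in> G"
      obtain c n where zc: "z = (c, n)" by (cases z)
      show "z \<in> G'" using G'I[of c n "\<zero>\<^bsub>R\<^esub>"] z zc Gc[of c n] b m by simp
    qed
    have "G' \<in> P"
    proof -
      have 1: "G' \<subseteq> carrier B \<times> carrier M" using Gc b m by (auto simp: G'_def)
      have 2: "(\<lambda>x. (i x, g x)) ` carrier A \<subseteq> G'" using Gi sub by blast
      have 3: "(c \<oplus>\<^bsub>B\<^esub> c', n \<oplus>\<^bsub>M\<^esub> n') \<in> G'" if "(c, n) \<in> G'" "(c', n') \<in> G'" for c n c' n'
      proof -
        from that obtain d p r d' p' r' where
          e: "(d, p) \<in> G" "r \<in> carrier R" "c = d \<oplus>\<^bsub>B\<^esub> r \<odot>\<^bsub>B\<^esub> b" "n = p \<oplus>\<^bsub>M\<^esub> r \<odot>\<^bsub>M\<^esub> m"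
             "(d', p') \<in> G" "r' \<in> carrier R" "c' = d' \<oplus>\<^bsub>B\<^esub> r' \<odot>\<^bsub>B\<^esub> b" "n' = p' \<oplus>\<^bsub>M\<^esub> r' \<odot>\<^bsub>M\<^esub> m"
          unfolding G'_def by blast
        have "c \<oplus>\<^bsub>B\<^esub> c' = (d \<oplus>\<^bsub>B\<^esub> d') \<oplus>\<^bsub>B\<^esub> (r \<oplus>\<^bsub>R\<^esub> r') \<odot>\<^bsub>B\<^esub> b"
          using e Gc b by (simp add: B.smult_l_distr B.a_ac)
        moreover have "n \<oplus>\<^bsub>M\<^esub> n' = (p \<oplus>\<^bsub>M\<^esub> p') \<oplus>\<^bsub>M\<^esub> (r \<oplus>\<^bsub>R\<^esub> r') \<odot>\<^bsub>M\<^esub> m"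
          using e Gc m by (simp add: M.smult_l_distr M.a_ac)
        ultimately show ?thesis using G'I[OF Ga[OF e(1) e(5)]] e by simp
      qed
      have 4: "(s \<odot>\<^bsub>B\<^esub> c, s \<odot>\<^bsub>M\<^esub> n) \<in> G'" if "s \<in> carrier R" "(c, n) \<in> G'" for s c n
      proof -
        from that obtain d p r where
          e: "(d, p) \<in> G" "r \<in> carrier R" "c = d \<oplus>\<^bsub>B\<^esub> r \<odot>\<^bsub>B\<^esub> b" "n = p \<oplus>\<^bsub>M\<^esub> r \<odot>\<^bsub>M\<^esub> m"
          unfolding G'_def by blast
        then show ?thesis using G'I[OF Gs[OF that(1) e(1)], of "s \<otimes>\<^bsub>R\<^esub> r"] that Gc b m
          by (simp add: B.smult_assoc1 M.smult_assoc1 B.smult_r_distr M.smult_r_distr)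
      qed
      \<comment> \<open>The choice of \<open>m\<close> enters here: if \<open>d + r b = 0\<close>
        then \<open>r\<close> lies in \<open>I\<close>, so \<open>r m\<close> is the value that
        \<open>G\<close> already assigns to \<open>r b\<close>.\<close>
      have 5: "n = \<zero>\<^bsub>M\<^esub>" if "(\<zero>\<^bsub>B\<^esub>, n) \<in> G'" for n
      proof -
        from that obtain d p r where
          e: "(d, p) \<in> G" "r \<in> carrier R" "\<zero>\<^bsub>B\<^esub> = d \<oplus>\<^bsub>B\<^esub> r \<odot>\<^bsub>B\<^esub> b" "n = p \<oplus>\<^bsub>M\<^esub> r \<odot>\<^bsub>M\<^esub> m"
          unfolding G'_def by blast
        note dc = Gc[OF e(1)]
        have "r \<odot>\<^bsub>B\<^esub> b = \<ominus>\<^bsub>B\<^esub> d"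
          using e dc b by (metis B.a_comm B.minus_equality B.smult_closed)
        then have "(r \<odot>\<^bsub>B\<^esub> b, \<ominus>\<^bsub>M\<^esub> p) \<in> G" using Gn[OF e(1)] by simp
        moreover from this have "r \<in> I" using e by (auto simp: I_def)
        ultimately have "r \<odot>\<^bsub>M\<^esub> m = \<ominus>\<^bsub>M\<^esub> p" using Im Gu by blast
        then show ?thesis using e dc by (simp add: M.r_neg)
      qed
      show ?thesis unfolding P_def using 1 2 3 4 5 by blast
    qed
    then have "G' = G" using max sub by blast
    moreover have "(\<zero>\<^bsub>B\<^esub> \<oplus>\<^bsub>B\<^esub> \<one>\<^bsub>R\<^esub> \<odot>\<^bsub>B\<^esub> b, \<zero>\<^bsub>M\<^esub> \<oplus>\<^bsub>M\<^esub> \<one>\<^bsub>R\<^esub> \<odot>\<^bsub>M\<^esub> m) \<in> G'"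
      by (rule G'I[OF G0]) simp
    ultimately show ?thesis using b m by auto
  qed
  define h where "h = (\<lambda>b. THE m. (b, m) \<in> G)"
  have hI: "h b = m" if "(b, m) \<in> G" for b m
    unfolding h_def using that Gu by blast
  have hG: "(b, h b) \<in> G" if "b \<in> carrier B" for b using total[OF that] hI by auto
  have "h \<in> module_homs R B M"
    by (rule module_homsI) (auto intro: hI Ga Gs hG Gc(2)[OF hG])
  moreover have "\<forall>x\<in>carrier A. h (i x) = g x" using Gi hI by blast
  ultimately show ?thesis by blast
qed

text \<open>Baer's criterion: the relative version with its two side conditions on \<open>J\<close>
  and \<open>h\<close> discarded.\<close>

lemma injective_module_via_ideals:
  assumes M: "module R M"
    and test: "\<And>J h. ideal J R \<Longrightarrow> h \<in> module_homs R (ideal_module R J) M \<Longrightarrow>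
      \<exists>m\<in>carrier M. \<forall>r\<in>J. h r = r \<odot>\<^bsub>M\<^esub> m"
  shows "injective_module R M"
  unfolding injective_module_def
  by (intro conjI allI impI M; elim conjE; rule hom_extend_via_ideals) (auto intro: M test)

text \<open>Extend \<open>h\<close> from \<open>J\<close> to \<open>R\<close> and take for
  \<open>m\<close> the value at one.\<close>

lemma injective_module_ideal_hom:
  assumes M: "injective_module R M" and J: "ideal J R"
    and h: "h \<in> module_homs R (ideal_module R J) M"
  shows "\<exists>m\<in>carrier M. \<forall>r\<in>J. h r = r \<odot>\<^bsub>M\<^esub> m"
proof -
  interpret M: module R M using M by (simp add: injective_module_def)
  interpret J: ideal J R by fact
  have R: "cring R" by (rule M.R.cring_axioms)
  have "(\<lambda>x. x) \<in> module_homs R (ideal_module R J) (regular_module R)"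
    by (rule module_homsI) (auto simp: J.Icarr)
  from injective_module_extend[OF M module_ideal_module[OF R J] module_regular_module[OF R] this _ h]
  obtain k where k: "k \<in> module_homs R (regular_module R) M" "\<And>r. r \<in> J \<Longrightarrow> k r = h r"
    by auto
  have "h r = r \<odot>\<^bsub>M\<^esub> k \<one>\<^bsub>R\<^esub>" if "r \<in> J" for r
    using module_homsD(3)[OF k(1), of r "\<one>\<^bsub>R\<^esub>"] k(2)[OF that] J.Icarr[OF that] by simp
  then show ?thesis using module_homsD(1)[OF k(1), of "\<one>\<^bsub>R\<^esub>"] by auto
qed

text \<open>The submodule of the relative criterion is \<open>R t\<close>, and \<open>ann\<close>
  makes \<open>t\<close> to \<open>y\<close> well defined on it. Of the lower bound on
  \<open>J\<close> only the annihilator of \<open>b\<close> is kept, which still forces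
  \<open>J\<close> to contain any ideal that kills \<open>B\<close>.\<close>

lemma hom_extend_cyclic:
  fixes B :: "('a, 'c) module"
  assumes M: "module R M" and B: "module R B" and t: "t \<in> carrier B" and y: "y \<in> carrier M"
    and ann: "\<And>r. r \<in> carrier R \<Longrightarrow> r \<odot>\<^bsub>B\<^esub> t = \<zero>\<^bsub>B\<^esub> \<Longrightarrow> r \<odot>\<^bsub>M\<^esub> y = \<zero>\<^bsub>M\<^esub>"
    and test: "\<And>b J h. b \<in> carrier B \<Longrightarrow> ideal J R \<Longrightarrow>
      h \<in> module_homs R (ideal_module R J) M \<Longrightarrow>
      {r \<in> carrier R. r \<odot>\<^bsub>B\<^esub> b = \<zero>\<^bsub>B\<^esub>} \<subseteq> J \<Longrightarrow>
      (\<And>r. r \<in> J \<Longrightarrow> r \<odot>\<^bsub>B\<^esub> b = \<zero>\<^bsub>B\<^esub> \<Longrightarrow> h r = \<zero>\<^bsub>M\<^esub>) \<Longrightarrow>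
      \<exists>m\<in>carrier M. \<forall>r\<in>J. h r = r \<odot>\<^bsub>M\<^esub> m"
  shows "\<exists>h\<in>module_homs R B M. h t = y"
proof -
  interpret M: module R M by fact
  interpret B: module R B by fact
  have R: "cring R" by (rule M.R.cring_axioms)
  note Rm = module_regular_module[OF R]
  let ?I = "B\<lparr>carrier := (\<lambda>r. r \<odot>\<^bsub>B\<^esub> t) ` carrier R\<rparr>"
  have sub: "submodule ((\<lambda>r. r \<odot>\<^bsub>B\<^esub> t) ` carrier R) R B"
    using hom_image_submodule[OF Rm B module_homs_smult_elem[OF B t]] by simp
  have I: "module R ?I" by (rule submodule.submodule_is_module[OF sub B])
  have f: "(\<lambda>r. r \<odot>\<^bsub>B\<^esub> t) \<in> module_homs R (regular_module R) ?I"
    using module_homsD[OF module_homs_smult_elem[OF B t]] by (intro module_homsI) auto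
  obtain g where g: "g \<in> module_homs R ?I M" "\<And>r. r \<in> carrier R \<Longrightarrow> g (r \<odot>\<^bsub>B\<^esub> t) = r \<odot>\<^bsub>M\<^esub> y"
    using hom_factor_surj[OF Rm I M f _ module_homs_smult_elem[OF M y]] ann by auto
  have inc: "(\<lambda>x. x) \<in> module_homs R ?I B" using t by (intro module_homsI) auto
  have zero: "\<zero>\<^bsub>B\<^esub> \<in> (\<lambda>r. r \<odot>\<^bsub>B\<^esub> t) ` carrier R"
    by (rule image_eqI[of _ _ "\<zero>\<^bsub>R\<^esub>"]) (use t in auto)
  have "\<exists>h\<in>module_homs R B M. \<forall>x\<in>carrier ?I. h x = g x"
  proof (rule hom_extend_via_ideals[OF M I B inc _ g(1)])
    fix b J h assume "b \<in> carrier B" "ideal J R" "h \<in> module_homs R (ideal_module R J) M"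
      and J: "{r \<in> carrier R. r \<odot>\<^bsub>B\<^esub> b \<in> (\<lambda>x. x) ` carrier ?I} \<subseteq> J"
      and "\<And>r. r \<in> J \<Longrightarrow> r \<odot>\<^bsub>B\<^esub> b = \<zero>\<^bsub>B\<^esub> \<Longrightarrow> h r = \<zero>\<^bsub>M\<^esub>"
    then show "\<exists>m\<in>carrier M. \<forall>r\<in>J. h r = r \<odot>\<^bsub>M\<^esub> m"
      by (intro test[of b]) (use zero in auto)
  qed simp
  then obtain h where h: "h \<in> module_homs R B M" "\<And>x. x \<in> carrier ?I \<Longrightarrow> h x = g x" by blast
  have "t \<in> carrier ?I" using t by (auto intro!: image_eqI[of _ _ "\<one>\<^bsub>R\<^esub>"])
  then have "h t = y" using h(2)[of t] g(2)[of "\<one>\<^bsub>R\<^esub>"] t y by simp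
  then show ?thesis using h(1) by blast
qed

section \<open>Homomorphisms out of free modules, quotients and tensor products\<close>

lemma free_module_hom_eqI:
  assumes A: "module R A" and f: "f \<in> module_homs R (free_module R S) A" and g: "g \<in> module_homs R (free_module R S) A"
    and eq: "\<And>s. s \<in> S \<Longrightarrow> f (free_gen R s) = g (free_gen R s)"
    and p: "p \<in> carrier (free_module R S)"
  shows "f p = g p"
proof -
  interpret A: module R A by fact
  have R: "cring R" by (rule A.R.cring_axioms)
  let ?P = "free_module R S"
  interpret P: module R ?P by (rule module_free_module[OF R])
  note P = P.module_axioms
  note fD = module_homsD[OF f] and gD = module_homsD[OF g]
  have "finite {s. p s \<noteq> \<zero>\<^bsub>R\<^esub>}" using p by (simp add: free_module_carrier)
  then show ?thesis using p
  proof (induction "{s. p s \<noteq> \<zero>\<^bsub>R\<^esub>}" arbitrary: p rule: finite_induct)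
    case empty
    then have "p = \<zero>\<^bsub>?P\<^esub>" by (auto simp: free_module_simps)
    then show ?case using module_homs_zero[OF P A f] module_homs_zero[OF P A g] by simp
  next
    case (insert t T p)
    define q where "q = (\<lambda>s. if s = t then \<zero>\<^bsub>R\<^esub> else p s)"
    have pc: "p s \<in> carrier R" for s using insert.prems by (simp add: free_module_carrier)
    have T: "T = {s. q s \<noteq> \<zero>\<^bsub>R\<^esub>}" using insert.hyps(2,4) by (auto simp: q_def)
    have q: "q \<in> carrier ?P"
      using insert.prems insert.hyps(1) T by (auto simp: free_module_carrier q_def)
    have tS: "t \<in> S" using insert.hyps(4) insert.prems by (auto simp: free_module_carrier)
    have gen: "free_gen R t \<in> carrier ?P" by (rule free_gen_closed[OF R tS])
    have pq: "p = p t \<odot>\<^bsub>?P\<^esub> free_gen R t \<oplus>\<^bsub>?P\<^esub> q"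
      using pc by (auto simp: free_module_simps free_gen_def q_def fun_eq_iff)
    have "f p = p t \<odot>\<^bsub>A\<^esub> f (free_gen R t) \<oplus>\<^bsub>A\<^esub> f q"
      by (subst pq) (simp only: fD P.smult_closed pc gen q)
    moreover have "g p = p t \<odot>\<^bsub>A\<^esub> g (free_gen R t) \<oplus>\<^bsub>A\<^esub> g q"
      by (subst pq) (simp only: gD P.smult_closed pc gen q)
    ultimately show ?case using insert.hyps(3)[OF T q] eq[OF tS] by simp
  qed
qed

text \<open>Projectivity of free modules: preimages are chosen on the generators only.\<close>

lemma free_module_lift:
  assumes A: "module R A" and B: "module R B" and f: "f \<in> module_homs R A B"
    and surj: "f ` carrier A = carrier B" and c: "c \<in> module_homs R (free_module R S) B"
  shows "\<exists>b\<in>module_homs R (free_module R S) A. \<forall>p\<in>carrier (free_module R S). f (b p) = c p"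
proof -
  have R: "cring R" using A module.axioms(1) by blast
  have "\<exists>x. x \<in> carrier A \<and> f x = c (free_gen R s)" if "s \<in> S" for s
    using module_homsD(1)[OF c free_gen_closed[OF R that]] surj by (metis imageE)
  then obtain \<phi> where \<phi>: "\<phi> s \<in> carrier A" "f (\<phi> s) = c (free_gen R s)" if "s \<in> S" for s by metis
  have phi: "\<phi> \<in> S \<rightarrow> carrier A" using \<phi> by auto
  note b = linear_extension_hom[OF A phi]
  have "f (linear_extension R A \<phi> p) = c p" if "p \<in> carrier (free_module R S)" for p
    by (rule free_module_hom_eqI[OF B module_homs_comp[OF b f] c _ that])
      (simp add: linear_extension_gen[OF A phi] \<phi>)
  then show ?thesis using b by blast
qed

lemma quotient_hom:
  assumes A: "module R A" and N: "submodule N R A"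
  shows "(\<lambda>x. N +>\<^bsub>A\<^esub> x) \<in> module_homs R A (quotient_module A N)"
    and "(\<lambda>x. N +>\<^bsub>A\<^esub> x) ` carrier A = carrier (quotient_module A N)"
    and "\<And>x. x \<in> carrier A \<Longrightarrow> N +>\<^bsub>A\<^esub> x = \<zero>\<^bsub>quotient_module A N\<^esub> \<longleftrightarrow> x \<in> N"
proof -
  interpret A: module R A by fact
  note sub = A.submoduleE[OF N]
  show "(\<lambda>x. N +>\<^bsub>A\<^esub> x) \<in> module_homs R A (quotient_module A N)"
    by (rule module_homsI) (simp_all add: coset_closed[OF A N] quotient_add[OF A N] quotient_smult[OF A N])
  show "(\<lambda>x. N +>\<^bsub>A\<^esub> x) ` carrier A = carrier (quotient_module A N)"
    using coset_closed[OF A N] by (auto elim!: quotient_carrierE[OF A N])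
  fix x assume x: "x \<in> carrier A"
  show "N +>\<^bsub>A\<^esub> x = \<zero>\<^bsub>quotient_module A N\<^esub> \<longleftrightarrow> x \<in> N"
  proof
    assume "N +>\<^bsub>A\<^esub> x = \<zero>\<^bsub>quotient_module A N\<^esub>"
    then have "N +>\<^bsub>A\<^esub> x = N" by (simp add: quotient_module_def)
    moreover have "x \<in> N +>\<^bsub>A\<^esub> x"
      using subgroup.one_closed[OF submodule.axioms(1)[OF N]] x
      by (auto simp: a_r_coset_def' intro!: exI[of _ "\<zero>\<^bsub>A\<^esub>"] bexI[of _ "\<zero>\<^bsub>A\<^esub>"])
    ultimately show "x \<in> N" by simp
  next
    assume "x \<in> N"
    then have "N +>\<^bsub>A\<^esub> x = N +>\<^bsub>A\<^esub> \<zero>\<^bsub>A\<^esub>"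
      using A.a_coset_join2[OF x submodule.axioms(1)[OF N]] A.a_coset_join2[OF A.zero_closed submodule.axioms(1)[OF N]]
        subgroup.one_closed[OF submodule.axioms(1)[OF N]] by simp
    then show "N +>\<^bsub>A\<^esub> x = \<zero>\<^bsub>quotient_module A N\<^esub>" by (simp add: quotient_zero[OF A N])
  qed
qed

lemma tensor_hom_eqI:
  assumes A: "module R A" and B: "module R B" and C: "module R C"
    and f: "f \<in> module_homs R (tensor_module R A B) C" and g: "g \<in> module_homs R (tensor_module R A B) C"
    and eq: "\<And>x y. x \<in> carrier A \<Longrightarrow> y \<in> carrier B \<Longrightarrow> f (pure_tensor R A B x y) = g (pure_tensor R A B x y)"
    and t: "t \<in> carrier (tensor_module R A B)"
  shows "f t = g t"
proof -
  have R: "cring R" using A module.axioms(1) by blast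
  let ?P = "free_module R (carrier A \<times> carrier B)" and ?K = "tensor_kernel R A B"
  note P = module_free_module[OF R, of "carrier A \<times> carrier B"] and K = tensor_kernel_sub[OF A B]
  note q = quotient_hom[OF P K, folded tensor_module_def]
  obtain p where p: "p \<in> carrier ?P" "t = ?K +>\<^bsub>?P\<^esub> p" using t q(2) by auto
  show ?thesis unfolding p(2)
  proof (rule free_module_hom_eqI[OF C module_homs_comp[OF q(1) f] module_homs_comp[OF q(1) g] _ p(1)])
    fix s assume "s \<in> carrier A \<times> carrier B"
    then show "f (?K +>\<^bsub>?P\<^esub> free_gen R s) = g (?K +>\<^bsub>?P\<^esub> free_gen R s)"
      using eq[of "fst s" "snd s"] by (auto simp: pure_tensor_def)
  qed
qed

lemma tensor_lift:
  assumes A: "module R A" and B: "module R B" and C: "module R C"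
    and \<beta>: "\<And>x y. x \<in> carrier A \<Longrightarrow> y \<in> carrier B \<Longrightarrow> \<beta> x y \<in> carrier C"
    "\<And>x x' y. x \<in> carrier A \<Longrightarrow> x' \<in> carrier A \<Longrightarrow> y \<in> carrier B \<Longrightarrow> \<beta> (x \<oplus>\<^bsub>A\<^esub> x') y = \<beta> x y \<oplus>\<^bsub>C\<^esub> \<beta> x' y"
    "\<And>x y y'. x \<in> carrier A \<Longrightarrow> y \<in> carrier B \<Longrightarrow> y' \<in> carrier B \<Longrightarrow> \<beta> x (y \<oplus>\<^bsub>B\<^esub> y') = \<beta> x y \<oplus>\<^bsub>C\<^esub> \<beta> x y'"
    "\<And>r x y. r \<in> carrier R \<Longrightarrow> x \<in> carrier A \<Longrightarrow> y \<in> carrier B \<Longrightarrow> \<beta> (r \<odot>\<^bsub>A\<^esub> x) y = r \<odot>\<^bsub>C\<^esub> \<beta> x y"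
    "\<And>r x y. r \<in> carrier R \<Longrightarrow> x \<in> carrier A \<Longrightarrow> y \<in> carrier B \<Longrightarrow> \<beta> x (r \<odot>\<^bsub>B\<^esub> y) = r \<odot>\<^bsub>C\<^esub> \<beta> x y"
  shows "\<exists>h\<in>module_homs R (tensor_module R A B) C. \<forall>x\<in>carrier A. \<forall>y\<in>carrier B. h (pure_tensor R A B x y) = \<beta> x y"
proof -
  have R: "cring R" using A module.axioms(1) by blast
  let ?P = "free_module R (carrier A \<times> carrier B)" and ?K = "tensor_kernel R A B"
  let ?L = "linear_extension R C (\<lambda>(x, y). \<beta> x y)"
  note P = module_free_module[OF R, of "carrier A \<times> carrier B"] and K = tensor_kernel_sub[OF A B]
  note q = quotient_hom[OF P K, folded tensor_module_def]
  have phi: "(\<lambda>(x, y). \<beta> x y) \<in> carrier A \<times> carrier B \<rightarrow> carrier C" using \<beta>(1) by auto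
  note L = linear_extension_hom[OF C phi]
  have ker: "?L p = \<zero>\<^bsub>C\<^esub>" if "p \<in> carrier ?P" "?K +>\<^bsub>?P\<^esub> p = \<zero>\<^bsub>tensor_module R A B\<^esub>" for p
    using tensor_kernel_bilinear[OF A B C \<beta>] that q(3)[OF that(1)] by (auto simp: a_kernel_iff)
  obtain h where h: "h \<in> module_homs R (tensor_module R A B) C" "\<And>p. p \<in> carrier ?P \<Longrightarrow> h (?K +>\<^bsub>?P\<^esub> p) = ?L p"
    using hom_factor_surj[OF P module_tensor_module[OF A B] C q(1,2) L ker] by blast
  have "h (pure_tensor R A B x y) = \<beta> x y" if "x \<in> carrier A" "y \<in> carrier B" for x y
    using that linear_extension_gen[OF C phi, of "(x, y)"]
    by (simp add: pure_tensor_def h(2)[OF free_gen_closed[OF R]])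
  then show ?thesis using h(1) by blast
qed

section \<open>Abelian groups as modules over the integers\<close>

text \<open>Injectives over \<open>R\<close> will be coinduced from divisible groups, so abelian
  groups have to count as modules over \<open>\<Z>\<close>. The argument is a ring scheme so that
  additive groups of rings and of modules are both covered.\<close>

definition int_module :: "('b, 'z) ring_scheme \<Rightarrow> (int, 'b) module" where
  "int_module G =
     \<lparr>carrier = carrier G, monoid.mult = undefined, one = undefined,
      ring.zero = \<zero>\<^bsub>G\<^esub>, ring.add = add G, smult = (\<lambda>n x. [n] \<cdot>\<^bsub>G\<^esub> x)\<rparr>"

lemma int_module_simps [simp]:
  "carrier (int_module G) = carrier G" "\<zero>\<^bsub>int_module G\<^esub> = \<zero>\<^bsub>G\<^esub>" "x \<oplus>\<^bsub>int_module G\<^esub> y = x \<oplus>\<^bsub>G\<^esub> y"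
  by (simp_all add: int_module_def)

lemma module_int_module:
  assumes "abelian_group G"
  shows "module \<Z> (int_module G)"
proof -
  interpret G: abelian_group G by fact
  show ?thesis
  proof (rule moduleI)
    show "abelian_group (int_module G)"
    proof (rule abelian_groupI)
      fix x assume "x \<in> carrier (int_module G)"
      then show "\<exists>y\<in>carrier (int_module G). y \<oplus>\<^bsub>int_module G\<^esub> x = \<zero>\<^bsub>int_module G\<^esub>"
        by (intro bexI[of _ "\<ominus>\<^bsub>G\<^esub> x"]) (auto simp: G.l_neg)
    qed (auto simp: G.a_ac)
    fix a b x y assume "x \<in> carrier (int_module G)" "y \<in> carrier (int_module G)"
    then show "(a \<oplus>\<^bsub>\<Z>\<^esub> b) \<odot>\<^bsub>int_module G\<^esub> x = a \<odot>\<^bsub>int_module G\<^esub> x \<oplus>\<^bsub>int_module G\<^esub> b \<odot>\<^bsub>int_module G\<^esub> x"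
      "a \<odot>\<^bsub>int_module G\<^esub> (x \<oplus>\<^bsub>int_module G\<^esub> y) = a \<odot>\<^bsub>int_module G\<^esub> x \<oplus>\<^bsub>int_module G\<^esub> a \<odot>\<^bsub>int_module G\<^esub> y"
      "(a \<otimes>\<^bsub>\<Z>\<^esub> b) \<odot>\<^bsub>int_module G\<^esub> x = a \<odot>\<^bsub>int_module G\<^esub> (b \<odot>\<^bsub>int_module G\<^esub> x)"
      "\<one>\<^bsub>\<Z>\<^esub> \<odot>\<^bsub>int_module G\<^esub> x = x" "a \<odot>\<^bsub>int_module G\<^esub> x \<in> carrier (int_module G)"
      by (simp_all add: int_module_def G.add.int_pow_mult G.add.int_pow_distrib G.add.int_pow_pow mult.commute)
  qed (rule int_is_cring)
qed

lemma additive_int_hom: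
  assumes A: "module \<Z> A" and B: "module \<Z> B"
    and f: "\<And>x. x \<in> carrier A \<Longrightarrow> f x \<in> carrier B"
    and add: "\<And>x y. x \<in> carrier A \<Longrightarrow> y \<in> carrier A \<Longrightarrow> f (x \<oplus>\<^bsub>A\<^esub> y) = f x \<oplus>\<^bsub>B\<^esub> f y"
  shows "f \<in> module_homs \<Z> A B"
proof (rule module_homsI)
  interpret A: module \<Z> A by fact
  interpret B: module \<Z> B by fact
  have lA: "(i + j) \<odot>\<^bsub>A\<^esub> x = i \<odot>\<^bsub>A\<^esub> x \<oplus>\<^bsub>A\<^esub> j \<odot>\<^bsub>A\<^esub> x" if "x \<in> carrier A" for i j x
    using A.smult_l_distr[of i j x] that by simp
  have lB: "(i + j) \<odot>\<^bsub>B\<^esub> x = i \<odot>\<^bsub>B\<^esub> x \<oplus>\<^bsub>B\<^esub> j \<odot>\<^bsub>B\<^esub> x" if "x \<in> carrier B" for i j x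
    using B.smult_l_distr[of i j x] that by simp
  have oA: "1 \<odot>\<^bsub>A\<^esub> x = x" "i \<odot>\<^bsub>A\<^esub> x \<in> carrier A" if "x \<in> carrier A" for x i
    using A.smult_one[OF that] A.smult_closed[of i x] that by auto
  have oB: "1 \<odot>\<^bsub>B\<^esub> x = x" "i \<odot>\<^bsub>B\<^esub> x \<in> carrier B" if "x \<in> carrier B" for x i
    using B.smult_one[OF that] B.smult_closed[of i x] that by auto
  have zB: "0 \<odot>\<^bsub>B\<^esub> x = \<zero>\<^bsub>B\<^esub>" if "x \<in> carrier B" for x using B.smult_l_null[OF that] by simp
  have zA: "0 \<odot>\<^bsub>A\<^esub> x = \<zero>\<^bsub>A\<^esub>" if "x \<in> carrier A" for x using A.smult_l_null[OF that] by simp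
  have f0: "f \<zero>\<^bsub>A\<^esub> = \<zero>\<^bsub>B\<^esub>"
    using add[of "\<zero>\<^bsub>A\<^esub>" "\<zero>\<^bsub>A\<^esub>"] f[of "\<zero>\<^bsub>A\<^esub>"] B.M.add.r_cancel_one'[of "f \<zero>\<^bsub>A\<^esub>" "f \<zero>\<^bsub>A\<^esub>"] by simp
  fix r x assume x: "x \<in> carrier A"
  have "f (r \<odot>\<^bsub>A\<^esub> x) = r \<odot>\<^bsub>B\<^esub> f x"
  proof (induction r rule: int_induct[of _ 0])
    case base
    then show ?case using x by (simp add: zA zB f0 f)
  next
    case (step1 i)
    then show ?case using x by (simp add: lA lB oA oB f add)
  next
    \<comment> \<open>Going downwards, the equation for \<open>i - 1\<close> is obtained by adding
      \<open>f x\<close> on both sides and cancelling.\<close>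
    case (step2 i)
    have "f ((i - 1) \<odot>\<^bsub>A\<^esub> x) \<oplus>\<^bsub>B\<^esub> f x = f ((i - 1 + 1) \<odot>\<^bsub>A\<^esub> x)"
      unfolding lA[OF x] using x by (simp add: oA add)
    also have "\<dots> = (i - 1 + 1) \<odot>\<^bsub>B\<^esub> f x" using step2 by simp
    also have "\<dots> = (i - 1) \<odot>\<^bsub>B\<^esub> f x \<oplus>\<^bsub>B\<^esub> f x" unfolding lB[OF f[OF x]] using x by (simp add: oB f)
    finally show ?case using x by (simp add: oA oB f)
  qed
  then show "f (r \<odot>\<^bsub>A\<^esub> x) = r \<odot>\<^bsub>B\<^esub> f x" .
qed (use f add in auto)

lemma int_ideal_principal:
  assumes "ideal J \<Z>"
  shows "\<exists>m\<in>J. \<forall>r\<in>J. m dvd r"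
proof (cases "J = {0}")
  case False
  interpret J: ideal J \<Z> by fact
  have neg: "- x \<in> J" and mul: "k * x \<in> J" if "x \<in> J" for x k
    using J.I_l_closed[of x "-1"] J.I_l_closed[of x k] that by auto
  have add: "x + y \<in> J" if "x \<in> J" "y \<in> J" for x y using J.a_closed[OF that] by simp
  have "0 \<in> J" using J.zero_closed by simp
  then obtain x where x: "x \<in> J" "x \<noteq> 0" using False by blast
  define n where "n = (LEAST n. n > 0 \<and> int n \<in> J)"
  have "\<exists>n>0. int n \<in> J"
    using x neg[OF x(1)] by (intro exI[of _ "nat \<bar>x\<bar>"]) (auto simp: abs_if)
  then have n: "n > 0" "int n \<in> J" unfolding n_def by (auto intro: LeastI2_ex)
  have "int n dvd r" if r: "r \<in> J" for r
  proof -
    have "r mod int n = r + - ((r div int n) * int n)" by (simp add: minus_div_mult_eq_mod)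
    then have m: "r mod int n \<in> J" using add[OF r neg[OF mul[OF n(2)]]] by metis
    have b: "0 \<le> r mod int n" "r mod int n < int n" using n(1) by simp_all
    have "r mod int n = 0"
    proof (rule ccontr)
      assume "r mod int n \<noteq> 0"
      then have "nat (r mod int n) > 0 \<and> int (nat (r mod int n)) \<in> J" using b(1) m by simp
      then have "n \<le> nat (r mod int n)" unfolding n_def by (rule Least_le)
      then show False using b by linarith
    qed
    then show ?thesis by auto
  qed
  then show ?thesis using n(2) by blast
qed auto

lemma divisible_injective:
  assumes D: "module \<Z> D"
    and div: "\<And>n x. n \<noteq> 0 \<Longrightarrow> x \<in> carrier D \<Longrightarrow> \<exists>y\<in>carrier D. n \<odot>\<^bsub>D\<^esub> y = x"
  shows "injective_module \<Z> D"
proof (rule injective_module_via_ideals[OF D])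
  interpret D: module \<Z> D by fact
  fix J h assume J: "ideal J \<Z>" and h: "h \<in> module_homs \<Z> (ideal_module \<Z> J) D"
  obtain m where m: "m \<in> J" "\<forall>r\<in>J. m dvd r" using int_ideal_principal[OF J] by blast
  have hk: "h (k * m) = k \<odot>\<^bsub>D\<^esub> h m" for k using module_homsD(3)[OF h, of k m] m by simp
  have hm: "h m \<in> carrier D" using module_homsD(1)[OF h, of m] m by simp
  \<comment> \<open>The assumption \<open>div\<close> does not cover division by zero; if the
    generator \<open>m\<close> is zero then \<open>h m\<close> is zero, and \<open>y\<close> can be
    taken to be zero.\<close>
  have "\<exists>y\<in>carrier D. m \<odot>\<^bsub>D\<^esub> y = h m"
  proof (cases "m = 0")
    case True
    then have "h m = \<zero>\<^bsub>D\<^esub>" using hk[of 0] D.smult_l_null[OF hm] by simp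
    then show ?thesis using True D.smult_r_null[of 0] by (intro bexI[of _ "\<zero>\<^bsub>D\<^esub>"]) auto
  qed (rule div[OF _ hm])
  then obtain y where y: "y \<in> carrier D" "m \<odot>\<^bsub>D\<^esub> y = h m" by blast
  have "h r = r \<odot>\<^bsub>D\<^esub> y" if r: "r \<in> J" for r
  proof -
    obtain k where k: "r = k * m" using m(2) r by (auto simp: dvd_def mult.commute)
    then show ?thesis using hk[of k] D.smult_assoc1[of k m y] y by simp
  qed
  then show "\<exists>y\<in>carrier D. \<forall>r\<in>J. h r = r \<odot>\<^bsub>D\<^esub> y" using y(1) by blast
qed

text \<open>The rational vector space with basis \<open>S\<close>, regarded as a
  \<open>\<Z>\<close>-module: a divisible group containing the free abelian group on
  \<open>S\<close>.\<close>

definition rat_module :: "'s set \<Rightarrow> (int, 's \<Rightarrow> rat) module" where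
  "rat_module S =
     \<lparr>carrier = {p. (\<forall>s. s \<notin> S \<longrightarrow> p s = 0) \<and> finite {s. p s \<noteq> 0}},
      monoid.mult = undefined, one = undefined,
      ring.zero = (\<lambda>s. 0), ring.add = (\<lambda>p q s. p s + q s), smult = (\<lambda>n p s. of_int n * p s)\<rparr>"

lemma module_rat_module: "module \<Z> (rat_module S)"
proof -
  have fin: "finite {s. p s + q s \<noteq> 0}" if "finite {s. p s \<noteq> 0}" "finite {s. q s \<noteq> 0}" for p q :: "'a \<Rightarrow> rat"
    by (rule finite_subset[OF _ finite_UnI[OF that]]) auto
  show ?thesis
  proof (rule moduleI)
    show "abelian_group (rat_module S)"
    proof (rule abelian_groupI)
      fix p assume "p \<in> carrier (rat_module S)"
      then show "\<exists>q\<in>carrier (rat_module S). q \<oplus>\<^bsub>rat_module S\<^esub> p = \<zero>\<^bsub>rat_module S\<^esub>"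
        by (intro bexI[of _ "\<lambda>s. - p s"]) (auto simp: rat_module_def)
    qed (auto simp: rat_module_def fin algebra_simps)
    fix n p assume "p \<in> carrier (rat_module S)"
    then show "n \<odot>\<^bsub>rat_module S\<^esub> p \<in> carrier (rat_module S)"
      by (auto simp: rat_module_def elim: rev_finite_subset)
  qed (auto simp: rat_module_def int_is_cring algebra_simps)
qed

text \<open>\<open>D\<close> is the group of finitely supported rational combinations of elements of \<open>N\<close>, modulo the
  integral combinations with value in \<open>K\<close>. Its elements are coded by finite lists, since a datatype may
  recurse through lists and functions from a fixed type but not through sets.\<close>

lemma int_divisible_hull:
  fixes N :: "(int, 'n) module"
  assumes N: "module \<Z> N" and K: "submodule K \<Z> N"
  shows "\<exists>(D :: (int, ('n \<times> rat) list) module) \<epsilon>.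
    injective_module \<Z> D \<and> \<epsilon> \<in> module_homs \<Z> N D \<and> a_kernel N D \<epsilon> = K"
proof -
  interpret N: module \<Z> N by fact
  let ?S = "carrier N"
  let ?F = "free_module \<Z> ?S" and ?A = "rat_module ?S"
  let ?L = "linear_extension \<Z> N (\<lambda>x. x)"
  note F = module_free_module[OF int_is_cring, of ?S] and A = module_rat_module[of ?S]
  have phi: "(\<lambda>x. x) \<in> ?S \<rightarrow> carrier N" by simp
  note L = linear_extension_hom[OF N phi]
  have Lg: "?L (free_gen \<Z> x) = x" if "x \<in> ?S" for x using linear_extension_gen[OF N phi that] .
  have gen: "free_gen \<Z> x \<in> carrier ?F" if "x \<in> ?S" for x by (rule free_gen_closed[OF int_is_cring that])
  have surj: "?L ` carrier ?F = carrier N"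
    using module_homsD(1)[OF L] Lg gen by (auto simp: image_iff) metis
  define J :: "('n \<Rightarrow> int) \<Rightarrow> 'n \<Rightarrow> rat" where "J = (\<lambda>q s. of_int (q s))"
  have J: "J \<in> module_homs \<Z> ?F ?A"
    by (rule module_homsI) (auto simp: J_def free_module_carrier free_module_simps rat_module_def)
  have Jinj: "q = q'" if "J q = J q'" for q q' using that by (auto simp: J_def fun_eq_iff)
  \<comment> \<open>\<open>Z\<close> is the kernel of evaluation modulo \<open>K\<close>, so
    \<open>N/K\<close> is isomorphic to \<open>?F\<close> modulo \<open>Z\<close> and embeds into
    the rational combinations modulo the image of \<open>Z\<close> under \<open>J\<close>.\<close>
  define Z where "Z = a_kernel ?F (quotient_module N K) (\<lambda>q. K +>\<^bsub>N\<^esub> ?L q)"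
  have Zi: "q \<in> Z \<longleftrightarrow> q \<in> carrier ?F \<and> ?L q \<in> K" for q
    unfolding Z_def a_kernel_iff using quotient_hom(3)[OF N K] module_homsD(1)[OF L] by blast
  have Z: "submodule Z \<Z> ?F" unfolding Z_def
    by (rule kernel_submodule[OF F module_quotient[OF N K] module_homs_comp[OF L quotient_hom(1)[OF N K]]])
  have J': "J \<in> module_homs \<Z> (?F\<lparr>carrier := Z\<rparr>) ?A"
    using module_homsD[OF J] Zi by (intro module_homsI) auto
  have B: "submodule (J ` Z) \<Z> ?A"
    using hom_image_submodule[OF submodule.submodule_is_module[OF Z F] A J'] by simp
  let ?D = "quotient_module ?A (J ` Z)"
  note D = module_quotient[OF A B] and q = quotient_hom[OF A B]
  have ker: "J ` Z +>\<^bsub>?A\<^esub> J p = \<zero>\<^bsub>?D\<^esub> \<longleftrightarrow> ?L p \<in> K" if "p \<in> carrier ?F" for p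
    unfolding q(3)[OF module_homsD(1)[OF J that]] using Zi that Jinj by blast
  have K0: "\<zero>\<^bsub>N\<^esub> \<in> K" using subgroup.one_closed[OF submodule.axioms(1)[OF K]] by simp
  then have kz: "J ` Z +>\<^bsub>?A\<^esub> J p = \<zero>\<^bsub>?D\<^esub>" if "p \<in> carrier ?F" "?L p = \<zero>\<^bsub>N\<^esub>" for p
    using ker that by simp
  obtain e where e: "e \<in> module_homs \<Z> N ?D" "\<And>p. p \<in> carrier ?F \<Longrightarrow> e (?L p) = J ` Z +>\<^bsub>?A\<^esub> J p"
    using hom_factor_surj[OF F N D L surj module_homs_comp[OF J q(1)] kz] by blast
  have ek: "a_kernel N ?D e = K"
  proof -
    have "e x = \<zero>\<^bsub>?D\<^esub> \<longleftrightarrow> x \<in> K" if "x \<in> carrier N" for x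
      using e(2)[OF gen[OF that]] ker[OF gen[OF that]] Lg[OF that] by simp
    then show ?thesis using N.submoduleE(1)[OF K] by (auto simp: a_kernel_iff)
  qed
  have inj: "injective_module \<Z> ?D"
  proof (rule divisible_injective[OF D])
    fix n :: int and X assume n: "n \<noteq> 0" and "X \<in> carrier ?D"
    then obtain p where p: "p \<in> carrier ?A" "X = J ` Z +>\<^bsub>?A\<^esub> p" using q(2) by auto
    have r: "(\<lambda>s. p s / of_int n) \<in> carrier ?A"
      using p(1) by (auto simp: rat_module_def elim: rev_finite_subset)
    have "n \<odot>\<^bsub>?A\<^esub> (\<lambda>s. p s / of_int n) = p" using n by (auto simp: rat_module_def)
    then have "n \<odot>\<^bsub>?D\<^esub> (J ` Z +>\<^bsub>?A\<^esub> (\<lambda>s. p s / of_int n)) = X"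
      using quotient_smult[OF A B _ r, of n] p(2) by simp
    then show "\<exists>Y\<in>carrier ?D. n \<odot>\<^bsub>?D\<^esub> Y = X" using coset_closed[OF A B r] by blast
  qed
  \<comment> \<open>A code lists the graph of the nonzero values of one representative of a coset.
    Finite support makes such a list exist; the representative, and with it the coset, can be read
    off from the list.\<close>
  define code where "code = (\<lambda>X :: ('n \<Rightarrow> rat) set. SOME l. \<exists>p\<in>X. set l = {(s, p s) | s. p s \<noteq> (0::rat)})"
  have code: "\<exists>p\<in>X. set (code X) = {(s, p s) | s. p s \<noteq> 0}" if X: "X \<in> carrier ?D" for X
  proof -
    obtain p where p: "p \<in> carrier ?A" "X = J ` Z +>\<^bsub>?A\<^esub> p" using q(2) X by auto
    have "\<zero>\<^bsub>?A\<^esub> \<in> J ` Z" using subgroup.one_closed[OF submodule.axioms(1)[OF B]] by simp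
    then have pX: "p \<in> X" unfolding p(2) a_r_coset_def' by (rule UN_I) (simp add: rat_module_def)
    have "{(s, p s) | s. p s \<noteq> 0} = (\<lambda>s. (s, p s)) ` {s. p s \<noteq> 0}" by auto
    then have "finite {(s, p s) | s. p s \<noteq> 0}" using p(1) by (simp add: rat_module_def)
    then obtain l where "set l = {(s, p s) | s. p s \<noteq> 0}" using finite_list by blast
    then show ?thesis unfolding code_def using pX by (intro someI_ex[of "\<lambda>l. \<exists>p\<in>X. set l = {(s, p s) | s. p s \<noteq> 0}"]) blast
  qed
  have cinj: "inj_on code (carrier ?D)"
  proof (rule inj_onI)
    fix X Y assume X: "X \<in> carrier ?D" and Y: "Y \<in> carrier ?D" and eq: "code X = code Y"
    obtain p p' where pp: "p \<in> X" "p' \<in> Y" "{(s, p s) | s. p s \<noteq> 0} = {(s, p' s) | s. p' s \<noteq> 0}"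
      using code[OF X] code[OF Y] eq by auto
    have "p s = p' s" for s
    proof -
      have "(c = p s \<and> p s \<noteq> 0) \<longleftrightarrow> (c = p' s \<and> p' s \<noteq> 0)" for c
        using pp(3) by (auto simp: set_eq_iff)
      then show ?thesis by metis
    qed
    then have pe: "p = p'" by auto
    obtain x where x: "x \<in> carrier ?A" "X = J ` Z +>\<^bsub>?A\<^esub> x" by (rule quotient_carrierE[OF A B X])
    obtain y where y: "y \<in> carrier ?A" "Y = J ` Z +>\<^bsub>?A\<^esub> y" by (rule quotient_carrierE[OF A B Y])
    have "X = J ` Z +>\<^bsub>?A\<^esub> p" using coset_memD[OF A B x(1)] pp(1) x by (metis coset_eqI[OF A B])
    moreover have "Y = J ` Z +>\<^bsub>?A\<^esub> p" using coset_memD[OF A B y(1)] pp(2) y pe by (metis coset_eqI[OF A B])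
    ultimately show "X = Y" by simp
  qed
  note t = transport_module[OF D cinj]
  let ?T = "transport_module code ?D" and ?\<psi> = "inv_into (carrier ?D) code"
  have "injective_module \<Z> ?T" by (rule injective_module_retract[OF inj t(1,3,2)]) (rule t(5))
  moreover have "(\<lambda>x. code (e x)) \<in> module_homs \<Z> N ?T" by (rule module_homs_comp[OF e(1) t(2)])
  moreover have "a_kernel N ?T (\<lambda>x. code (e x)) = K"
  proof -
    have z: "code \<zero>\<^bsub>?D\<^esub> = \<zero>\<^bsub>?T\<^esub>" using module_homs_zero[OF D t(1,2)] .
    interpret D: module \<Z> ?D by (rule D)
    have "code (e x) = \<zero>\<^bsub>?T\<^esub> \<longleftrightarrow> e x = \<zero>\<^bsub>?D\<^esub>" if "x \<in> carrier N" for x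
      unfolding z[symmetric] using cinj module_homsD(1)[OF e(1) that] D.zero_closed by (auto dest: inj_onD)
    then show ?thesis unfolding ek[symmetric] by (auto simp: a_kernel_iff z)
  qed
  ultimately show ?thesis by blast
qed

section \<open>Enough injectives\<close>

text \<open>This is \<open>Hom(R, D)\<close> over the integers, the right adjoint of restriction of
  scalars. Scalars act on the argument, since \<open>D\<close> carries no action of
  \<open>R\<close>.\<close>

definition coinduced_module :: "'a ring \<Rightarrow> (int, 'd) module \<Rightarrow> ('a, 'a \<Rightarrow> 'd) module" where
  "coinduced_module R D = (let H = hom_module \<Z> (int_module R) D in
     \<lparr>carrier = carrier H, monoid.mult = undefined, one = undefined,
      ring.zero = zero H, ring.add = add H,
      smult = (\<lambda>r u. \<lambda>s\<in>carrier R. u (s \<otimes>\<^bsub>R\<^esub> r))\<rparr>)"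

lemma coinduced_simps:
  "carrier (coinduced_module R D) = module_homs \<Z> (int_module R) D \<inter> extensional (carrier R)"
  "\<zero>\<^bsub>coinduced_module R D\<^esub> = (\<lambda>s\<in>carrier R. \<zero>\<^bsub>D\<^esub>)"
  "u \<oplus>\<^bsub>coinduced_module R D\<^esub> v = (\<lambda>s\<in>carrier R. u s \<oplus>\<^bsub>D\<^esub> v s)"
  "r \<odot>\<^bsub>coinduced_module R D\<^esub> u = (\<lambda>s\<in>carrier R. u (s \<otimes>\<^bsub>R\<^esub> r))"
  by (simp_all add: coinduced_module_def hom_module_def Let_def)

lemma coinduced_memI:
  assumes "cring R" "module \<Z> D" "\<And>s. s \<in> carrier R \<Longrightarrow> u s \<in> carrier D"
    and "\<And>s t. s \<in> carrier R \<Longrightarrow> t \<in> carrier R \<Longrightarrow> u (s \<oplus>\<^bsub>R\<^esub> t) = u s \<oplus>\<^bsub>D\<^esub> u t"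
  shows "(\<lambda>s\<in>carrier R. u s) \<in> carrier (coinduced_module R D)"
proof -
  interpret R: cring R by fact
  note RZ = module_int_module[OF R.abelian_group_axioms]
  show ?thesis unfolding coinduced_simps
    using module_homs_restrict[OF RZ additive_int_hom[OF RZ assms(2)], of u] assms(3,4) by simp
qed

lemma module_coinduced_module:
  assumes R: "cring R" and D: "module \<Z> D"
  shows "module R (coinduced_module R D)"
proof -
  interpret R: cring R by fact
  interpret D: module \<Z> D by fact
  let ?E = "coinduced_module R D"
  interpret H: module \<Z> "hom_module \<Z> (int_module R) D"
    by (rule module_hom_module[OF module_int_module[OF R.abelian_group_axioms] D])
  have c: "u s \<in> carrier D" "s \<in> carrier R \<Longrightarrow> t \<in> carrier R \<Longrightarrow> u (s \<oplus>\<^bsub>R\<^esub> t) = u s \<oplus>\<^bsub>D\<^esub> u t"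
    if "u \<in> carrier ?E" "s \<in> carrier R" for u s t
    using that module_homsD(1,2)[of u \<Z> "int_module R" D] by (auto simp: coinduced_simps)
  have ext: "u = v" if "u \<in> carrier ?E" "v \<in> carrier ?E" "\<And>s. s \<in> carrier R \<Longrightarrow> u s = v s" for u v
    using that by (auto simp: coinduced_simps intro: extensionalityI)
  have sc: "r \<odot>\<^bsub>?E\<^esub> u \<in> carrier ?E" if "r \<in> carrier R" "u \<in> carrier ?E" for r u
    unfolding coinduced_simps(4) using that
    by (intro coinduced_memI[OF R D]) (auto simp: c R.l_distr)
  have E: "abelian_group ?E"
  proof (rule abelian_groupI)
    fix u assume "u \<in> carrier ?E"
    then show "\<exists>v\<in>carrier ?E. v \<oplus>\<^bsub>?E\<^esub> u = \<zero>\<^bsub>?E\<^esub>"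
      using H.M.l_neg[of u] H.M.a_inv_closed[of u] by (auto simp: coinduced_module_def Let_def)
  qed (auto simp: coinduced_module_def Let_def H.M.a_ac)
  interpret E: abelian_group ?E by (rule E)
  show ?thesis
  proof (rule moduleI[OF R E])
    fix r s u v assume r: "r \<in> carrier R" and u: "u \<in> carrier ?E"
    show "r \<odot>\<^bsub>?E\<^esub> u \<in> carrier ?E" using sc r u by blast
    show "r \<odot>\<^bsub>?E\<^esub> (u \<oplus>\<^bsub>?E\<^esub> v) = r \<odot>\<^bsub>?E\<^esub> u \<oplus>\<^bsub>?E\<^esub> r \<odot>\<^bsub>?E\<^esub> v" 
      using r by (auto simp: coinduced_simps fun_eq_iff restrict_def)
    assume s: "s \<in> carrier R"
    show "(r \<oplus>\<^bsub>R\<^esub> s) \<odot>\<^bsub>?E\<^esub> u = r \<odot>\<^bsub>?E\<^esub> u \<oplus>\<^bsub>?E\<^esub> s \<odot>\<^bsub>?E\<^esub> u"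
      using r s c[OF u] by (auto simp: coinduced_simps fun_eq_iff restrict_def R.r_distr)
    show "(r \<otimes>\<^bsub>R\<^esub> s) \<odot>\<^bsub>?E\<^esub> u = r \<odot>\<^bsub>?E\<^esub> (s \<odot>\<^bsub>?E\<^esub> u)"
      using r s by (auto simp: coinduced_simps fun_eq_iff restrict_def R.m_assoc)
  next
    fix u assume u: "u \<in> carrier ?E"
    show "\<one>\<^bsub>R\<^esub> \<odot>\<^bsub>?E\<^esub> u = u"
      by (rule ext[OF sc[OF R.one_closed u] u]) (simp add: coinduced_simps)
  qed
qed

text \<open>An \<open>R\<close>-homomorphism from \<open>J\<close> into the coinduced module is
  determined by its values at one, which form an additive map from \<open>J\<close> to
  \<open>D\<close>. An additive extension of that map to \<open>R\<close> is itself an element of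
  the coinduced module, and it is the one that Baer's criterion asks for.\<close>

lemma injective_coinduced_module:
  assumes R: "cring R" and D: "injective_module \<Z> D"
  shows "injective_module R (coinduced_module R D)"
proof -
  interpret R: cring R by fact
  have Dm: "module \<Z> D" using D by (simp add: injective_module_def)
  let ?E = "coinduced_module R D"
  show ?thesis
  proof (rule injective_module_via_ideals[OF module_coinduced_module[OF R Dm]])
    fix J h assume J: "ideal J R" and h: "h \<in> module_homs R (ideal_module R J) ?E"
    interpret J: ideal J R by fact
    interpret JM: module R "ideal_module R J" by (rule module_ideal_module[OF R J])
    note RZ = module_int_module[OF R.abelian_group_axioms] and JZ = module_int_module[OF JM.abelian_group_axioms]
    note hD = module_homsD[OF h]
    have hc: "h r s \<in> carrier D" if "r \<in> J" "s \<in> carrier R" for r s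
      using hD(1)[of r] that module_homsD(1)[of "h r" \<Z> "int_module R" D s] by (auto simp: coinduced_simps)
    have h1: "(\<lambda>r. h r \<one>\<^bsub>R\<^esub>) \<in> module_homs \<Z> (int_module (ideal_module R J)) D"
      by (rule additive_int_hom[OF JZ Dm]) (use hc hD(2) in \<open>auto simp: coinduced_simps\<close>)
    have inc: "(\<lambda>r. r) \<in> module_homs \<Z> (int_module (ideal_module R J)) (int_module R)"
      by (rule additive_int_hom[OF JZ RZ]) (auto simp: J.Icarr)
    obtain k where k: "k \<in> module_homs \<Z> (int_module R) D" "\<And>r. r \<in> J \<Longrightarrow> k r = h r \<one>\<^bsub>R\<^esub>"
      using injective_module_extend[OF D JZ RZ inc _ h1] by auto
    let ?e = "\<lambda>s\<in>carrier R. k s"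
    have e: "?e \<in> carrier ?E" using module_homsD[OF k(1)] by (intro coinduced_memI[OF R Dm]) auto
    have "h r = r \<odot>\<^bsub>?E\<^esub> ?e" if r: "r \<in> J" for r
    proof (rule extensionalityI[of _ "carrier R"])
      show "h r \<in> extensional (carrier R)" using hD(1)[of r] r by (simp add: coinduced_simps)
      show "r \<odot>\<^bsub>?E\<^esub> ?e \<in> extensional (carrier R)" by (simp add: coinduced_simps)
      fix s assume s: "s \<in> carrier R"
      have "h r s = h (s \<otimes>\<^bsub>R\<^esub> r) \<one>\<^bsub>R\<^esub>" using hD(3)[of s r] s r by (simp add: coinduced_simps)
      also have "\<dots> = k (s \<otimes>\<^bsub>R\<^esub> r)" using k(2) J.I_l_closed[OF r s] by simp
      also have "\<dots> = (r \<odot>\<^bsub>?E\<^esub> ?e) s" using s r J.Icarr[OF r] by (simp add: coinduced_simps)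
      finally show "h r s = (r \<odot>\<^bsub>?E\<^esub> ?e) s" .
    qed
    then show "\<exists>e\<in>carrier ?E. \<forall>r\<in>J. h r = r \<odot>\<^bsub>?E\<^esub> e" using e by blast
  qed
qed

text \<open>Prescribing the kernel \<open>K\<close>, instead of treating embeddings only, lets the
  next map of a resolution start from the previous term without forming a cokernel. The map is the
  adjoint of \<open>\<epsilon>\<close>, sending \<open>x\<close> to the function \<open>r\<close> to
  \<open>\<epsilon> (r x)\<close>.\<close>

lemma enough_injectives:
  fixes N :: "('a, 'n) module"
  assumes N: "module R N" and K: "submodule K R N"
  shows "\<exists>(E :: ('a, 'a \<Rightarrow> ('n \<times> rat) list) module) j.
    injective_module R E \<and> j \<in> module_homs R N E \<and> a_kernel N E j = K"
proof -
  interpret N: module R N by fact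
  have R: "cring R" by (rule N.R.cring_axioms)
  note NZ = module_int_module[OF N.M.abelian_group_axioms]
  note sub = N.submoduleE[OF K]
  have KZ: "submodule K \<Z> (int_module N)"
  proof -
    interpret KM: module R "N\<lparr>carrier := K\<rparr>" by (rule submodule.submodule_is_module[OF K N])
    note m = module_int_module[OF KM.abelian_group_axioms]
    have "(\<lambda>x. x) \<in> module_homs \<Z> (int_module (N\<lparr>carrier := K\<rparr>)) (int_module N)"
      by (rule additive_int_hom[OF m NZ]) (use sub(1) in auto)
    from hom_image_submodule[OF m NZ this] show ?thesis by simp
  qed
  obtain D :: "(int, ('n \<times> rat) list) module" and \<epsilon> where
    D: "injective_module \<Z> D" and \<epsilon>: "\<epsilon> \<in> module_homs \<Z> (int_module N) D" and ker: "a_kernel (int_module N) D \<epsilon> = K"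
    using int_divisible_hull[OF NZ KZ] by blast
  have Dm: "module \<Z> D" using D by (simp add: injective_module_def)
  let ?E = "coinduced_module R D"
  define j where "j = (\<lambda>x. \<lambda>r\<in>carrier R. \<epsilon> (r \<odot>\<^bsub>N\<^esub> x))"
  note eD = module_homsD[OF \<epsilon>]
  have j: "j \<in> module_homs R N ?E"
  proof (rule module_homsI)
    fix x assume x: "x \<in> carrier N"
    then show "j x \<in> carrier ?E" unfolding j_def
      using eD by (intro coinduced_memI[OF R Dm]) (auto simp: N.smult_l_distr)
    show "j (x \<oplus>\<^bsub>N\<^esub> y) = j x \<oplus>\<^bsub>?E\<^esub> j y" if "y \<in> carrier N" for y
      using x that eD by (auto simp: j_def coinduced_simps fun_eq_iff N.smult_r_distr)
    show "j (r \<odot>\<^bsub>N\<^esub> x) = r \<odot>\<^bsub>?E\<^esub> j x" if "r \<in> carrier R" for r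
      using x that eD by (auto simp: j_def coinduced_simps fun_eq_iff N.smult_assoc1)
  qed
  \<comment> \<open>Evaluation at one detects membership in \<open>K\<close>; conversely
    \<open>K\<close> is closed under scalars, so all values of \<open>j x\<close> vanish for
    \<open>x\<close> in \<open>K\<close>.\<close>
  have "j x = \<zero>\<^bsub>?E\<^esub> \<longleftrightarrow> x \<in> K" if x: "x \<in> carrier N" for x
  proof
    assume "j x = \<zero>\<^bsub>?E\<^esub>"
    then have "j x \<one>\<^bsub>R\<^esub> = \<zero>\<^bsub>?E\<^esub> \<one>\<^bsub>R\<^esub>" by simp
    then have "\<epsilon> x = \<zero>\<^bsub>D\<^esub>" using x by (simp add: j_def coinduced_simps)
    then show "x \<in> K" using x by (simp add: a_kernel_iff flip: ker)
  next
    assume "x \<in> K"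
    then have "\<epsilon> (r \<odot>\<^bsub>N\<^esub> x) = \<zero>\<^bsub>D\<^esub>" if "r \<in> carrier R" for r
      using sub(4)[OF that, of x] by (simp add: a_kernel_iff flip: ker)
    then show "j x = \<zero>\<^bsub>?E\<^esub>" by (auto simp: j_def coinduced_simps)
  qed
  then have "a_kernel N ?E j = K" using sub(1) by (auto simp: a_kernel_iff)
  then show ?thesis using injective_coinduced_module[OF R D] j by blast
qed

text \<open>Every \<open>R\<close>-module with carrier in this type embeds into an injective one with carrier in this type,
  so that all terms of an injective resolution can live in a single type.\<close>

datatype ('a, 'm) resolution_elem = Base 'm | Hull "'a \<Rightarrow> (('a, 'm) resolution_elem \<times> rat) list"

locale injective_resolution =
  fixes R :: "'a ring" and M :: "('a, 'm) module" and E :: "nat \<Rightarrow> ('a, 'e) module"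
    and \<iota> :: "'m \<Rightarrow> 'e" and d :: "nat \<Rightarrow> 'e \<Rightarrow> 'e"
  assumes cring: "cring R" and mod: "module R M" and inj: "\<And>n. injective_module R (E n)"
    and \<iota>: "\<iota> \<in> module_homs R M (E 0)" "inj_on \<iota> (carrier M)"
    and d: "\<And>n. d n \<in> module_homs R (E n) (E (Suc n))"
    and exact_0: "exact_at M (E 0) (E 1) \<iota> (d 0)"
    and exact: "\<And>n. exact_at (E n) (E (Suc n)) (E (Suc (Suc n))) (d n) (d (Suc n))"

text \<open>\<open>Hull\<close> wraps the elements of the coinduced hull back into the type of the
  elements of \<open>N\<close>, so that the construction can be iterated.\<close>

lemma injective_step:
  fixes N :: "('a, ('a, 'm) resolution_elem) module"
  assumes N: "module R N" and K: "submodule K R N"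
  shows "\<exists>(E :: ('a, ('a, 'm) resolution_elem) module) j.
    injective_module R E \<and> j \<in> module_homs R N E \<and> a_kernel N E j = K"
proof -
  obtain E :: "('a, 'a \<Rightarrow> (('a, 'm) resolution_elem \<times> rat) list) module" and j where
    E: "injective_module R E" and j: "j \<in> module_homs R N E" and ker: "a_kernel N E j = K"
    using enough_injectives[OF N K] by blast
  have Em: "module R E" using E by (simp add: injective_module_def)
  interpret E: module R E by (rule Em)
  have inj: "inj_on Hull (carrier E)" by (simp add: inj_on_def)
  note t = transport_module[OF Em inj]
  have "injective_module R (transport_module Hull E)"
    by (rule injective_module_retract[OF E t(1,3,2)]) (rule t(5))
  moreover have "a_kernel N (transport_module Hull E) (\<lambda>x. Hull (j x)) = K"
    unfolding ker[symmetric] by (auto simp: a_kernel_iff simp flip: module_homs_zero[OF Em t(1,2)])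
  ultimately show ?thesis using module_homs_comp[OF j t(2)] by blast
qed

lemma injective_resolution_exists:
  fixes M :: "('a, 'm) module"
  assumes R: "cring R" and M: "module R M"
  shows "\<exists>(E :: nat \<Rightarrow> ('a, ('a, 'm) resolution_elem) module) \<iota> d. injective_resolution R M E \<iota> d"
proof -
  have iB: "inj_on Base (carrier M)" by (simp add: inj_on_def)
  note t = transport_module[OF M iB]
  let ?M = "transport_module Base M :: ('a, ('a, 'm) resolution_elem) module"
  interpret M: module R ?M by (rule t(1))
  have "submodule {\<zero>\<^bsub>?M\<^esub>} R ?M"
    using M.minus_equality[OF M.l_zero[OF M.zero_closed] M.zero_closed M.zero_closed] by (intro M.submoduleI) auto
  then obtain E0 :: "('a, ('a, 'm) resolution_elem) module" and j where
    E0: "injective_module R E0" and j: "j \<in> module_homs R ?M E0" "a_kernel ?M E0 j = {\<zero>\<^bsub>?M\<^esub>}"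
    using injective_step[OF t(1)] by blast
  have E0m: "module R E0" using E0 by (simp add: injective_module_def)
  let ?\<iota> = "\<lambda>x. j (Base x)"
  note i = module_homs_comp[OF t(2) j(1)]
  have i_inj: "inj_on ?\<iota> (carrier M)"
  proof (rule inj_onI)
    fix x y assume xy: "x \<in> carrier M" "y \<in> carrier M" "j (Base x) = j (Base y)"
    have c: "Base x \<in> carrier ?M" "Base y \<in> carrier ?M" using xy module_homsD(1)[OF t(2)] by auto
    have "j (Base x \<ominus>\<^bsub>?M\<^esub> Base y) = \<zero>\<^bsub>E0\<^esub>"
      using module_homs_minus[OF t(1) E0m j(1) c] xy(3) module_minus_eq_zero[OF E0m] module_homsD(1)[OF j(1)] c by simp
    then have "Base x \<ominus>\<^bsub>?M\<^esub> Base y \<in> a_kernel ?M E0 j" using c by (simp add: a_kernel_iff)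
    then have "Base x \<ominus>\<^bsub>?M\<^esub> Base y = \<zero>\<^bsub>?M\<^esub>" using j(2) by simp
    then show "x = y" using module_minus_eq_zero[OF t(1) c] by simp
  qed
  \<comment> \<open>A state consists of the current term and the submodule that has to be the kernel
    of the next map, namely the image of the preceding one. The first state is pinned down inside
    \<open>P\<close> because dependent choice returns a sequence known only through \<open>P\<close>
    and \<open>Q\<close>.\<close>
  define P :: "nat \<Rightarrow> ('a, ('a, 'm) resolution_elem) module \<times> ('a, 'm) resolution_elem set \<Rightarrow> bool"
    where "P n s \<longleftrightarrow> injective_module R (fst s) \<and> submodule (snd s) R (fst s) \<and>
      (n = 0 \<longrightarrow> s = (E0, ?\<iota> ` carrier M))" for n s
  define Q :: "nat \<Rightarrow> ('a, ('a, 'm) resolution_elem) module \<times> ('a, 'm) resolution_elem set \<Rightarrow>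
      ('a, ('a, 'm) resolution_elem) module \<times> ('a, 'm) resolution_elem set \<Rightarrow> bool"
    where "Q n s s' \<longleftrightarrow> (\<exists>d. d \<in> module_homs R (fst s) (fst s') \<and> a_kernel (fst s) (fst s') d = snd s \<and>
      snd s' = d ` carrier (fst s))" for n s s'
  obtain f where f: "\<And>n. P n (f n)" "\<And>n. Q n (f n) (f (Suc n))"
  proof -
    have "\<exists>f. \<forall>n. P n (f n) \<and> Q n (f n) (f (Suc n))"
    proof (rule dependent_nat_choice)
      show "\<exists>s. P 0 s" unfolding P_def using E0 hom_image_submodule[OF M E0m i] by auto
      fix s n assume "P n s"
      then have s: "injective_module R (fst s)" "submodule (snd s) R (fst s)" by (auto simp: P_def)
      have sm: "module R (fst s)" using s(1) by (simp add: injective_module_def)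
      obtain E' :: "('a, ('a, 'm) resolution_elem) module" and d where
        E': "injective_module R E'" and d: "d \<in> module_homs R (fst s) E'" "a_kernel (fst s) E' d = snd s"
        using injective_step[OF sm s(2)] by blast
      have "module R E'" using E' by (simp add: injective_module_def)
      then have "P (Suc n) (E', d ` carrier (fst s)) \<and> Q n s (E', d ` carrier (fst s))"
        using E' d hom_image_submodule[OF sm _ d(1)] by (auto simp: P_def Q_def)
      then show "\<exists>s'. P (Suc n) s' \<and> Q n s s'" by blast
    qed
    then show ?thesis using that by blast
  qed
  have "\<exists>d. \<forall>n. d n \<in> module_homs R (fst (f n)) (fst (f (Suc n))) \<and>
      a_kernel (fst (f n)) (fst (f (Suc n))) (d n) = snd (f n) \<and> snd (f (Suc n)) = d n ` carrier (fst (f n))"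
    using f(2) unfolding Q_def by (intro choice) blast
  then obtain d where d: "\<And>n. d n \<in> module_homs R (fst (f n)) (fst (f (Suc n)))"
    "\<And>n. a_kernel (fst (f n)) (fst (f (Suc n))) (d n) = snd (f n)"
    "\<And>n. snd (f (Suc n)) = d n ` carrier (fst (f n))" by blast
  have f0: "f 0 = (E0, ?\<iota> ` carrier M)" using f(1)[of 0] by (simp add: P_def)
  have "injective_resolution R M (\<lambda>n. fst (f n)) ?\<iota> d"
  proof (rule injective_resolution.intro)
    show "injective_module R (fst (f n))" for n using f(1)[of n] by (simp add: P_def)
    show "exact_at M (fst (f 0)) (fst (f 1)) ?\<iota> (d 0)" using d(2)[of 0] f0 by (simp add: exact_at_def)
    show "exact_at (fst (f n)) (fst (f (Suc n))) (fst (f (Suc (Suc n)))) (d n) (d (Suc n))" for n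
      using d(2)[of "Suc n"] d(3)[of n] by (simp add: exact_at_def)
  qed (use R M i i_inj f0 d(1) in auto)
  then show ?thesis by blast
qed

section \<open>Faithfully flat modules\<close>

lemma hom_module_simps:
  "carrier (hom_module R A B) = module_homs R A B \<inter> extensional (carrier A)"
  "\<zero>\<^bsub>hom_module R A B\<^esub> = (\<lambda>x\<in>carrier A. \<zero>\<^bsub>B\<^esub>)"
  "u \<oplus>\<^bsub>hom_module R A B\<^esub> v = (\<lambda>x\<in>carrier A. u x \<oplus>\<^bsub>B\<^esub> v x)"
  "r \<odot>\<^bsub>hom_module R A B\<^esub> u = (\<lambda>x\<in>carrier A. r \<odot>\<^bsub>B\<^esub> u x)"
  by (simp_all add: hom_module_def)

lemma hom_module_map:
  assumes "module R A" "f \<in> module_homs R B C"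
  shows "(\<lambda>u. \<lambda>x\<in>carrier A. f (u x)) \<in> module_homs R (hom_module R A B) (hom_module R A C)"
proof (rule module_homsI)
  note fD = module_homsD[OF assms(2)]
  fix u assume "u \<in> carrier (hom_module R A B)"
  then have u: "u \<in> module_homs R A B" by (simp add: hom_module_simps)
  show "(\<lambda>x\<in>carrier A. f (u x)) \<in> carrier (hom_module R A C)"
    using module_homs_restrict[OF assms(1) module_homs_comp[OF u assms(2)]] by (simp add: hom_module_simps)
  show "(\<lambda>x\<in>carrier A. f ((r \<odot>\<^bsub>hom_module R A B\<^esub> u) x)) = r \<odot>\<^bsub>hom_module R A C\<^esub> (\<lambda>x\<in>carrier A. f (u x))"
    if "r \<in> carrier R" for r
    using that module_homsD(1)[OF u] by (auto simp: hom_module_simps fun_eq_iff fD)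
  fix v assume "v \<in> carrier (hom_module R A B)"
  then have v: "v \<in> module_homs R A B" by (simp add: hom_module_simps)
  show "(\<lambda>x\<in>carrier A. f ((u \<oplus>\<^bsub>hom_module R A B\<^esub> v) x)) =
      (\<lambda>x\<in>carrier A. f (u x)) \<oplus>\<^bsub>hom_module R A C\<^esub> (\<lambda>x\<in>carrier A. f (v x))"
    using module_homsD(1)[OF u] module_homsD(1)[OF v] by (auto simp: hom_module_simps fun_eq_iff fD)
qed

lemma hom_inj_onI:
  assumes A: "module R A" and B: "module R B" and f: "f \<in> module_homs R A B"
    and ker: "\<And>x. x \<in> carrier A \<Longrightarrow> f x = \<zero>\<^bsub>B\<^esub> \<Longrightarrow> x = \<zero>\<^bsub>A\<^esub>"
  shows "inj_on f (carrier A)"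
proof (rule inj_onI)
  interpret A: module R A by fact
  fix x y assume xy: "x \<in> carrier A" "y \<in> carrier A" "f x = f y"
  then have "f (x \<ominus>\<^bsub>A\<^esub> y) = \<zero>\<^bsub>B\<^esub>"
    using module_homs_minus[OF A B f xy(1,2)] module_minus_eq_zero[OF B] module_homsD(1)[OF f] by auto
  then have "x \<ominus>\<^bsub>A\<^esub> y = \<zero>\<^bsub>A\<^esub>" using xy by (intro ker) auto
  then show "x = y" using module_minus_eq_zero[OF A xy(1,2)] by simp
qed

lemma pure_tensor_zero_right:
  assumes A: "module R A" and B: "module R B" and x: "x \<in> carrier A"
  shows "pure_tensor R A B x \<zero>\<^bsub>B\<^esub> = \<zero>\<^bsub>tensor_module R A B\<^esub>"
proof -
  interpret A: module R A by fact
  interpret B: module R B by fact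
  interpret T: module R "tensor_module R A B" by (rule module_tensor_module[OF A B])
  note b = pure_tensor_bilinear[OF A B x B.zero_closed x B.zero_closed A.R.zero_closed]
  show ?thesis using b(5) b(1) T.smult_l_null by simp
qed

text \<open>On pure tensors \<open>r\<close> can be moved to the factor that it kills, and
  homomorphisms out of a tensor product agree once they agree on pure tensors.\<close>

lemma tensor_smult_eq_zeroI:
  assumes A: "module R A" and B: "module R B" and r: "r \<in> carrier R"
    and z: "\<And>y. y \<in> carrier B \<Longrightarrow> r \<odot>\<^bsub>B\<^esub> y = \<zero>\<^bsub>B\<^esub>"
    and t: "t \<in> carrier (tensor_module R A B)"
  shows "r \<odot>\<^bsub>tensor_module R A B\<^esub> t = \<zero>\<^bsub>tensor_module R A B\<^esub>"
proof -
  note T = module_tensor_module[OF A B]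
  have id: "(\<lambda>t. t) \<in> module_homs R (tensor_module R A B) (tensor_module R A B)" by (rule module_homsI) auto
  show ?thesis
  proof (rule tensor_hom_eqI[OF A B T module_homs_smult[OF T id r] module_homs_const_zero[OF T] _ t])
    fix x y assume xy: "x \<in> carrier A" "y \<in> carrier B"
    show "r \<odot>\<^bsub>tensor_module R A B\<^esub> pure_tensor R A B x y = \<zero>\<^bsub>tensor_module R A B\<^esub>"
      using pure_tensor_bilinear(5)[OF A B xy xy r] z[OF xy(2)] pure_tensor_zero_right[OF A B xy(1)] by simp
  qed
qed

section \<open>Consequences of faithful flatness\<close>

context
  fixes R :: "'a ring" and F :: "('a, 'f) module"
  assumes ff: "faithfully_flat R F"
begin

lemma faithfully_flat_module: "module R F"
  using ff by (simp add: faithfully_flat_def)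

lemma faithfully_flat_exact_iff:
  fixes A B C :: "('a, 'a) module"
  assumes "module R A" "module R B" "module R C" "f \<in> module_homs R A B" "g \<in> module_homs R B C"
  shows "exact_at A B C f g \<longleftrightarrow>
    exact_at (tensor_module R F A) (tensor_module R F B) (tensor_module R F C) (tensor_map R F B f) (tensor_map R F C g)"
  using ff assms unfolding faithfully_flat_def by blast

lemma cring_base: "cring R"
  using faithfully_flat_module module.axioms(1) by blast

lemma module_zero_module: "module R (ideal_module R {\<zero>\<^bsub>R\<^esub>})"
  by (rule module_ideal_module[OF cring_base ring.zeroideal[OF cring.axioms(1)[OF cring_base]]])

text \<open>Injectivity is exactness of \<open>0 -> A -> B\<close> at \<open>A\<close>, where the
  zero ideal serves as zero module in the type of the test modules. The map induced by
  \<open>0 -> A\<close> is zero on pure tensors, so exactness after tensoring gives a trivial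
  kernel.\<close>

lemma flat_tensor_map_inj:
  fixes A B :: "('a, 'a) module"
  assumes A: "module R A" and B: "module R B" and i: "i \<in> module_homs R A B" "inj_on i (carrier A)"
  shows "inj_on (tensor_map R F B i) (carrier (tensor_module R F A))"
proof -
  note F = faithfully_flat_module
  interpret A: module R A by fact
  let ?Z = "ideal_module R {\<zero>\<^bsub>R\<^esub>}"
  note Z = module_zero_module and TA = module_tensor_module[OF F A] and TB = module_tensor_module[OF F B]
  interpret TA: module R "tensor_module R F A" by (rule TA)
  interpret TZ: module R "tensor_module R F ?Z" by (rule module_tensor_module[OF F Z])
  have z: "(\<lambda>x. \<zero>\<^bsub>A\<^esub>) \<in> module_homs R ?Z A" by (rule module_homs_const_zero[OF A])
  have "x = \<zero>\<^bsub>A\<^esub>" if "x \<in> carrier A" "i x = \<zero>\<^bsub>B\<^esub>" for x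
    using inj_onD[OF i(2), of x "\<zero>\<^bsub>A\<^esub>"] that module_homs_zero[OF A B i(1)] by simp
  then have "exact_at ?Z A B (\<lambda>x. \<zero>\<^bsub>A\<^esub>) i"
    using module_homs_zero[OF A B i(1)] by (auto simp: exact_at_def a_kernel_iff)
  then have ex: "tensor_map R F A (\<lambda>x. \<zero>\<^bsub>A\<^esub>) ` carrier (tensor_module R F ?Z) =
      a_kernel (tensor_module R F A) (tensor_module R F B) (tensor_map R F B i)"
    using faithfully_flat_exact_iff[OF Z A B z i(1)] by (simp add: exact_at_def)
  have "tensor_map R F A (\<lambda>x. \<zero>\<^bsub>A\<^esub>) t = \<zero>\<^bsub>tensor_module R F A\<^esub>" if "t \<in> carrier (tensor_module R F ?Z)" for t
    by (rule tensor_hom_eqI[OF F Z TA tensor_map_hom[OF F Z A z] module_homs_const_zero[OF TA] _ that])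
      (simp add: tensor_map_pure[OF F Z A z] pure_tensor_zero_right[OF F A])
  then have "t = \<zero>\<^bsub>tensor_module R F A\<^esub>"
    if "t \<in> carrier (tensor_module R F A)" "tensor_map R F B i t = \<zero>\<^bsub>tensor_module R F B\<^esub>" for t
    using ex that by (auto simp: a_kernel_iff set_eq_iff image_iff)
  then show ?thesis by (intro hom_inj_onI[OF TA TB tensor_map_hom[OF F A B i(1)]])
qed

text \<open>If the tensor product were zero, tensoring \<open>0 -> V -> 0\<close> would give an
  exact sequence; exactness is reflected, so \<open>V\<close> would be zero.\<close>

lemma faithful_tensor_nonzero:
  fixes V :: "('a, 'a) module"
  assumes V: "module R V" and nz: "carrier V \<noteq> {\<zero>\<^bsub>V\<^esub>}"
  shows "carrier (tensor_module R F V) \<noteq> {\<zero>\<^bsub>tensor_module R F V\<^esub>}"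
proof
  note F = faithfully_flat_module
  let ?Z = "ideal_module R {\<zero>\<^bsub>R\<^esub>}"
  note Z = module_zero_module and TV = module_tensor_module[OF F V] and TZ = module_tensor_module[OF F module_zero_module]
  interpret TZ: module R "tensor_module R F ?Z" by (rule TZ)
  have z: "(\<lambda>x. \<zero>\<^bsub>V\<^esub>) \<in> module_homs R ?Z V" by (rule module_homs_const_zero[OF V])
  have z': "(\<lambda>x. \<zero>\<^bsub>R\<^esub>) \<in> module_homs R V ?Z" using module_homs_const_zero[OF Z] by simp
  assume T: "carrier (tensor_module R F V) = {\<zero>\<^bsub>tensor_module R F V\<^esub>}"
  note a = tensor_map_hom[OF F Z V z] and b = tensor_map_hom[OF F V Z z']
  have "exact_at (tensor_module R F ?Z) (tensor_module R F V) (tensor_module R F ?Z)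
      (tensor_map R F V (\<lambda>x. \<zero>\<^bsub>V\<^esub>)) (tensor_map R F ?Z (\<lambda>x. \<zero>\<^bsub>R\<^esub>))"
    unfolding exact_at_def
  proof (intro equalityI subsetI)
    fix t assume "t \<in> tensor_map R F V (\<lambda>x. \<zero>\<^bsub>V\<^esub>) ` carrier (tensor_module R F ?Z)"
    then have "t = \<zero>\<^bsub>tensor_module R F V\<^esub>" using module_homsD(1)[OF a] T by blast
    then show "t \<in> a_kernel (tensor_module R F V) (tensor_module R F ?Z) (tensor_map R F ?Z (\<lambda>x. \<zero>\<^bsub>R\<^esub>))"
      using module_homs_zero[OF TV TZ b] T by (simp add: a_kernel_iff)
  next
    fix t assume "t \<in> a_kernel (tensor_module R F V) (tensor_module R F ?Z) (tensor_map R F ?Z (\<lambda>x. \<zero>\<^bsub>R\<^esub>))"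
    then have "t = tensor_map R F V (\<lambda>x. \<zero>\<^bsub>V\<^esub>) \<zero>\<^bsub>tensor_module R F ?Z\<^esub>"
      using module_homs_zero[OF TZ TV a] T by (simp add: a_kernel_iff)
    then show "t \<in> tensor_map R F V (\<lambda>x. \<zero>\<^bsub>V\<^esub>) ` carrier (tensor_module R F ?Z)" using TZ.zero_closed by blast
  qed
  then have "exact_at ?Z V ?Z (\<lambda>x. \<zero>\<^bsub>V\<^esub>) (\<lambda>x. \<zero>\<^bsub>R\<^esub>)"
    using faithfully_flat_exact_iff[OF Z V Z z z'] by simp
  then show False using nz by (auto simp: exact_at_def a_kernel_iff set_eq_iff)
qed

lemma hom_module_injective:
  assumes E: "injective_module R E"
  shows "injective_module R (hom_module R F E)"
proof -
  note F = faithfully_flat_module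
  have Em: "module R E" using E by (simp add: injective_module_def)
  interpret F: module R F by (rule F)
  interpret E: module R E by (rule Em)
  let ?H = "hom_module R F E"
  have H: "module R ?H" by (rule module_hom_module[OF F Em])
  show ?thesis unfolding injective_module_def
  proof (intro conjI allI impI H; elim conjE)
    fix A B :: "('a, 'a) module" and i g
    assume A: "module R A" and B: "module R B" and i: "i \<in> module_homs R A B" "inj_on i (carrier A)"
      and g: "g \<in> module_homs R A ?H"
    interpret A: module R A by (rule A)
    interpret B: module R B by (rule B)
    note gD = module_homsD[OF g] and TA = module_tensor_module[OF F A] and TB = module_tensor_module[OF F B]
    have gF: "g a \<in> module_homs R F E" if "a \<in> carrier A" for a using gD(1)[OF that] by (simp add: hom_module_simps)
    \<comment> \<open>\<open>g\<close> is uncurried to a map on the tensor product, extended there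
      by injectivity of \<open>E\<close> and flatness of \<open>F\<close>, and curried back as
      \<open>h\<close>.\<close>
    have "\<exists>h\<in>module_homs R (tensor_module R F A) E. \<forall>x\<in>carrier F. \<forall>a\<in>carrier A. h (pure_tensor R F A x a) = g a x"
      using module_homsD[OF gF] by (intro tensor_lift[OF F A Em]) (auto simp: gD hom_module_simps)
    then obtain G where G: "G \<in> module_homs R (tensor_module R F A) E"
      "\<And>x a. x \<in> carrier F \<Longrightarrow> a \<in> carrier A \<Longrightarrow> G (pure_tensor R F A x a) = g a x" by blast
    obtain H where H: "H \<in> module_homs R (tensor_module R F B) E"
      "\<And>t. t \<in> carrier (tensor_module R F A) \<Longrightarrow> H (tensor_map R F B i t) = G t"
      using injective_module_extend[OF E TA TB tensor_map_hom[OF F A B i(1)] flat_tensor_map_inj[OF A B i] G(1)] by blast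
    note HD = module_homsD[OF H(1)]
    define h where "h = (\<lambda>b. \<lambda>x\<in>carrier F. H (pure_tensor R F B x b))"
    have pb: "pure_tensor R F B x b \<in> carrier (tensor_module R F B)" if "x \<in> carrier F" "b \<in> carrier B" for x b
      using pure_tensor_bilinear(1)[OF F B that that F.R.zero_closed] .
    have p2: "pure_tensor R F B (x \<oplus>\<^bsub>F\<^esub> x') b = pure_tensor R F B x b \<oplus>\<^bsub>tensor_module R F B\<^esub> pure_tensor R F B x' b"
      if "x \<in> carrier F" "b \<in> carrier B" "x' \<in> carrier F" for x x' b
      using pure_tensor_bilinear(2)[OF F B that that(2) F.R.zero_closed] .
    have p3: "pure_tensor R F B x (b \<oplus>\<^bsub>B\<^esub> b') = pure_tensor R F B x b \<oplus>\<^bsub>tensor_module R F B\<^esub> pure_tensor R F B x b'"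
      if "x \<in> carrier F" "b \<in> carrier B" "b' \<in> carrier B" for x b b'
      using pure_tensor_bilinear(3)[OF F B that(1,2) that(1,3) F.R.zero_closed] .
    have p45: "pure_tensor R F B (r \<odot>\<^bsub>F\<^esub> x) b = r \<odot>\<^bsub>tensor_module R F B\<^esub> pure_tensor R F B x b"
      "pure_tensor R F B x (r \<odot>\<^bsub>B\<^esub> b) = r \<odot>\<^bsub>tensor_module R F B\<^esub> pure_tensor R F B x b"
      if "r \<in> carrier R" "x \<in> carrier F" "b \<in> carrier B" for r x b
      using pure_tensor_bilinear(4,5)[OF F B that(2,3) that(2,3,1)] by auto
    have "h b \<in> carrier ?H" if "b \<in> carrier B" for b
    proof -
      have "(\<lambda>x. H (pure_tensor R F B x b)) \<in> module_homs R F E"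
        using that by (intro module_homsI) (simp_all add: HD pb p2 p45)
      then show ?thesis using module_homs_restrict[OF F] by (simp add: h_def hom_module_simps)
    qed
    then have "h \<in> module_homs R B ?H"
      by (intro module_homsI) (auto simp: h_def hom_module_simps fun_eq_iff HD pb p3 p45)
    moreover have "h (i a) = g a" if a: "a \<in> carrier A" for a
    proof (rule extensionalityI[of _ "carrier F"])
      show "g a \<in> extensional (carrier F)" using gD(1)[OF a] by (simp add: hom_module_simps)
      fix x assume x: "x \<in> carrier F"
      then show "h (i a) x = g a x"
        using H(2)[of "pure_tensor R F A x a"] pure_tensor_bilinear(1)[OF F A x a x a F.R.zero_closed]
        by (simp add: h_def tensor_map_pure[OF F A B i(1) x a] G(2) a)
    qed (simp add: h_def)
    ultimately show "\<exists>h\<in>module_homs R B ?H. \<forall>x\<in>carrier A. h (i x) = g x" by blast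
  qed
qed

text \<open>Flatness makes \<open>F \<otimes> R/p\<close> torsion-free over \<open>R/p\<close>, and faithfulness makes it nonzero.\<close>

lemma prime_tensor_generator:
  assumes p: "primeideal p R"
  shows "\<exists>(V :: ('a, 'a) module) e x. module R V \<and> e \<in> carrier V \<and> x \<in> carrier F \<and>
    (\<forall>r\<in>p. \<forall>v\<in>carrier V. r \<odot>\<^bsub>V\<^esub> v = \<zero>\<^bsub>V\<^esub>) \<and>
    (\<forall>r\<in>carrier R. r \<odot>\<^bsub>tensor_module R F V\<^esub> pure_tensor R F V x e = \<zero>\<^bsub>tensor_module R F V\<^esub> \<longrightarrow> r \<in> p)"
proof -
  note F = faithfully_flat_module and R = cring_base
  interpret R: cring R by (rule cring_base)
  interpret p: primeideal p R by fact
  interpret F: module R F by (rule F)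
  note reg = module_regular_module[OF R] and sub = ideal_submodule_regular[OF R p.is_ideal]
  let ?Q = "quotient_module (regular_module R) p" and ?q = "\<lambda>x. p +>\<^bsub>regular_module R\<^esub> x"
  note Q = module_quotient[OF reg sub] and q = quotient_hom[OF reg sub]
  \<comment> \<open>Flatness is available only for modules with carrier in the type of
    \<open>R\<close>, so \<open>R/p\<close> is copied onto a set of coset representatives.\<close>
  let ?rep = "\<lambda>X. SOME x. x \<in> X"
  have rep: "X = ?q (?rep X)" "?rep X \<in> carrier R" if X: "X \<in> carrier ?Q" for X
  proof -
    obtain x where x: "x \<in> carrier (regular_module R)" "X = ?q x" by (rule quotient_carrierE[OF reg sub X])
    have "\<zero>\<^bsub>R\<^esub> \<oplus>\<^bsub>R\<^esub> x \<in> X" unfolding x(2) a_r_coset_def' by (rule UN_I[of "\<zero>\<^bsub>R\<^esub>"]) simp_all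
    then have "?rep X \<in> X" by (rule someI)
    note m = coset_memD[OF reg sub x(1) this[unfolded x(2)]]
    show "?rep X \<in> carrier R" using m(1) x(2) by simp
    show "X = ?q (?rep X)" using coset_eqI[OF reg sub m(1) x(1) m(2)] x(2) by simp
  qed
  have inj: "inj_on ?rep (carrier ?Q)" by (rule inj_onI) (metis rep(1))
  note t = transport_module[OF Q inj]
  let ?V = "transport_module ?rep ?Q"
  define \<pi> where "\<pi> = (\<lambda>r. ?rep (?q r))"
  interpret V: module R ?V by (rule t(1))
  have \<pi>: "\<pi> \<in> module_homs R (regular_module R) ?V" unfolding \<pi>_def by (rule module_homs_comp[OF q(1) t(2)])
  note \<pi>D = module_homsD[OF \<pi>]
  have ker: "\<pi> r = \<zero>\<^bsub>?V\<^esub> \<longleftrightarrow> r \<in> p" if r: "r \<in> carrier R" for r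
  proof -
    interpret Q: module R ?Q by (rule Q)
    have "?q r \<in> carrier ?Q" using module_homsD(1)[OF q(1)] r by simp
    then have "\<pi> r = \<zero>\<^bsub>?V\<^esub> \<longleftrightarrow> ?q r = \<zero>\<^bsub>?Q\<^esub>"
      unfolding \<pi>_def module_homs_zero[OF Q t(1,2), symmetric] using inj Q.zero_closed by (auto dest: inj_onD)
    then show ?thesis using q(3)[of r] r by simp
  qed
  have surj: "\<exists>r\<in>carrier R. v = \<pi> r" if "v \<in> carrier ?V" for v
    using that unfolding t(6) \<pi>_def q(2)[symmetric] by auto
  let ?e = "\<pi> \<one>\<^bsub>R\<^esub>"
  have e: "?e \<in> carrier ?V" using \<pi>D(1) by simp
  have \<pi>e: "\<pi> r = r \<odot>\<^bsub>?V\<^esub> ?e" if "r \<in> carrier R" for r using \<pi>D(3)[of r "\<one>\<^bsub>R\<^esub>"] that by simp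
  have pV: "r \<odot>\<^bsub>?V\<^esub> v = \<zero>\<^bsub>?V\<^esub>" if r: "r \<in> p" and v: "v \<in> carrier ?V" for r v
  proof -
    obtain s where s: "s \<in> carrier R" "v = \<pi> s" using surj[OF v] by blast
    then show ?thesis using \<pi>D(3)[of r s] ker[of "r \<otimes>\<^bsub>R\<^esub> s"] p.I_r_closed[OF r s(1)] p.Icarr[OF r] by simp
  qed
  note TV = module_tensor_module[OF F t(1)]
  let ?T = "tensor_module R F ?V" and ?t = "pure_tensor R F ?V"
  interpret T: module R ?T by (rule TV)
  have pt: "?t x v \<in> carrier ?T" if "x \<in> carrier F" "v \<in> carrier ?V" for x v
    using pure_tensor_bilinear(1)[OF F t(1) that that R.zero_closed] .
  have ptr: "?t x (r \<odot>\<^bsub>?V\<^esub> v) = r \<odot>\<^bsub>?T\<^esub> ?t x v" if "x \<in> carrier F" "v \<in> carrier ?V" "r \<in> carrier R" for x v r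
    using pure_tensor_bilinear(5)[OF F t(1) that(1,2) that] .
  have "\<one>\<^bsub>R\<^esub> \<notin> p" using p.I_notcarr p.one_imp_carrier by metis
  then have "carrier ?V \<noteq> {\<zero>\<^bsub>?V\<^esub>}" using ker[of "\<one>\<^bsub>R\<^esub>"] e by auto
  then have nz: "carrier ?T \<noteq> {\<zero>\<^bsub>?T\<^esub>}" by (rule faithful_tensor_nonzero[OF t(1)])
  \<comment> \<open>\<open>?V\<close> is generated by \<open>?e\<close>, so the pure tensors with
    second factor \<open>?e\<close> generate the tensor product and cannot all vanish.\<close>
  have "\<exists>x\<in>carrier F. ?t x ?e \<noteq> \<zero>\<^bsub>?T\<^esub>"
  proof (rule ccontr)
    assume *: "\<not> (\<exists>x\<in>carrier F. ?t x ?e \<noteq> \<zero>\<^bsub>?T\<^esub>)"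
    have id: "(\<lambda>t. t) \<in> module_homs R ?T ?T" by (rule module_homsI) auto
    have "w = \<zero>\<^bsub>?T\<^esub>" if w: "w \<in> carrier ?T" for w
    proof (rule tensor_hom_eqI[OF F t(1) TV id module_homs_const_zero[OF TV] _ w])
      fix x v assume x: "x \<in> carrier F" and v: "v \<in> carrier ?V"
      obtain r where r: "r \<in> carrier R" "v = r \<odot>\<^bsub>?V\<^esub> ?e" using surj[OF v] \<pi>e by metis
      then show "?t x v = \<zero>\<^bsub>?T\<^esub>" using ptr[OF x e r(1)] * x by simp
    qed
    then show False using nz T.zero_closed by blast
  qed
  then obtain x where x: "x \<in> carrier F" "?t x ?e \<noteq> \<zero>\<^bsub>?T\<^esub>" by blast
  have "r \<in> p" if r: "r \<in> carrier R" "r \<odot>\<^bsub>?T\<^esub> ?t x ?e = \<zero>\<^bsub>?T\<^esub>" for r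
  proof (rule ccontr)
    assume rp: "r \<notin> p"
    have id: "(\<lambda>t. t) \<in> module_homs R ?T ?T" "(\<lambda>v. v) \<in> module_homs R ?V ?V" by (auto intro: module_homsI)
    note m = module_homs_smult[OF t(1) id(2) r(1)]
    \<comment> \<open>For \<open>r\<close> outside \<open>p\<close>, multiplication by
      \<open>r\<close> is injective on \<open>R/p\<close> because \<open>p\<close> is prime.
      Flatness preserves this, so \<open>r\<close> cannot kill the nonzero tensor.\<close>
    have "v = \<zero>\<^bsub>?V\<^esub>" if v: "v \<in> carrier ?V" "r \<odot>\<^bsub>?V\<^esub> v = \<zero>\<^bsub>?V\<^esub>" for v
    proof -
      obtain s where s: "s \<in> carrier R" "v = \<pi> s" using surj[OF v(1)] by blast
      then have "r \<otimes>\<^bsub>R\<^esub> s \<in> p" using \<pi>D(3)[of r s] ker[of "r \<otimes>\<^bsub>R\<^esub> s"] r(1) v(2) by simp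
      then have "s \<in> p" using p.I_prime[OF r(1) s(1)] rp by blast
      then show ?thesis using ker s by simp
    qed
    then have "inj_on (\<lambda>v. r \<odot>\<^bsub>?V\<^esub> v) (carrier ?V)" by (rule hom_inj_onI[OF t(1) t(1) m])
    note i = flat_tensor_map_inj[OF t(1) t(1) m this]
    have "tensor_map R F ?V (\<lambda>v. r \<odot>\<^bsub>?V\<^esub> v) (?t x ?e) = \<zero>\<^bsub>?T\<^esub>"
      using tensor_map_pure[OF F t(1) t(1) m x(1) e] ptr[OF x(1) e r(1)] r(2) by simp
    then have "?t x ?e = \<zero>\<^bsub>?T\<^esub>"
      using inj_onD[OF i _ pt[OF x(1) e] T.zero_closed] module_homs_zero[OF TV TV tensor_map_hom[OF F t(1) t(1) m]] by simp
    then show False using x(2) by simp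
  qed
  then show ?thesis using t(1) e x(1) pV by blast
qed

text \<open>The homomorphism \<open>v\<close> sends a point of \<open>F\<close> to its tensor with
  \<open>e\<close> and then maps the tensor product to \<open>L\<close>; as \<open>p\<close> kills
  the tensor product, it kills all values of \<open>v\<close>. The annihilator of the chosen tensor
  is exactly \<open>p\<close>, which makes sending it to \<open>y\<close> consistent.\<close>

lemma prime_annihilated_hom:
  assumes p: "primeideal p R" and L: "module R L" and y: "y \<in> carrier L"
    and py: "\<And>r. r \<in> p \<Longrightarrow> r \<odot>\<^bsub>L\<^esub> y = \<zero>\<^bsub>L\<^esub>"
    and test: "\<And>J h. ideal J R \<Longrightarrow> p \<subset> J \<Longrightarrow> h \<in> module_homs R (ideal_module R J) L \<Longrightarrow>
      \<exists>m\<in>carrier L. \<forall>r\<in>J. h r = r \<odot>\<^bsub>L\<^esub> m"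
  shows "\<exists>v\<in>module_homs R F L. \<exists>x\<in>carrier F. v x = y \<and> (\<forall>r\<in>p. \<forall>x\<in>carrier F. r \<odot>\<^bsub>L\<^esub> v x = \<zero>\<^bsub>L\<^esub>)"
proof -
  note F = faithfully_flat_module
  interpret R: cring R by (rule cring_base)
  interpret p: primeideal p R by fact
  interpret L: module R L by fact
  interpret F: module R F by (rule F)
  obtain V :: "('a, 'a) module" and e x where V: "module R V" and e: "e \<in> carrier V" and x: "x \<in> carrier F"
    and pV: "\<And>r v. r \<in> p \<Longrightarrow> v \<in> carrier V \<Longrightarrow> r \<odot>\<^bsub>V\<^esub> v = \<zero>\<^bsub>V\<^esub>"
    and ann: "\<And>r. r \<in> carrier R \<Longrightarrow> r \<odot>\<^bsub>tensor_module R F V\<^esub> pure_tensor R F V x e = \<zero>\<^bsub>tensor_module R F V\<^esub> \<Longrightarrow> r \<in> p"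
    using prime_tensor_generator[OF p] by blast
  let ?T = "tensor_module R F V" and ?t = "pure_tensor R F V"
  note T = module_tensor_module[OF F V]
  have pt: "?t x e \<in> carrier ?T" "?t (x \<oplus>\<^bsub>F\<^esub> x') e = ?t x e \<oplus>\<^bsub>?T\<^esub> ?t x' e" if "x \<in> carrier F" "x' \<in> carrier F" for x x'
    using pure_tensor_bilinear(1,2)[OF F V that(1) e that(2) e R.zero_closed] by auto
  have ptr: "?t (r \<odot>\<^bsub>F\<^esub> x) e = r \<odot>\<^bsub>?T\<^esub> ?t x e" if "x \<in> carrier F" "r \<in> carrier R" for x r
    using pure_tensor_bilinear(4)[OF F V that(1) e that(1) e that(2)] .
  have pT: "r \<odot>\<^bsub>?T\<^esub> w = \<zero>\<^bsub>?T\<^esub>" if "r \<in> p" "w \<in> carrier ?T" for r w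
    by (rule tensor_smult_eq_zeroI[OF F V p.Icarr[OF that(1)] pV[OF that(1)] that(2)])
  have "\<exists>h\<in>module_homs R ?T L. h (?t x e) = y"
  proof (rule hom_extend_cyclic[OF L T pt(1)[OF x x] y])
    show "r \<odot>\<^bsub>L\<^esub> y = \<zero>\<^bsub>L\<^esub>" if "r \<in> carrier R" "r \<odot>\<^bsub>?T\<^esub> ?t x e = \<zero>\<^bsub>?T\<^esub>" for r using py ann that by blast
    fix b J h assume b: "b \<in> carrier ?T" and J: "ideal J R" and h: "h \<in> module_homs R (ideal_module R J) L"
      and sub: "{r \<in> carrier R. r \<odot>\<^bsub>?T\<^esub> b = \<zero>\<^bsub>?T\<^esub>} \<subseteq> J" and z: "\<And>r. r \<in> J \<Longrightarrow> r \<odot>\<^bsub>?T\<^esub> b = \<zero>\<^bsub>?T\<^esub> \<Longrightarrow> h r = \<zero>\<^bsub>L\<^esub>"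
    have "p \<subseteq> J" using sub pT b p.Icarr by blast
    show "\<exists>m\<in>carrier L. \<forall>r\<in>J. h r = r \<odot>\<^bsub>L\<^esub> m"
    proof (cases "p = J")
      \<comment> \<open>For \<open>J = p\<close> the map \<open>h\<close> is zero, since
        \<open>p\<close> kills \<open>b\<close>; so \<open>m\<close> can be zero.\<close>
      case True
      then have "h r = r \<odot>\<^bsub>L\<^esub> \<zero>\<^bsub>L\<^esub>" if "r \<in> J" for r using z[OF that] pT[of r b] b that p.Icarr[of r] by simp
      then show ?thesis using L.zero_closed by blast
    qed (use test[OF J _ h] \<open>p \<subseteq> J\<close> in blast)
  qed
  then obtain h where h: "h \<in> module_homs R ?T L" "h (?t x e) = y" by blast
  note hD = module_homsD[OF h(1)]
  have "(\<lambda>x. h (?t x e)) \<in> module_homs R F L" by (rule module_homsI) (simp_all add: pt ptr hD)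
  moreover have z: "r \<odot>\<^bsub>L\<^esub> h (?t x e) = \<zero>\<^bsub>L\<^esub>" if "r \<in> p" "x \<in> carrier F" for r x
    using hD(3)[of r "?t x e"] pT[OF that(1)] pt(1)[OF that(2,2)] p.Icarr[OF that(1)] module_homs_zero[OF T L h(1)] by simp
  ultimately show ?thesis
    by (intro bexI[of _ "\<lambda>x. h (?t x e)"] bexI[of _ x]) (simp_all add: h(2) x z)
qed

end

section \<open>Vanishing of Ext along an injective resolution\<close>

text \<open>The coset of the cocycle contains the cocycle and is by hypothesis the zero coset, that
  is, the set of coboundaries. Vanishing of \<open>Ext\<close> enters the proof in this elementwise
  form.\<close>

lemma Ext_vanish_coboundary:
  assumes R: "cring R" and F: "module R F" and M: "module R M"
    and Ext: "carrier (Ext R (Suc i) F M) = {\<zero>\<^bsub>Ext R (Suc i) F M\<^esub>}"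
    and c: "c \<in> module_homs R (res_module R F (Suc i)) M"
    and cocycle: "\<And>q. q \<in> carrier (res_module R F (Suc (Suc i))) \<Longrightarrow> c (res_boundary R F (Suc i) q) = \<zero>\<^bsub>M\<^esub>"
  shows "\<exists>a\<in>module_homs R (res_module R F i) M. \<forall>q\<in>carrier (res_module R F (Suc i)). c q = a (res_boundary R F i q)"
proof -
  note P = module_res_module[OF R, of F]
  have C: "module R (ext_cochains R n F M)" for n
    unfolding ext_cochains_def by (rule module_hom_module[OF P M])
  interpret C: module R "ext_cochains R (Suc i) F M" by (rule C)
  \<comment> \<open>Cochains are extensional functions, so \<open>c\<close> is cut off outside its
    source.\<close>
  let ?c = "\<lambda>q\<in>carrier (res_module R F (Suc i)). c q"
  let ?B = "ext_coboundaries R (Suc i) F M" and ?Z = "ext_cocycles R (Suc i) F M"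
  have cc: "?c \<in> carrier (ext_cochains R (Suc i) F M)"
    using module_homs_restrict[OF P c] by (simp add: ext_cochains_def hom_module_simps)
  have "ext_coboundary R (Suc i) F ?c = \<zero>\<^bsub>ext_cochains R (Suc (Suc i)) F M\<^esub>"
    using cocycle module_homsD(1)[OF res_boundary_hom[OF R F, of "Suc i"]]
    by (auto simp: ext_coboundary_def compose_def ext_cochains_def hom_module_simps fun_eq_iff)
  then have cZ: "?c \<in> ?Z" using cc by (simp add: ext_cocycles_def a_kernel_iff)
  have "submodule (ext_coboundary R i F ` carrier (ext_cochains R i F M)) R (ext_cochains R (Suc i) F M)"
    by (rule hom_image_submodule[OF C C ext_coboundary_hom[OF R F M]])
  then have zB: "\<zero>\<^bsub>ext_cochains R (Suc i) F M\<^esub> \<in> ?B"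
    using subgroup.one_closed[OF submodule.axioms(1)] by fastforce
  let ?A = "(ext_cochains R (Suc i) F M)\<lparr>carrier := ?Z\<rparr>"
  have "?B +>\<^bsub>?A\<^esub> ?c \<in> carrier (Ext R (Suc i) F M)"
    unfolding Ext_def quotient_module_def A_RCOSETS_def' using cZ by auto
  then have "?B +>\<^bsub>?A\<^esub> ?c = ?B" unfolding Ext by (simp add: Ext_def quotient_module_def)
  moreover have "\<zero>\<^bsub>ext_cochains R (Suc i) F M\<^esub> \<oplus>\<^bsub>?A\<^esub> ?c \<in> ?B +>\<^bsub>?A\<^esub> ?c"
    unfolding a_r_coset_def' by (rule UN_I[OF zB]) simp
  ultimately have "?c \<in> ?B" using cc by simp
  then obtain a where a: "a \<in> carrier (ext_cochains R i F M)" "?c = ext_coboundary R i F a" by auto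
  have "c q = a (res_boundary R F i q)" if "q \<in> carrier (res_module R F (Suc i))" for q
    using fun_cong[OF a(2), of q] that by (simp add: ext_coboundary_def compose_def)
  moreover have "a \<in> module_homs R (res_module R F i) M" using a(1) by (simp add: ext_cochains_def hom_module_simps)
  ultimately show ?thesis by blast
qed

lemma res_boundary_boundary:
  assumes "cring R" "module R F" "q \<in> carrier (res_module R F (Suc (Suc i)))"
  shows "res_boundary R F i (res_boundary R F (Suc i) q) = \<zero>\<^bsub>res_module R F i\<^esub>"
  using standard_resolution_exact(3)[OF assms(1,2), of i] assms(3) by (auto simp: exact_at_def a_kernel_iff set_eq_iff)

context injective_resolution
begin

section \<open>Cosyzygies of \<open>M\<close> in the injective resolution\<close>

definition cycles :: "nat \<Rightarrow> ('a, 'e) module" where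
  "cycles n = (E n)\<lparr>carrier := a_kernel (E n) (E (Suc n)) (d n)\<rparr>"

lemma E_module: "module R (E n)"
  using inj by (simp add: injective_module_def)

lemma cycles_simps:
  "carrier (cycles n) = a_kernel (E n) (E (Suc n)) (d n)" "\<zero>\<^bsub>cycles n\<^esub> = \<zero>\<^bsub>E n\<^esub>"
  "x \<oplus>\<^bsub>cycles n\<^esub> y = x \<oplus>\<^bsub>E n\<^esub> y" "r \<odot>\<^bsub>cycles n\<^esub> x = r \<odot>\<^bsub>E n\<^esub> x"
  by (simp_all add: cycles_def)

lemma cycles_module: "module R (cycles n)"
  unfolding cycles_def
  by (rule submodule.submodule_is_module[OF kernel_submodule[OF E_module E_module d] E_module])

lemma cycles_closed: "x \<in> carrier (cycles n) \<Longrightarrow> x \<in> carrier (E n)"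
  by (simp add: cycles_simps a_kernel_iff)

lemma cycles_incl: "(\<lambda>x. x) \<in> module_homs R (cycles n) (E n)"
  by (rule module_homsI) (simp_all add: cycles_closed cycles_simps(2-))

lemma hom_to_cycles_iff:
  "f \<in> module_homs R A (cycles n) \<longleftrightarrow> f \<in> module_homs R A (E n) \<and> (\<forall>x\<in>carrier A. d n (f x) = \<zero>\<^bsub>E (Suc n)\<^esub>)"
  by (auto simp: module_homs_def cycles_simps a_kernel_iff Pi_iff)

lemma d_cycles: "d n \<in> module_homs R (E n) (cycles (Suc n))"
  using d[of n] exact[of n] by (auto simp: hom_to_cycles_iff exact_at_def a_kernel_iff set_eq_iff)

lemma d_surj: "d n ` carrier (E n) = carrier (cycles (Suc n))"
  using exact[of n] by (simp add: exact_at_def cycles_simps)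

lemma \<iota>_cycles: "\<iota> \<in> module_homs R M (cycles 0)"
  using \<iota>(1) exact_0 by (auto simp: hom_to_cycles_iff exact_at_def a_kernel_iff set_eq_iff)

lemma \<iota>_surj: "\<iota> ` carrier M = carrier (cycles 0)"
  using exact_0 by (simp add: exact_at_def cycles_simps)

lemma \<iota>_inverse: "\<exists>\<kappa>\<in>module_homs R (cycles 0) M. (\<forall>x\<in>carrier M. \<kappa> (\<iota> x) = x) \<and> (\<forall>y\<in>carrier (cycles 0). \<iota> (\<kappa> y) = y)"
proof -
  interpret M: module R M by (rule mod)
  have id: "(\<lambda>x. x) \<in> module_homs R M M" by (rule module_homsI) auto
  have "x = \<zero>\<^bsub>M\<^esub>" if "x \<in> carrier M" "\<iota> x = \<zero>\<^bsub>cycles 0\<^esub>" for x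
    using inj_onD[OF \<iota>(2), of x "\<zero>\<^bsub>M\<^esub>"] that module_homs_zero[OF mod cycles_module \<iota>_cycles] by simp
  from hom_factor_surj[OF mod cycles_module mod \<iota>_cycles \<iota>_surj id this] obtain \<kappa> where
    \<kappa>: "\<kappa> \<in> module_homs R (cycles 0) M" "\<And>x. x \<in> carrier M \<Longrightarrow> \<kappa> (\<iota> x) = x" by blast
  then have "\<iota> (\<kappa> y) = y" if "y \<in> carrier (cycles 0)" for y using that \<kappa>(2) unfolding \<iota>_surj[symmetric] by auto
  then show ?thesis using \<kappa> by blast
qed

text \<open>Vanishing of \<open>Ext\<close> in all positive degrees with \<open>cycles n\<close> as
  second argument, written as solvability of coboundary equations. The index \<open>i\<close> stands
  for degree \<open>i + 1\<close>, so degree zero is excluded.\<close>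

definition acyclic_at :: "('a, 'f) module \<Rightarrow> nat \<Rightarrow> bool" where
  "acyclic_at F n \<longleftrightarrow> (\<forall>i. \<forall>c\<in>module_homs R (res_module R F (Suc i)) (cycles n).
     (\<forall>q\<in>carrier (res_module R F (Suc (Suc i))). c (res_boundary R F (Suc i) q) = \<zero>\<^bsub>E n\<^esub>) \<longrightarrow>
     (\<exists>a\<in>module_homs R (res_module R F i) (cycles n).
        \<forall>q\<in>carrier (res_module R F (Suc i)). c q = a (res_boundary R F i q)))"

lemma acyclic_atD:
  assumes "acyclic_at F n" "c \<in> module_homs R (res_module R F (Suc i)) (cycles n)"
    and "\<And>q. q \<in> carrier (res_module R F (Suc (Suc i))) \<Longrightarrow> c (res_boundary R F (Suc i) q) = \<zero>\<^bsub>E n\<^esub>"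
  shows "\<exists>a\<in>module_homs R (res_module R F i) (cycles n).
    \<forall>q\<in>carrier (res_module R F (Suc i)). c q = a (res_boundary R F i q)"
  using assms unfolding acyclic_at_def by simp

lemma acyclic_at_0:
  assumes F: "module R F" and Ext: "\<And>i. i > 0 \<Longrightarrow> carrier (Ext R i F M) = {\<zero>\<^bsub>Ext R i F M\<^esub>}"
  shows "acyclic_at F 0"
  unfolding acyclic_at_def
proof (intro allI ballI impI)
  fix i c assume c: "c \<in> module_homs R (res_module R F (Suc i)) (cycles 0)"
    and z: "\<forall>q\<in>carrier (res_module R F (Suc (Suc i))). c (res_boundary R F (Suc i) q) = \<zero>\<^bsub>E 0\<^esub>"
  obtain \<kappa> where \<kappa>: "\<kappa> \<in> module_homs R (cycles 0) M" "\<And>y. y \<in> carrier (cycles 0) \<Longrightarrow> \<iota> (\<kappa> y) = y"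
    using \<iota>_inverse by blast
  have "\<exists>a\<in>module_homs R (res_module R F i) M. \<forall>q\<in>carrier (res_module R F (Suc i)). \<kappa> (c q) = a (res_boundary R F i q)"
    using module_homs_zero[OF cycles_module mod \<kappa>(1)] z
    by (intro Ext_vanish_coboundary[OF cring F mod Ext module_homs_comp[OF c \<kappa>(1)]]) (simp_all add: cycles_simps)
  then obtain a where a: "a \<in> module_homs R (res_module R F i) M"
    "\<And>q. q \<in> carrier (res_module R F (Suc i)) \<Longrightarrow> \<kappa> (c q) = a (res_boundary R F i q)" by blast
  have "c q = \<iota> (a (res_boundary R F i q))" if "q \<in> carrier (res_module R F (Suc i))" for q
    using \<kappa>(2)[OF module_homsD(1)[OF c that]] a(2)[OF that] by simp
  then show "\<exists>a\<in>module_homs R (res_module R F i) (cycles 0).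
      \<forall>q\<in>carrier (res_module R F (Suc i)). c q = a (res_boundary R F i q)"
    using module_homs_comp[OF a(1) \<iota>_cycles] by (intro bexI[of _ "\<lambda>q. \<iota> (a q)"]) simp_all
qed

text \<open>Dimension shifting: lift \<open>c\<close> to \<open>b\<close> with values in
  \<open>E n\<close>. On boundaries \<open>b\<close> gives a cocycle with values in
  \<open>cycles n\<close>, hence the coboundary of some \<open>a\<close>. Then \<open>b - a\<close>
  still lifts \<open>c\<close> and vanishes on boundaries, so it factors through \<open>g\<close>.
  The target \<open>G\<close> is left open because it will be \<open>F\<close> for
  \<open>i = 0\<close> and the preceding free module otherwise.\<close>

lemma acyclic_at_lift:
  assumes F: "module R F" and acyc: "acyclic_at F n"
    and c: "c \<in> module_homs R (res_module R F i) (cycles (Suc n))"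
    and z: "\<And>q. q \<in> carrier (res_module R F (Suc i)) \<Longrightarrow> c (res_boundary R F i q) = \<zero>\<^bsub>E (Suc n)\<^esub>"
    and G: "module R G" and g: "g \<in> module_homs R (res_module R F i) G"
    and ex: "exact_at (res_module R F (Suc i)) (res_module R F i) G (res_boundary R F i) g"
  shows "\<exists>e\<in>module_homs R G (E n). \<forall>q\<in>carrier (res_module R F i). d n (e (g q)) = c q"
proof -
  note P = module_res_module[OF cring, of F] and bd = res_boundary_hom[OF cring F]
  obtain b where b: "b \<in> module_homs R (res_module R F i) (E n)"
    "\<And>q. q \<in> carrier (res_module R F i) \<Longrightarrow> d n (b q) = c q"
    using free_module_lift[OF E_module cycles_module d_cycles d_surj c[unfolded res_module_def]]
    by (auto simp: res_module_def)
  have b_bd: "(\<lambda>q. b (res_boundary R F i q)) \<in> module_homs R (res_module R F (Suc i)) (cycles n)"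
    unfolding hom_to_cycles_iff using module_homs_comp[OF bd b(1)] b(2) z module_homsD(1)[OF bd] by auto
  have "b (res_boundary R F i (res_boundary R F (Suc i) q)) = \<zero>\<^bsub>E n\<^esub>" if "q \<in> carrier (res_module R F (Suc (Suc i)))" for q
    using res_boundary_boundary[OF cring F that] module_homs_zero[OF P E_module b(1)] by simp
  from acyclic_atD[OF acyc b_bd this] obtain a where a: "a \<in> module_homs R (res_module R F i) (cycles n)"
    "\<And>q. q \<in> carrier (res_module R F (Suc i)) \<Longrightarrow> b (res_boundary R F i q) = a (res_boundary R F i q)" by blast
  have a': "a \<in> module_homs R (res_module R F i) (E n)" "\<And>q. q \<in> carrier (res_module R F i) \<Longrightarrow> d n (a q) = \<zero>\<^bsub>E (Suc n)\<^esub>"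
    using a(1) by (auto simp: hom_to_cycles_iff)
  have "b q \<ominus>\<^bsub>E n\<^esub> a q = \<zero>\<^bsub>E n\<^esub>" if q: "q \<in> carrier (res_module R F i)" "g q = \<zero>\<^bsub>G\<^esub>" for q
  proof -
    have "q \<in> res_boundary R F i ` carrier (res_module R F (Suc i))"
      using ex q by (simp add: exact_at_def a_kernel_iff)
    then have "b q = a q" using a(2) by auto
    then show ?thesis using module_minus_eq_zero[OF E_module] module_homsD(1)[OF a'(1) q(1)] by simp
  qed
  \<comment> \<open>The image of \<open>g\<close> may be a proper submodule of \<open>G\<close>;
    injectivity of \<open>E n\<close> extends the factored map to all of \<open>G\<close>.\<close>
  from injective_module_factor[OF inj P G g module_homs_diff[OF E_module b(1) a'(1)] this]
  obtain e where e: "e \<in> module_homs R G (E n)"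
    "\<And>q. q \<in> carrier (res_module R F i) \<Longrightarrow> e (g q) = b q \<ominus>\<^bsub>E n\<^esub> a q" by blast
  have "d n (e (g q)) = c q" if q: "q \<in> carrier (res_module R F i)" for q
  proof -
    interpret En: module R "E (Suc n)" by (rule E_module)
    have "c q \<in> carrier (E (Suc n))" using module_homsD(1)[OF c q] cycles_closed by blast
    then show ?thesis
      using module_minus_eq_zero[OF E_module, of "c q" "Suc n" "c q"] q
        module_homs_minus[OF E_module E_module d module_homsD(1)[OF b(1) q] module_homsD(1)[OF a'(1) q]]
        En.minus_equality[OF En.l_zero[OF En.zero_closed] En.zero_closed En.zero_closed]
      by (simp add: e(2) b(2) a'(2) a_minus_def)
  qed
  then show ?thesis using e(1) by blast
qed

lemma acyclic_at_Suc:
  assumes F: "module R F" and acyc: "acyclic_at F n"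
  shows "acyclic_at F (Suc n)"
  unfolding acyclic_at_def
proof (intro allI ballI impI)
  fix i c assume c: "c \<in> module_homs R (res_module R F (Suc i)) (cycles (Suc n))"
    and z: "\<forall>q\<in>carrier (res_module R F (Suc (Suc i))). c (res_boundary R F (Suc i) q) = \<zero>\<^bsub>E (Suc n)\<^esub>"
  note P = module_res_module[OF cring, of F] and bd = res_boundary_hom[OF cring F]
  obtain e where e: "e \<in> module_homs R (res_module R F i) (E n)"
    "\<And>q. q \<in> carrier (res_module R F (Suc i)) \<Longrightarrow> d n (e (res_boundary R F i q)) = c q"
    using acyclic_at_lift[OF F acyc c _ P bd standard_resolution_exact(3)[OF cring F]] z by blast
  then show "\<exists>a\<in>module_homs R (res_module R F i) (cycles (Suc n)).
      \<forall>q\<in>carrier (res_module R F (Suc i)). c q = a (res_boundary R F i q)"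
    using module_homs_comp[OF e(1) d_cycles] by (intro bexI[of _ "\<lambda>q. d n (e q)"]) auto
qed

text \<open>Degree zero of the shift, with the augmentation as \<open>g\<close>: \<open>f\<close> is
  pulled back to the free cover of \<open>F\<close>, where it can be lifted, and the corrected lift
  descends to \<open>F\<close>.\<close>

lemma acyclic_at_hom_lift:
  assumes F: "module R F" and acyc: "acyclic_at F n" and f: "f \<in> module_homs R F (cycles (Suc n))"
  shows "\<exists>e\<in>module_homs R F (E n). \<forall>x\<in>carrier F. d n (e x) = f x"
proof -
  note \<epsilon> = res_augmentation_hom[OF cring F] and ex = standard_resolution_exact(1,2)[OF cring F]
  have "res_augmentation R F (res_boundary R F 0 q) = \<zero>\<^bsub>F\<^esub>" if "q \<in> carrier (res_module R F (Suc 0))" for q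
    using ex(2) that by (auto simp: exact_at_def a_kernel_iff set_eq_iff)
  then have z: "f (res_augmentation R F (res_boundary R F 0 q)) = \<zero>\<^bsub>E (Suc n)\<^esub>" if "q \<in> carrier (res_module R F (Suc 0))" for q
    using that module_homs_zero[OF F cycles_module f] by (simp add: cycles_simps)
  obtain e where e: "e \<in> module_homs R F (E n)"
    "\<And>q. q \<in> carrier (res_module R F 0) \<Longrightarrow> d n (e (res_augmentation R F q)) = f (res_augmentation R F q)"
    using acyclic_at_lift[OF F acyc module_homs_comp[OF \<epsilon> f] z F \<epsilon> ex(2)] by blast
  have "d n (e x) = f x" if "x \<in> carrier F" for x using e(2) that unfolding ex(1)[symmetric] by auto
  then show ?thesis using e(1) by blast
qed

text \<open>\<open>acyc\<close> makes \<open>Hom(F, E n) -> Hom(F, cycles (n + 1))\<close>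
  surjective and \<open>Hn\<close> makes its kernel injective, so it splits. The splitting also
  exhibits the target as a retract of the injective module \<open>Hom(F, E n)\<close>, which keeps
  the induction on \<open>n\<close> going.\<close>

lemma hom_section:
  assumes ff: "faithfully_flat R F" and acyc: "acyclic_at F n"
    and Hn: "injective_module R (hom_module R F (cycles n))"
  shows "\<exists>\<sigma>\<in>module_homs R (hom_module R F (cycles (Suc n))) (hom_module R F (E n)).
    \<forall>v\<in>carrier (hom_module R F (cycles (Suc n))). \<forall>x\<in>carrier F. d n (\<sigma> v x) = v x"
    and "injective_module R (hom_module R F (cycles (Suc n)))"
proof -
  note F = faithfully_flat_module[OF ff]
  let ?X = "hom_module R F (cycles n)" and ?Y = "hom_module R F (E n)" and ?Z = "hom_module R F (cycles (Suc n))"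
  let ?q = "\<lambda>u. \<lambda>x\<in>carrier F. d n (u x)"
  note Y = module_hom_module[OF F E_module, of n] and Z = module_hom_module[OF F cycles_module, of "Suc n"]
  note q = hom_module_map[OF F d_cycles]
  have i: "(\<lambda>u. u) \<in> module_homs R ?X ?Y"
    by (rule module_homsI) (auto simp: hom_module_simps hom_to_cycles_iff cycles_simps)
  have "(\<lambda>x\<in>carrier F. d n (u x)) = (\<lambda>x\<in>carrier F. z) \<longleftrightarrow> (\<forall>x\<in>carrier F. d n (u x) = z)" for u z
    by (metis (no_types, lifting) restrict_apply' restrict_ext)
  then have "exact_at ?X ?Y ?Z (\<lambda>u. u) ?q"
    by (auto simp: exact_at_def a_kernel_iff hom_module_simps hom_to_cycles_iff cycles_simps(2-))
  moreover have "?q ` carrier ?Y = carrier ?Z"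
  proof (intro equalityI subsetI)
    fix v assume "v \<in> ?q ` carrier ?Y"
    then show "v \<in> carrier ?Z" using module_homsD(1)[OF q] by blast
  next
    fix v assume v: "v \<in> carrier ?Z"
    then obtain e where e: "e \<in> module_homs R F (E n)" "\<And>x. x \<in> carrier F \<Longrightarrow> d n (e x) = v x"
      using acyclic_at_hom_lift[OF F acyc, of v] by (auto simp: hom_module_simps)
    have "v = ?q (\<lambda>x\<in>carrier F. e x)"
      using v e(2) by (intro extensionalityI[of v "carrier F"]) (auto simp: hom_module_simps)
    moreover have "(\<lambda>x\<in>carrier F. e x) \<in> carrier ?Y"
      using module_homs_restrict[OF F e(1)] by (simp add: hom_module_simps)
    ultimately show "v \<in> ?q ` carrier ?Y" by (rule image_eqI)
  qed
  ultimately obtain s where s: "s \<in> module_homs R ?Z ?Y" "\<And>v. v \<in> carrier ?Z \<Longrightarrow> ?q (s v) = v"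
    using injective_kernel_splits[OF Hn Y Z i _ q] by auto
  have "d n (s v x) = v x" if "v \<in> carrier ?Z" "x \<in> carrier F" for v x
    using fun_cong[OF s(2)[OF that(1)], of x] that(2) by simp
  then show "\<exists>\<sigma>\<in>module_homs R ?Z ?Y. \<forall>v\<in>carrier ?Z. \<forall>x\<in>carrier F. d n (\<sigma> v x) = v x"
    using s(1) by blast
  show "injective_module R ?Z"
    by (rule injective_module_retract[OF hom_module_injective[OF ff inj] Z s(1) q]) (rule s(2))
qed

lemma hom_cycles_injective:
  assumes ff: "faithfully_flat R F" and acyc: "acyclic_at F 0" and HM: "injective_module R (hom_module R F M)"
  shows "acyclic_at F n \<and> injective_module R (hom_module R F (cycles n))"
proof (induction n)
  case 0
  note F = faithfully_flat_module[OF ff]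
  obtain \<kappa> where \<kappa>: "\<kappa> \<in> module_homs R (cycles 0) M" "\<And>y. y \<in> carrier (cycles 0) \<Longrightarrow> \<iota> (\<kappa> y) = y"
    using \<iota>_inverse by blast
  have "injective_module R (hom_module R F (cycles 0))"
  proof (rule injective_module_retract[OF HM module_hom_module[OF F cycles_module]
        hom_module_map[OF F \<kappa>(1)] hom_module_map[OF F \<iota>_cycles]])
    fix v assume v: "v \<in> carrier (hom_module R F (cycles 0))"
    then have "v x \<in> carrier (cycles 0)" if "x \<in> carrier F" for x
      using module_homsD(1)[of v R F "cycles 0"] that by (simp add: hom_module_simps)
    then show "(\<lambda>x\<in>carrier F. \<iota> ((\<lambda>x\<in>carrier F. \<kappa> (v x)) x)) = v"
      using v \<kappa>(2) by (intro extensionalityI[of _ "carrier F" v]) (auto simp: hom_module_simps)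
  qed
  then show ?case using acyc by simp
next
  case (Suc n)
  then show ?case using acyclic_at_Suc[OF faithfully_flat_module[OF ff]] hom_section(2)[OF ff] by blast
qed

section \<open>Vanishing of Ext against cyclic modules\<close>

text \<open>The elementwise form of \<open>Ext\<close>\<open>\<^sup>1(R/J, cycles n) = 0\<close>: homomorphisms
  \<open>R/J \<rightarrow> cycles (n + 1)\<close> lift to \<open>E n\<close>.\<close>

definition lifts_annihilated :: "'a set \<Rightarrow> nat \<Rightarrow> bool" where
  "lifts_annihilated J n \<longleftrightarrow> (\<forall>y\<in>carrier (cycles (Suc n)). (\<forall>r\<in>J. r \<odot>\<^bsub>E (Suc n)\<^esub> y = \<zero>\<^bsub>E (Suc n)\<^esub>) \<longrightarrow>
     (\<exists>e\<in>carrier (E n). d n e = y \<and> (\<forall>r\<in>J. r \<odot>\<^bsub>E n\<^esub> e = \<zero>\<^bsub>E n\<^esub>)))"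

lemma lifts_annihilatedE:
  assumes "lifts_annihilated J n" "y \<in> carrier (cycles (Suc n))"
    and "\<forall>r\<in>J. r \<odot>\<^bsub>E (Suc n)\<^esub> y = \<zero>\<^bsub>E (Suc n)\<^esub>"
  obtains e where "e \<in> carrier (E n)" "d n e = y" "\<forall>r\<in>J. r \<odot>\<^bsub>E n\<^esub> e = \<zero>\<^bsub>E n\<^esub>"
proof -
  have "\<exists>e\<in>carrier (E n). d n e = y \<and> (\<forall>r\<in>J. r \<odot>\<^bsub>E n\<^esub> e = \<zero>\<^bsub>E n\<^esub>)"
    using assms unfolding lifts_annihilated_def by simp
  then show ?thesis using that by blast
qed

text \<open>Injectivity of \<open>E n\<close> writes \<open>h\<close> as multiplication by some
  \<open>e\<close> in \<open>E n\<close>, and \<open>d n e\<close> is killed by \<open>J\<close>. An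
  annihilated lift \<open>e'\<close> of \<open>d n e\<close> corrects \<open>e\<close> to
  \<open>e - e'\<close>, which is a cycle and acts on \<open>J\<close> in the same way.\<close>

lemma lifts_annihilated_ideal_hom:
  assumes lift: "lifts_annihilated J n" and J: "ideal J R" and h: "h \<in> module_homs R (ideal_module R J) (cycles n)"
  shows "\<exists>m\<in>carrier (cycles n). \<forall>r\<in>J. h r = r \<odot>\<^bsub>cycles n\<^esub> m"
proof -
  interpret J: ideal J R by fact
  interpret En: module R "E n" by (rule E_module)
  have hE: "h \<in> module_homs R (ideal_module R J) (E n)" "\<And>r. r \<in> J \<Longrightarrow> d n (h r) = \<zero>\<^bsub>E (Suc n)\<^esub>"
    using h by (auto simp: hom_to_cycles_iff)
  obtain e where e: "e \<in> carrier (E n)" "\<And>r. r \<in> J \<Longrightarrow> h r = r \<odot>\<^bsub>E n\<^esub> e"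
    using injective_module_ideal_hom[OF inj J hE(1)] by blast
  have Jde: "\<forall>r\<in>J. r \<odot>\<^bsub>E (Suc n)\<^esub> d n e = \<zero>\<^bsub>E (Suc n)\<^esub>"
  proof
    fix r assume r: "r \<in> J"
    show "r \<odot>\<^bsub>E (Suc n)\<^esub> d n e = \<zero>\<^bsub>E (Suc n)\<^esub>"
      using module_homsD(3)[OF d J.Icarr[OF r] e(1)] hE(2)[OF r] e(2)[OF r] by simp
  qed
  obtain e' where e': "e' \<in> carrier (E n)" "d n e' = d n e" "\<forall>r\<in>J. r \<odot>\<^bsub>E n\<^esub> e' = \<zero>\<^bsub>E n\<^esub>"
    by (rule lifts_annihilatedE[OF lift module_homsD(1)[OF d_cycles e(1)] Jde])
  have "d n (e \<ominus>\<^bsub>E n\<^esub> e') = \<zero>\<^bsub>E (Suc n)\<^esub>"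
    using module_homs_minus[OF E_module E_module d e(1) e'(1)] module_homsD(1)[OF d e(1)] e'(2)
      module_minus_eq_zero[OF E_module] by simp
  then have m: "e \<ominus>\<^bsub>E n\<^esub> e' \<in> carrier (cycles n)" using e(1) e'(1) by (simp add: cycles_simps a_kernel_iff)
  have "h r = r \<odot>\<^bsub>cycles n\<^esub> (e \<ominus>\<^bsub>E n\<^esub> e')" if r: "r \<in> J" for r
  proof -
    have "(\<lambda>x. r \<odot>\<^bsub>E n\<^esub> x) \<in> module_homs R (E n) (E n)"
      by (rule module_homs_smult[OF E_module _ J.Icarr[OF r]]) (auto intro: module_homsI)
    from module_homs_minus[OF E_module E_module this e(1) e'(1)]
    have "r \<odot>\<^bsub>E n\<^esub> (e \<ominus>\<^bsub>E n\<^esub> e') = r \<odot>\<^bsub>E n\<^esub> e \<ominus>\<^bsub>E n\<^esub> \<zero>\<^bsub>E n\<^esub>" using e'(3) r by simp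
    also have "\<dots> = r \<odot>\<^bsub>E n\<^esub> e"
      using En.M.minus_equality[OF En.M.l_zero[OF En.M.zero_closed] En.M.zero_closed En.M.zero_closed]
        En.smult_closed[OF J.Icarr[OF r] e(1)] by (simp add: a_minus_def)
    finally show ?thesis using e(2)[OF r] by (simp add: cycles_simps)
  qed
  then show ?thesis using m by blast
qed

text \<open>The long exact sequence of \<open>0 \<rightarrow> R/(J : x) \<rightarrow> R/J \<rightarrow> R/(J + Rx) \<rightarrow> 0\<close>.\<close>

lemma lifts_annihilated_extension:
  assumes J: "ideal J R" and x: "x \<in> carrier R"
    and colon: "lifts_annihilated {r \<in> carrier R. r \<otimes>\<^bsub>R\<^esub> x \<in> J} n"
    and sum: "lifts_annihilated (genideal R (insert x J)) n"
  shows "lifts_annihilated J n"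
  unfolding lifts_annihilated_def
proof (intro ballI impI)
  interpret R: cring R by (rule cring)
  interpret J: ideal J R by fact
  interpret En: module R "E n" by (rule E_module)
  interpret Es: module R "E (Suc n)" by (rule E_module)
  interpret Cs: module R "cycles (Suc n)" by (rule cycles_module)
  fix y assume y: "y \<in> carrier (cycles (Suc n))" and Jy: "\<forall>r\<in>J. r \<odot>\<^bsub>E (Suc n)\<^esub> y = \<zero>\<^bsub>E (Suc n)\<^esub>"
  have yE: "y \<in> carrier (E (Suc n))" by (rule cycles_closed[OF y])
  have xy: "x \<odot>\<^bsub>E (Suc n)\<^esub> y \<in> carrier (cycles (Suc n))" using Cs.smult_closed[OF x y] by (simp add: cycles_simps)
  have Jxy: "\<forall>r\<in>{r \<in> carrier R. r \<otimes>\<^bsub>R\<^esub> x \<in> J}. r \<odot>\<^bsub>E (Suc n)\<^esub> (x \<odot>\<^bsub>E (Suc n)\<^esub> y) = \<zero>\<^bsub>E (Suc n)\<^esub>"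
    using Jy by (simp flip: Es.smult_assoc1[OF _ x yE])
  obtain e1 where e1: "e1 \<in> carrier (E n)" "d n e1 = x \<odot>\<^bsub>E (Suc n)\<^esub> y"
    and e1z: "\<forall>r\<in>{r \<in> carrier R. r \<otimes>\<^bsub>R\<^esub> x \<in> J}. r \<odot>\<^bsub>E n\<^esub> e1 = \<zero>\<^bsub>E n\<^esub>"
    by (rule lifts_annihilatedE[OF colon xy Jxy])
  note reg = module_regular_module[OF cring] and sub = ideal_submodule_regular[OF cring J]
  let ?Q = "quotient_module (regular_module R) J" and ?q = "\<lambda>x. J +>\<^bsub>regular_module R\<^esub> x"
  note Q = module_quotient[OF reg sub] and q = quotient_hom[OF reg sub]
  note qD = module_homsD[OF q(1), simplified]
  \<comment> \<open>The class of \<open>x\<close> in \<open>R/J\<close> has annihilator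
    \<open>(J : x)\<close>, which kills \<open>e1\<close>, so the class can be sent to
    \<open>e1\<close>; injectivity of \<open>E n\<close> extends this to \<open>R/J\<close>. The
    image \<open>e2\<close> of one then satisfies \<open>x e2 = e1\<close> and
    \<open>J e2 = 0\<close>.\<close>
  have "\<exists>h\<in>module_homs R ?Q (E n). h (?q x) = e1"
  proof (rule hom_extend_cyclic[OF E_module Q qD(1)[OF x] e1(1)])
    show "r \<odot>\<^bsub>E n\<^esub> e1 = \<zero>\<^bsub>E n\<^esub>" if "r \<in> carrier R" "r \<odot>\<^bsub>?Q\<^esub> ?q x = \<zero>\<^bsub>?Q\<^esub>" for r
      using e1z that q(3)[of "r \<otimes>\<^bsub>R\<^esub> x"] qD(3)[OF that(1) x] x by simp
  qed (rule injective_module_ideal_hom[OF inj])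
  then obtain h where h: "h \<in> module_homs R ?Q (E n)" "h (?q x) = e1" by blast
  note hq = module_homs_comp[OF q(1) h(1)]
  note hqD = module_homsD[OF hq, simplified]
  define e2 where "e2 = h (?q \<one>\<^bsub>R\<^esub>)"
  have e2: "e2 \<in> carrier (E n)" using hqD(1) by (simp add: e2_def)
  have e2r: "h (?q r) = r \<odot>\<^bsub>E n\<^esub> e2" if "r \<in> carrier R" for r
    using hqD(3)[of r "\<one>\<^bsub>R\<^esub>"] that by (simp add: e2_def)
  have Je2: "r \<odot>\<^bsub>E n\<^esub> e2 = \<zero>\<^bsub>E n\<^esub>" if "r \<in> J" for r
    using e2r[OF J.Icarr[OF that]] q(3)[of r] that J.Icarr[OF that] module_homs_zero[OF Q E_module h(1)] by simp
  have xe2: "x \<odot>\<^bsub>E n\<^esub> e2 = e1" using e2r[OF x] h(2) by simp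
  \<comment> \<open>Subtracting \<open>d n e2\<close> leaves an element killed by \<open>J\<close>
    and also by \<open>x\<close>, so the assumption on the larger ideal applies to it.\<close>
  let ?w = "y \<ominus>\<^bsub>E (Suc n)\<^esub> d n e2"
  have de2: "d n e2 \<in> carrier (E (Suc n))" "d n e2 \<in> carrier (cycles (Suc n))"
    using module_homsD(1)[OF d e2] module_homsD(1)[OF d_cycles e2] by auto
  have wE: "?w \<in> carrier (E (Suc n))" using yE de2 by simp
  have w: "?w \<in> carrier (cycles (Suc n))"
    using module_homs_minus[OF cycles_module E_module cycles_incl y de2(2)] Cs.minus_closed[OF y de2(2)] by metis
  have rw: "r \<odot>\<^bsub>E (Suc n)\<^esub> ?w = \<zero>\<^bsub>E (Suc n)\<^esub>"
    if r: "r \<in> carrier R" "r \<odot>\<^bsub>E (Suc n)\<^esub> y = d n (r \<odot>\<^bsub>E n\<^esub> e2)" for r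
  proof -
    have "(\<lambda>x. r \<odot>\<^bsub>E (Suc n)\<^esub> x) \<in> module_homs R (E (Suc n)) (E (Suc n))"
      by (rule module_homs_smult[OF E_module _ r(1)]) (auto intro: module_homsI)
    from module_homs_minus[OF E_module E_module this yE de2(1)] show ?thesis
      using r(2) module_homsD(3)[OF d r(1) e2] module_minus_eq_zero[OF E_module] Es.smult_closed[OF r(1) yE] by simp
  qed
  have "insert x J \<subseteq> {r \<in> carrier R. r \<odot>\<^bsub>E (Suc n)\<^esub> ?w = \<zero>\<^bsub>E (Suc n)\<^esub>}"
    using rw x J.Icarr xe2 e1(2) Je2 Jy module_homs_zero[OF E_module E_module d] by auto
  then have "genideal R (insert x J) \<subseteq> {r \<in> carrier R. r \<odot>\<^bsub>E (Suc n)\<^esub> ?w = \<zero>\<^bsub>E (Suc n)\<^esub>}"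
    by (rule R.genideal_minimal[OF annihilator_ideal[OF E_module wE]])
  then have Jw: "\<forall>r\<in>genideal R (insert x J). r \<odot>\<^bsub>E (Suc n)\<^esub> ?w = \<zero>\<^bsub>E (Suc n)\<^esub>" by blast
  obtain e3 where e3: "e3 \<in> carrier (E n)" "d n e3 = ?w" "\<forall>r\<in>genideal R (insert x J). r \<odot>\<^bsub>E n\<^esub> e3 = \<zero>\<^bsub>E n\<^esub>"
    by (rule lifts_annihilatedE[OF sum w Jw])
  have "J \<subseteq> genideal R (insert x J)" using R.genideal_self[of "insert x J"] x J.a_subset by auto
  then have "r \<odot>\<^bsub>E n\<^esub> (e3 \<oplus>\<^bsub>E n\<^esub> e2) = \<zero>\<^bsub>E n\<^esub>" if "r \<in> J" for r
    using e3 e2 Je2[OF that] J.Icarr[OF that] that by (simp add: En.smult_r_distr subset_iff)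
  moreover have "d n (e3 \<oplus>\<^bsub>E n\<^esub> e2) = y"
    using module_homsD(2)[OF d e3(1) e2] e3(2) yE de2(1) by (simp add: a_minus_def Es.M.a_assoc Es.M.l_neg)
  ultimately show "\<exists>e\<in>carrier (E n). d n e = y \<and> (\<forall>r\<in>J. r \<odot>\<^bsub>E n\<^esub> e = \<zero>\<^bsub>E n\<^esub>)"
    using e3(1) e2 by (intro bexI[of _ "e3 \<oplus>\<^bsub>E n\<^esub> e2"]) auto
qed

lemma lifts_annihilated_prime:
  assumes ff: "faithfully_flat R F" and acyc: "acyclic_at F n"
    and Hn: "injective_module R (hom_module R F (cycles n))"
    and p: "primeideal p R"
    and above: "\<And>J. ideal J R \<Longrightarrow> p \<subset> J \<Longrightarrow> lifts_annihilated J (Suc n)"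
  shows "lifts_annihilated p n"
  unfolding lifts_annihilated_def
proof (intro ballI impI)
  note F = faithfully_flat_module[OF ff]
  interpret p: primeideal p R by fact
  fix y assume y: "y \<in> carrier (cycles (Suc n))" and py: "\<forall>r\<in>p. r \<odot>\<^bsub>E (Suc n)\<^esub> y = \<zero>\<^bsub>E (Suc n)\<^esub>"
  let ?Y = "hom_module R F (E n)" and ?Z = "hom_module R F (cycles (Suc n))"
  obtain \<sigma> where \<sigma>: "\<sigma> \<in> module_homs R ?Z ?Y"
    "\<And>v x. v \<in> carrier ?Z \<Longrightarrow> x \<in> carrier F \<Longrightarrow> d n (\<sigma> v x) = v x"
    using hom_section(1)[OF ff acyc Hn] by blast
  \<comment> \<open>The extension problem takes place in \<open>cycles (n + 1)\<close>, which is why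
    \<open>above\<close> speaks of \<open>n + 1\<close> and not of \<open>n\<close>.\<close>
  have "\<exists>v\<in>module_homs R F (cycles (Suc n)). \<exists>x\<in>carrier F. v x = y \<and>
      (\<forall>r\<in>p. \<forall>x\<in>carrier F. r \<odot>\<^bsub>cycles (Suc n)\<^esub> v x = \<zero>\<^bsub>cycles (Suc n)\<^esub>)"
    using py by (intro prime_annihilated_hom[OF ff p cycles_module y] lifts_annihilated_ideal_hom[OF above])
      (auto simp: cycles_simps)
  then obtain v x where v: "v \<in> module_homs R F (cycles (Suc n))" and x: "x \<in> carrier F" "v x = y"
    and pv: "\<And>r x. r \<in> p \<Longrightarrow> x \<in> carrier F \<Longrightarrow> r \<odot>\<^bsub>E (Suc n)\<^esub> v x = \<zero>\<^bsub>E (Suc n)\<^esub>"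
    by (auto simp: cycles_simps)
  let ?v = "\<lambda>x\<in>carrier F. v x"
  have vZ: "?v \<in> carrier ?Z" using module_homs_restrict[OF F v] by (simp add: hom_module_simps)
  have \<sigma>v: "\<sigma> ?v \<in> module_homs R F (E n)" using module_homsD(1)[OF \<sigma>(1) vZ] by (simp add: hom_module_simps)
  have "r \<odot>\<^bsub>E n\<^esub> \<sigma> ?v x = \<zero>\<^bsub>E n\<^esub>" if r: "r \<in> p" for r
  proof -
    \<comment> \<open>Linearity of \<open>\<sigma>\<close> over \<open>R\<close> carries
      annihilation by \<open>p\<close> from \<open>?v\<close> to its lift.\<close>
    have "r \<odot>\<^bsub>?Z\<^esub> ?v = \<zero>\<^bsub>?Z\<^esub>" using pv[OF r] by (auto simp: hom_module_simps cycles_simps fun_eq_iff)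
    then have "r \<odot>\<^bsub>?Y\<^esub> \<sigma> ?v = \<zero>\<^bsub>?Y\<^esub>"
      using module_homsD(3)[OF \<sigma>(1) p.Icarr[OF r] vZ]
        module_homs_zero[OF module_hom_module[OF F cycles_module] module_hom_module[OF F E_module] \<sigma>(1)] by simp
    from fun_cong[OF this, of x] show ?thesis using x(1) by (simp add: hom_module_simps)
  qed
  moreover have "d n (\<sigma> ?v x) = y" using \<sigma>(2)[OF vZ x(1)] x by simp
  ultimately show "\<exists>e\<in>carrier (E n). d n e = y \<and> (\<forall>r\<in>p. r \<odot>\<^bsub>E n\<^esub> e = \<zero>\<^bsub>E n\<^esub>)"
    using module_homsD(1)[OF \<sigma>v x(1)] by blast
qed

text \<open>An ideal counts as bad if it fails at some \<open>n\<close>, with \<open>n\<close> free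
  to vary: the prime step at \<open>n\<close> draws on the larger ideals at \<open>n + 1\<close>,
  and above a maximal bad ideal all ideals are good at every \<open>n\<close>.\<close>

lemma lifts_annihilated_ideal:
  assumes noeth: "noetherian_ring R" and ff: "faithfully_flat R F" and acyc: "\<And>n. acyclic_at F n"
    and H: "\<And>n. injective_module R (hom_module R F (cycles n))"
    and J: "ideal J R"
  shows "lifts_annihilated J n"
proof (rule ccontr)
  assume bad: "\<not> lifts_annihilated J n"
  interpret R: cring R by (rule cring)
  interpret N: noetherian_ring R by (rule noeth)
  let ?S = "{J. ideal J R \<and> \<not> (\<forall>n. lifts_annihilated J n)}"
  have "\<exists>p\<in>?S. \<forall>X\<in>?S. p \<subseteq> X \<longrightarrow> X = p"
  proof (rule subset_Zorn_nonempty)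
    show "?S \<noteq> {}" using J bad by blast
    fix C assume C: "C \<noteq> {}" "subset.chain ?S C"
    have "subset.chain {I. ideal I R} C" using C(2) by (auto simp: subset_chain_def)
    \<comment> \<open>A nonempty chain of ideals in a noetherian ring contains its union, so the
      union is again bad.\<close>
    from N.ideal_chain_is_trivial[OF C(1) this] show "\<Union>C \<in> ?S" using C(2) by (auto simp: subset_chain_def)
  qed
  then obtain p where p: "ideal p R" "\<not> (\<forall>n. lifts_annihilated p n)"
    and max: "\<And>X. X \<in> ?S \<Longrightarrow> p \<subseteq> X \<Longrightarrow> X = p" by blast
  interpret p: ideal p R by (rule p(1))
  have above: "lifts_annihilated X n" if "ideal X R" "p \<subset> X" for X n
    using max[of X] that by blast
  have "primeideal p R"
  proof (rule primeidealI[OF p(1) cring])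
    \<comment> \<open>The whole ring is never bad: an element killed by one is zero and lifts to
      zero.\<close>
    show "carrier R \<noteq> p"
    proof
      assume eq: "carrier R = p"
      have "lifts_annihilated p n" for n
        unfolding lifts_annihilated_def
      proof (intro ballI impI)
        interpret En: module R "E n" by (rule E_module)
        interpret Es: module R "E (Suc n)" by (rule E_module)
        fix y assume "y \<in> carrier (cycles (Suc n))" and py: "\<forall>r\<in>p. r \<odot>\<^bsub>E (Suc n)\<^esub> y = \<zero>\<^bsub>E (Suc n)\<^esub>"
        then have "y = \<zero>\<^bsub>E (Suc n)\<^esub>"
          using Es.smult_one[OF cycles_closed] R.one_closed eq by metis
        then show "\<exists>e\<in>carrier (E n). d n e = y \<and> (\<forall>r\<in>p. r \<odot>\<^bsub>E n\<^esub> e = \<zero>\<^bsub>E n\<^esub>)"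
          using module_homs_zero[OF E_module E_module d] eq by (intro bexI[of _ "\<zero>\<^bsub>E n\<^esub>"]) auto
      qed
      then show False using p(2) by blast
    qed
    fix a b assume a: "a \<in> carrier R" and b: "b \<in> carrier R" and ab: "a \<otimes>\<^bsub>R\<^esub> b \<in> p"
    show "a \<in> p \<or> b \<in> p"
    proof (rule ccontr)
      assume n: "\<not> (a \<in> p \<or> b \<in> p)"
      note reg = module_regular_module[OF cring] and sub = ideal_submodule_regular[OF cring p(1)]
      note Q = module_quotient[OF reg sub] and q = quotient_hom[OF reg sub]
      note qD = module_homsD[OF q(1), simplified]
      \<comment> \<open>The colon ideal is recognised as the annihilator of the class of
        \<open>b\<close> in \<open>R/p\<close>.\<close>
      have "r \<odot>\<^bsub>quotient_module (regular_module R) p\<^esub> (p +>\<^bsub>regular_module R\<^esub> b) =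
          \<zero>\<^bsub>quotient_module (regular_module R) p\<^esub> \<longleftrightarrow> r \<otimes>\<^bsub>R\<^esub> b \<in> p" if "r \<in> carrier R" for r
        using q(3)[of "r \<otimes>\<^bsub>R\<^esub> b"] qD(3)[OF that b] that b by simp
      then have "{r \<in> carrier R. r \<odot>\<^bsub>quotient_module (regular_module R) p\<^esub> (p +>\<^bsub>regular_module R\<^esub> b) =
          \<zero>\<^bsub>quotient_module (regular_module R) p\<^esub>} = {r \<in> carrier R. r \<otimes>\<^bsub>R\<^esub> b \<in> p}" by blast
      then have colon: "ideal {r \<in> carrier R. r \<otimes>\<^bsub>R\<^esub> b \<in> p} R"
        using annihilator_ideal[OF Q qD(1)[OF b]] by simp
      \<comment> \<open>\<open>(p : b)\<close> contains \<open>a\<close>, and the ideal generated by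
        \<open>p\<close> and \<open>b\<close> contains \<open>b\<close>, so both are strictly larger
        than \<open>p\<close> and good at every \<open>n\<close>; the extension lemma would then
        make \<open>p\<close> good.\<close>
      have "p \<subset> {r \<in> carrier R. r \<otimes>\<^bsub>R\<^esub> b \<in> p}" using n a b ab p.I_r_closed p.Icarr by blast
      note c = above[OF colon this]
      have ins: "insert b p \<subseteq> carrier R" using b p.a_subset by auto
      then have "p \<subset> genideal R (insert b p)" using R.genideal_self[OF ins] n by blast
      note s = above[OF R.genideal_ideal[OF ins] this]
      show False using p(2) lifts_annihilated_extension[OF p(1) b c s] by blast
    qed
  qed
  then show False using p(2) lifts_annihilated_prime[OF ff acyc H _ above] by blast
qed

lemma injective_if_lifts_annihilated:
  assumes "\<And>J. ideal J R \<Longrightarrow> lifts_annihilated J 0"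
  shows "injective_module R M"
proof -
  have "injective_module R (cycles 0)"
    by (rule injective_module_via_ideals[OF cycles_module]) (rule lifts_annihilated_ideal_hom[OF assms])
  moreover obtain \<kappa> where "\<kappa> \<in> module_homs R (cycles 0) M" "\<And>x. x \<in> carrier M \<Longrightarrow> \<kappa> (\<iota> x) = x"
    using \<iota>_inverse by blast
  ultimately show ?thesis using injective_module_retract[OF _ mod \<iota>_cycles] by blast
qed

end

theorem mainTheorem2:
  fixes R :: "'a ring" and F :: "('a, 'f) module" and M :: "('a, 'm) module"
  assumes "cring R" and "noetherian_ring R"
    and "module R F" and "faithfully_flat R F"
    and "module R M"
    and "\<And>i. i > 0 \<Longrightarrow> carrier (Ext R i F M) = {\<zero>\<^bsub>Ext R i F M\<^esub>}"
  shows "injective_module R (hom_module R F M) \<longleftrightarrow> injective_module R M"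
proof
  assume "injective_module R M"
  then show "injective_module R (hom_module R F M)" by (rule hom_module_injective[OF assms(4)])
next
  assume H: "injective_module R (hom_module R F M)"
  obtain E :: "nat \<Rightarrow> ('a, ('a, 'm) resolution_elem) module" and \<iota> d where "injective_resolution R M E \<iota> d"
    using injective_resolution_exists[OF assms(1,5)] by blast
  then interpret injective_resolution R M E \<iota> d .
  note h = hom_cycles_injective[OF assms(4) acyclic_at_0[OF assms(3,6)] H]
  show "injective_module R M"
    by (rule injective_if_lifts_annihilated[OF lifts_annihilated_ideal[OF assms(2,4)]]) (use h in blast)+
qed

end
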